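(* For all integers $s\geq 1$ and $m\geq 1$, the Euler characteristic of the moduli space $X_s^m=\mathcal{MCG}_{1,s}^m$ of $m$-colored one-loop graphs with $s$ legs is $$\chi(X_s^m)=2^{s-1}\,\frac{m(1-m)}{2}+\frac{m(m+1)}{2}+\sum_{k=3}^{s}(-1)^{k-1}\,S(s,k)\,\frac{(k-1)!}{2}\,m^k,$$ where $S(s,k)$ denotes the Stirling number of the second kind (the number of partitions of an $s$-element set into $k$ non-empty blocks).
   Context: Graphs are finite non-empty multigraphs (self-loops and multiple edges allowed) with a set $E(G)$ of internal edges and $s$ external legs labeled bijectively by $1,\ldots,s$, each leg attached to a vertex. The valency of a vertex is the number of half-edges at it (legs count once, self-loops twice). A graph is admissible if it is connected, stays connected upon removal of any single internal edge, and all vertices have valency $\geq 3$. Its rank is its first Betti number. Hence an admissible graph of rank one with $s$ legs is a cycle with $k$ vertices and $k$ internal edges, $1\leq k\leq s$ ($k=1$: one vertex with a self-loop; $k=2$: two vertices joined by a double edge), each vertex carrying at least one leg. An $m$-coloring is any map $c:E(G)\to\{1,\ldots,m\}$. A metric $\lambda:E(G)\to\mathbb{R}_{\geq 0}$ is regular if $Z=\{e:\lambda(e)=0\}$ is (the edge set of) a forest; in rank one this means $\lambda\not\equiv 0$. $G/Z$ denotes $G$ with the edges of $Z$ collapsed. The points of $X_s^m$ are the triples $(G,\lambda,c)$ with $G$ admissible of rank one with $s$ legs, $\lambda$ a regular metric, $c$ an $m$-coloring, modulo the relation: $(G,\lambda,c)\sim(G',\lambda',c')$ iff, with $Z,Z'$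 the zero sets of $\lambda,\lambda'$, there are a graph isomorphism $\varphi:G/Z\to G'/Z'$ preserving the leg labels and a constant $a>0$ with $\lambda'\circ\varphi=a\lambda$ and $c'\circ\varphi=c$ on $E(G)\setminus Z$. Topology: for each isomorphism class of pairs $(G,c)$ the regular metrics of total length $1$ form a closed simplex of dimension $|E(G)|-1$; $X_s^m$ carries the quotient topology from the disjoint union of these simplices. *)

theory Defs
  imports
    "HOL-Homology.Homology"
    "HOL-Library.Uprod"
    "HOL-Combinatorics.Stirling"
begin

section \<open>Multigraphs with labelled legs\<close>

record ('v, 'e) legged_graph =
  verts :: "'v set"
  edges :: "'e set"
  ends :: "'e \<Rightarrow> 'v uprod"
  leg :: "nat \<Rightarrow> 'v"

text \<open>An internal edge is a self-loop if its ends are \<open>Upair v v\<close>; the leg labelled \<open>i\<close>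
  is attached to the vertex \<open>leg G i\<close>.\<close>

definition is_graph :: "nat \<Rightarrow> ('v, 'e) legged_graph \<Rightarrow> bool" where
  "is_graph s G \<longleftrightarrow>
     finite (verts G) \<and> verts G \<noteq> {} \<and> finite (edges G) \<and>
     ends G \<in> extensional (edges G) \<and>
     (\<forall>e\<in>edges G. set_uprod (ends G e) \<subseteq> verts G) \<and>
     leg G \<in> {1..s} \<rightarrow>\<^sub>E verts G"

definition valency :: "nat \<Rightarrow> ('v, 'e) legged_graph \<Rightarrow> 'v \<Rightarrow> nat" where
  "valency s G v =
     card {e \<in> edges G. v \<in> set_uprod (ends G e)} + card {e \<in> edges G. ends G e = Upair v v} +
     card {i \<in> {1..s}. leg G i = v}"

text \<open>Two vertices are related if they are joined by a path all of whose edges lie in \<open>F\<close>.\<close>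

definition joined_by :: "('v, 'e) legged_graph \<Rightarrow> 'e set \<Rightarrow> 'v rel" where
  "joined_by G F =
     {(x, y). \<exists>e\<in>F. ends G e = Upair x y}\<^sup>* \<inter> (verts G \<times> verts G)"

definition connected_by :: "('v, 'e) legged_graph \<Rightarrow> 'e set \<Rightarrow> bool" where
  "connected_by G F \<longleftrightarrow> verts G \<noteq> {} \<and> (\<forall>u\<in>verts G. \<forall>v\<in>verts G. (u, v) \<in> joined_by G F)"

definition first_betti :: "('v, 'e) legged_graph \<Rightarrow> int" where
  "first_betti G =
     int (card (edges G)) - int (card (verts G)) + int (card (verts G // joined_by G (edges G)))"

definition admissible :: "nat \<Rightarrow> ('v, 'e) legged_graph \<Rightarrow> bool" where
  "admissible s G \<longleftrightarrow>
     is_graph s G \<and> connected_by G (edges G) \<and>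
     (\<forall>e\<in>edges G. connected_by G (edges G - {e})) \<and>
     (\<forall>v\<in>verts G. valency s G v \<ge> 3)"

text \<open>A self-loop is a cycle of length one and a pair of parallel edges is a cycle of length two.\<close>

definition is_cycle :: "('v, 'e) legged_graph \<Rightarrow> 'e list \<Rightarrow> 'v list \<Rightarrow> bool" where
  "is_cycle G es vs \<longleftrightarrow>
     es \<noteq> [] \<and> length vs = length es \<and> distinct es \<and> distinct vs \<and>
     set es \<subseteq> edges G \<and> set vs \<subseteq> verts G \<and>
     (\<forall>i<length es. ends G (es ! i) = Upair (vs ! i) (vs ! (Suc i mod length vs)))"

definition is_forest :: "('v, 'e) legged_graph \<Rightarrow> 'e set \<Rightarrow> bool" where
  "is_forest G Z \<longleftrightarrow> Z \<subseteq> edges G \<and> (\<nexists>es vs. is_cycle G es vs \<and> set es \<subseteq> Z)"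

definition collapse :: "('v, 'e) legged_graph \<Rightarrow> 'e set \<Rightarrow> ('v set, 'e) legged_graph" where
  "collapse G Z =
     \<lparr>verts = verts G // joined_by G Z,
      edges = edges G - Z,
      ends = (\<lambda>e. map_uprod (\<lambda>v. joined_by G Z `` {v}) (ends G e)),
      leg = (\<lambda>i. joined_by G Z `` {leg G i})\<rparr>"

text \<open>Isomorphisms are given by their action on vertices and edges. Half-edges are not
  represented; whether an isomorphism flips a self-loop is irrelevant for metrics and colorings.\<close>

definition graph_iso ::
  "nat \<Rightarrow> ('v, 'e) legged_graph \<Rightarrow> ('w, 'f) legged_graph \<Rightarrow> ('v \<Rightarrow> 'w) \<Rightarrow> ('e \<Rightarrow> 'f) \<Rightarrow> bool" where
  "graph_iso s G H f \<phi> \<longleftrightarrow>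
     bij_betw f (verts G) (verts H) \<and> bij_betw \<phi> (edges G) (edges H) \<and>
     (\<forall>e\<in>edges G. ends H (\<phi> e) = map_uprod f (ends G e)) \<and>
     (\<forall>i\<in>{1..s}. leg H i = f (leg G i))"


section \<open>Colored metric graphs\<close>

definition zero_edges :: "('v, 'e) legged_graph \<Rightarrow> ('e \<Rightarrow> real) \<Rightarrow> 'e set" where
  "zero_edges G l = {e \<in> edges G. l e = 0}"

definition regular_metrics :: "('v, 'e) legged_graph \<Rightarrow> ('e \<Rightarrow> real) set" where
  "regular_metrics G = {l \<in> edges G \<rightarrow>\<^sub>E {0..}. is_forest G (zero_edges G l)}"

definition colorings :: "nat \<Rightarrow> ('v, 'e) legged_graph \<Rightarrow> ('e \<Rightarrow> nat) set" where
  "colorings m G = edges G \<rightarrow>\<^sub>E {1..m}"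

text \<open>Every finite graph is isomorphic to one whose vertices and edges are natural numbers.\<close>

type_synonym ngraph = "(nat, nat) legged_graph"
type_synonym colored_metric_graph = "ngraph \<times> (nat \<Rightarrow> real) \<times> (nat \<Rightarrow> nat)"

definition one_loop_graphs :: "nat \<Rightarrow> ngraph set" where
  "one_loop_graphs s = {G. admissible s G \<and> first_betti G = 1}"

definition colored_metric_graphs :: "nat \<Rightarrow> nat \<Rightarrow> colored_metric_graph set" where
  "colored_metric_graphs s m =
     {(G, l, c). G \<in> one_loop_graphs s \<and> l \<in> regular_metrics G \<and> c \<in> colorings m G}"

definition cmg_rel :: "nat \<Rightarrow> nat \<Rightarrow> colored_metric_graph rel" where
  "cmg_rel s m =
     {((G, l, c), (G', l', c')).
        (G, l, c) \<in> colored_metric_graphs s m \<and> (G', l', c') \<in> colored_metric_graphs s m \<and>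
        (\<exists>f \<phi> a. graph_iso s (collapse G (zero_edges G l)) (collapse G' (zero_edges G' l')) f \<phi> \<and>
           a > 0 \<and>
           (\<forall>e \<in> edges G - zero_edges G l. l' (\<phi> e) = a * l e \<and> c' (\<phi> e) = c e))}"


section \<open>The moduli space\<close>

text \<open>The finest topology on \<open>f ` topspace X\<close> for which \<open>f\<close> is continuous.\<close>

definition quotient_topology :: "'a topology \<Rightarrow> ('a \<Rightarrow> 'b) \<Rightarrow> 'b topology" where
  "quotient_topology X f =
     topology (\<lambda>U. U \<subseteq> f ` topspace X \<and> openin X {x \<in> topspace X. f x \<in> U})"

lemma openin_quotient_topology:
  "openin (quotient_topology X f) U \<longleftrightarrow>
     U \<subseteq> f ` topspace X \<and> openin X {x \<in> topspace X. f x \<in> U}"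
proof -
  have "istopology (\<lambda>U. U \<subseteq> f ` topspace X \<and> openin X {x \<in> topspace X. f x \<in> U})"
    unfolding istopology_def
  proof (intro conjI allI impI)
    fix S T
    assume "S \<subseteq> f ` topspace X \<and> openin X {x \<in> topspace X. f x \<in> S}"
      and "T \<subseteq> f ` topspace X \<and> openin X {x \<in> topspace X. f x \<in> T}"
    moreover have "{x \<in> topspace X. f x \<in> S \<inter> T} =
        {x \<in> topspace X. f x \<in> S} \<inter> {x \<in> topspace X. f x \<in> T}" by auto
    ultimately show "S \<inter> T \<subseteq> f ` topspace X" "openin X {x \<in> topspace X. f x \<in> S \<inter> T}"
      by auto
  next
    fix \<K>
    assume *: "\<forall>K\<in>\<K>. K \<subseteq> f ` topspace X \<and> openin X {x \<in> topspace X. f x \<in> K}"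
    then show "\<Union>\<K> \<subseteq> f ` topspace X" by blast
    have "{x \<in> topspace X. f x \<in> \<Union>\<K>} = (\<Union>K\<in>\<K>. {x \<in> topspace X. f x \<in> K})" by auto
    with * show "openin X {x \<in> topspace X. f x \<in> \<Union>\<K>}" by auto
  qed
  then show ?thesis
    by (simp add: quotient_topology_def topology_inverse')
qed

lemma topspace_quotient_topology [simp]: "topspace (quotient_topology X f) = f ` topspace X"
proof
  show "topspace (quotient_topology X f) \<subseteq> f ` topspace X"
    using openin_topspace[of "quotient_topology X f"] unfolding openin_quotient_topology by (rule conjunct1)
  have "{x \<in> topspace X. f x \<in> f ` topspace X} = topspace X" by auto
  then have "openin (quotient_topology X f) (f ` topspace X)"
    by (simp add: openin_quotient_topology)
  then show "f ` topspace X \<subseteq> topspace (quotient_topology X f)"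
    by (rule openin_subset)
qed

lemma quotient_map_quotient_topology: "quotient_map X (quotient_topology X f) f"
  by (auto simp: quotient_map_def openin_quotient_topology)

text \<open>For a one-loop graph these are all points of the standard closed simplex spanned by
  the edges of \<open>G\<close>.\<close>

definition metric_simplex :: "('v, 'e) legged_graph \<Rightarrow> ('e \<Rightarrow> real) topology" where
  "metric_simplex G =
     subtopology (powertop_real (edges G)) {l \<in> regular_metrics G. (\<Sum>e\<in>edges G. l e) = 1}"

text \<open>The disjoint union is indexed by all pairs \<open>(G, c)\<close> instead of one representative of each
  isomorphism class. Isomorphic pairs contribute homeomorphic simplices with the same image, so
  the quotient topology is the same. Every class of \<open>cmg_rel\<close> has a member of total length one:
  a regular metric on a one-loop graph is not identically zero and can be rescaled.\<close>

definition colored_simplices ::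
  "nat \<Rightarrow> nat \<Rightarrow> ((ngraph \<times> (nat \<Rightarrow> nat)) \<times> (nat \<Rightarrow> real)) topology" where
  "colored_simplices s m =
     sum_topology (\<lambda>(G, c). metric_simplex G) (SIGMA G : one_loop_graphs s. colorings m G)"

definition MCG1 :: "nat \<Rightarrow> nat \<Rightarrow> colored_metric_graph set topology" where
  "MCG1 s m =
     quotient_topology (colored_simplices s m) (\<lambda>((G, c), l). cmg_rel s m `` {(G, l, c)})"

lemma equiv_joined_by: "equiv (verts G) (joined_by G F)"
proof -
  let ?r = "{(x, y). \<exists>e\<in>F. ends G e = Upair x y}"
  have "sym ?r"
  proof (rule symI)
    fix x y assume "(x, y) \<in> ?r"
    moreover have "Upair x y = Upair y x" by simp
    ultimately show "(y, x) \<in> ?r" by auto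
  qed
  then have "sym (?r\<^sup>*)"
    by (rule sym_rtrancl)
  moreover have "trans (?r\<^sup>*)" "refl (?r\<^sup>*)"
    by (rule trans_rtrancl, rule refl_rtrancl)
  ultimately have "sym (joined_by G F)" "trans (joined_by G F)" "refl_on (verts G) (joined_by G F)"
    "joined_by G F \<subseteq> verts G \<times> verts G"
    unfolding joined_by_def sym_def trans_def refl_on_def by blast+
  then show ?thesis
    by (simp add: equiv_def)
qed

lemma uprod_bij_inv:
  assumes "bij_betw f A B" "set_uprod x \<subseteq> A"
  shows "map_uprod (inv_into A f) (map_uprod f x) = x"
  using assms by (cases x) (auto simp: bij_betw_def)

lemma graph_iso_sym:
  assumes iso: "graph_iso s G H f \<phi>"
    and ends: "\<forall>e\<in>edges G. set_uprod (ends G e) \<subseteq> verts G"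
    and legs: "\<forall>i\<in>{1..s}. leg G i \<in> verts G"
  shows "graph_iso s H G (inv_into (verts G) f) (inv_into (edges G) \<phi>)"
proof -
  have f: "bij_betw f (verts G) (verts H)" and p: "bij_betw \<phi> (edges G) (edges H)"
    using iso by (auto simp: graph_iso_def)
  have "ends G (inv_into (edges G) \<phi> e) = map_uprod (inv_into (verts G) f) (ends H e)"
    if e: "e \<in> edges H" for e
  proof -
    obtain d where d: "d \<in> edges G" "e = \<phi> d"
      using e p by (auto simp: bij_betw_def)
    then have "inv_into (edges G) \<phi> e = d"
      using p by (auto simp: bij_betw_def)
    moreover have "ends H e = map_uprod f (ends G d)"
      using iso d by (auto simp: graph_iso_def)
    ultimately show ?thesis
      using uprod_bij_inv[OF f] ends d by auto
  qed
  moreover have "leg G i = inv_into (verts G) f (leg H i)" if "i \<in> {1..s}" for i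
    using that iso legs f by (auto simp: graph_iso_def bij_betw_def)
  ultimately show ?thesis
    using f p by (auto simp: graph_iso_def bij_betw_inv_into)
qed

lemma graph_iso_trans:
  assumes "graph_iso s G H f \<phi>" "graph_iso s H K g \<psi>"
  shows "graph_iso s G K (g \<circ> f) (\<psi> \<circ> \<phi>)"
proof -
  have "\<phi> e \<in> edges H" if "e \<in> edges G" for e
    using assms(1) that by (auto simp: graph_iso_def bij_betw_def)
  moreover have "bij_betw (g \<circ> f) (verts G) (verts K)" "bij_betw (\<psi> \<circ> \<phi>) (edges G) (edges K)"
    using assms by (meson bij_betw_trans graph_iso_def)+
  ultimately show ?thesis
    using assms by (simp add: graph_iso_def uprod.map_comp)
qed

lemma
  assumes "is_graph s G"
  shows collapse_ends: "\<forall>e\<in>edges (collapse G Z).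
      set_uprod (ends (collapse G Z) e) \<subseteq> verts (collapse G Z)"
    and collapse_legs: "\<forall>i\<in>{1..s}. leg (collapse G Z) i \<in> verts (collapse G Z)"
  using assms by (fastforce simp: collapse_def is_graph_def uprod.set_map PiE_iff intro: quotientI)+

lemma cmg_rel_equiv: "equiv (colored_metric_graphs s m) (cmg_rel s m)"
proof (rule equivI)
  show "cmg_rel s m \<subseteq> colored_metric_graphs s m \<times> colored_metric_graphs s m"
    by (auto simp: cmg_rel_def)
  show "refl_on (colored_metric_graphs s m) (cmg_rel s m)"
  proof (rule refl_onI)
    fix x assume x: "x \<in> colored_metric_graphs s m"
    obtain G l c where [simp]: "x = (G, l, c)" by (cases x)
    have "graph_iso s (collapse G (zero_edges G l)) (collapse G (zero_edges G l)) id id"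
      by (auto simp: graph_iso_def uprod.map_id)
    moreover have "(0 :: real) < 1"
      "\<forall>e \<in> edges G - zero_edges G l. l (id e) = 1 * l e \<and> c (id e) = c e"
      by simp_all
    ultimately have "\<exists>f \<phi> a.
        graph_iso s (collapse G (zero_edges G l)) (collapse G (zero_edges G l)) f \<phi> \<and>
        a > 0 \<and> (\<forall>e \<in> edges G - zero_edges G l. l (\<phi> e) = a * l e \<and> c (\<phi> e) = c e)"
      by blast
    then show "(x, x) \<in> cmg_rel s m"
      using x by (simp add: cmg_rel_def)
  qed
  show "sym (cmg_rel s m)"
  proof (rule symI)
    fix x y assume xy: "(x, y) \<in> cmg_rel s m"
    obtain G l c G' l' c' where [simp]: "x = (G, l, c)" "y = (G', l', c')"
      by (cases x, cases y)
    let ?H = "collapse G (zero_edges G l)" and ?H' = "collapse G' (zero_edges G' l')"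
    from xy obtain f \<phi> a where iso: "graph_iso s ?H ?H' f \<phi>" and a: "a > 0"
      and lc: "\<forall>e \<in> edges G - zero_edges G l. l' (\<phi> e) = a * l e \<and> c' (\<phi> e) = c e"
      by (auto simp: cmg_rel_def)
    have G: "is_graph s G"
      using xy by (simp add: cmg_rel_def colored_metric_graphs_def one_loop_graphs_def
          admissible_def)
    let ?\<psi> = "inv_into (edges ?H) \<phi>"
    have "graph_iso s ?H' ?H (inv_into (verts ?H) f) ?\<psi>"
      using graph_iso_sym[OF iso collapse_ends[OF G] collapse_legs[OF G]] .
    moreover have "l (?\<psi> e) = inverse a * l' e \<and> c (?\<psi> e) = c' e"
      if "e \<in> edges G' - zero_edges G' l'" for e
    proof -
      have bij: "bij_betw \<phi> (edges ?H) (edges ?H')" and "e \<in> edges ?H'"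
        using iso that by (auto simp: graph_iso_def collapse_def)
      then obtain d where d: "d \<in> edges ?H" "e = \<phi> d"
        by (auto simp: bij_betw_def)
      then have "?\<psi> e = d"
        using bij by (auto simp: bij_betw_def)
      moreover have "l' e = a * l d \<and> c' e = c d"
        using d lc by (auto simp: collapse_def)
      ultimately show ?thesis
        using a by simp
    qed
    moreover have "inverse a > 0"
      using a by simp
    ultimately have "\<exists>f \<phi> a. graph_iso s ?H' ?H f \<phi> \<and> a > 0 \<and>
        (\<forall>e \<in> edges G' - zero_edges G' l'. l (\<phi> e) = a * l' e \<and> c (\<phi> e) = c' e)"
      by blast
    then show "(y, x) \<in> cmg_rel s m"
      using xy by (simp add: cmg_rel_def)
  qed
  show "trans (cmg_rel s m)"
  proof (rule transI)
    fix x y z assume xy: "(x, y) \<in> cmg_rel s m" and yz: "(y, z) \<in> cmg_rel s m"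
    obtain G l c G' l' c' G'' l'' c''
      where [simp]: "x = (G, l, c)" "y = (G', l', c')" "z = (G'', l'', c'')"
      by (cases x, cases y, cases z)
    let ?H = "collapse G (zero_edges G l)" and ?H' = "collapse G' (zero_edges G' l')"
      and ?H'' = "collapse G'' (zero_edges G'' l'')"
    from xy obtain f \<phi> a where 1: "graph_iso s ?H ?H' f \<phi>" "a > 0"
      "\<forall>e \<in> edges G - zero_edges G l. l' (\<phi> e) = a * l e \<and> c' (\<phi> e) = c e"
      by (auto simp: cmg_rel_def)
    from yz obtain g \<psi> b where 2: "graph_iso s ?H' ?H'' g \<psi>" "b > 0"
      "\<forall>e \<in> edges G' - zero_edges G' l'. l'' (\<psi> e) = b * l' e \<and> c'' (\<psi> e) = c' e"
      by (auto simp: cmg_rel_def)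
    have "\<phi> e \<in> edges G' - zero_edges G' l'" if "e \<in> edges G - zero_edges G l" for e
      using 1(1) that by (auto simp: graph_iso_def collapse_def bij_betw_def)
    then have "\<forall>e \<in> edges G - zero_edges G l.
        l'' ((\<psi> \<circ> \<phi>) e) = (b * a) * l e \<and> c'' ((\<psi> \<circ> \<phi>) e) = c e"
      using 1(3) 2(3) by simp
    moreover have "graph_iso s ?H ?H'' (g \<circ> f) (\<psi> \<circ> \<phi>)"
      using graph_iso_trans 1(1) 2(1) by blast
    moreover have "b * a > 0"
      using 1(2) 2(2) by simp
    ultimately have "\<exists>f \<phi> a. graph_iso s ?H ?H'' f \<phi> \<and> a > 0 \<and>
        (\<forall>e \<in> edges G - zero_edges G l. l'' (\<phi> e) = a * l e \<and> c'' (\<phi> e) = c e)"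
      by blast
    then show "(x, z) \<in> cmg_rel s m"
      using xy yz by (simp add: cmg_rel_def)
  qed
qed


section \<open>Euler characteristic\<close>

definition int_independent :: "('a, 'b) monoid_scheme \<Rightarrow> 'a set \<Rightarrow> bool" where
  "int_independent A B \<longleftrightarrow>
     finite B \<and> B \<subseteq> carrier A \<and>
     (\<forall>k :: 'a \<Rightarrow> int. finprod A (\<lambda>x. x [^]\<^bsub>A\<^esub> k x) B = \<one>\<^bsub>A\<^esub> \<longrightarrow> (\<forall>x\<in>B. k x = 0))"

text \<open>The rank of an abelian group: the largest size of a linearly independent set over the
  integers. The supremum is a junk value unless \<open>finite_rank\<close> holds.\<close>

definition finite_rank :: "('a, 'b) monoid_scheme \<Rightarrow> bool" where
  "finite_rank A \<longleftrightarrow> bdd_above (card ` {B. int_independent A B})"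

definition abelian_rank :: "('a, 'b) monoid_scheme \<Rightarrow> nat" where
  "abelian_rank A = Sup (card ` {B. int_independent A B})"

definition betti_number :: "nat \<Rightarrow> 'a topology \<Rightarrow> nat" where
  "betti_number p X = abelian_rank (homology_group (int p) X)"

definition has_finite_betti_numbers :: "'a topology \<Rightarrow> bool" where
  "has_finite_betti_numbers X \<longleftrightarrow>
     (\<forall>p. finite_rank (homology_group (int p) X)) \<and> finite {p. betti_number p X \<noteq> 0}"

definition euler_characteristic :: "'a topology \<Rightarrow> int" where
  "euler_characteristic X = (\<Sum>p | betti_number p X \<noteq> 0. (-1) ^ p * int (betti_number p X))"

end

theory Submission
  imports
    Defs
    "HOL-Analysis.Abstract_Topological_Spaces"
begin

text \<open>
  The moduli space is a finite cell complex, and attaching an \<open>n\<close>-cell changes the Euler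
  characteristic by \<open>(-1)\<^sup>n\<close>: removing the center of the cell leaves a space that retracts onto
  the smaller complex, and excision and the long exact sequence reduce the difference to an open
  simplex and its punctured version, a sphere up to homotopy.

  Contracting edges of length zero brings every point to a cycle with \<open>k\<close> vertices and positive
  edge lengths, with leg 1 at vertex 0. Such a cycle is a surjective labelling by \<open>{..<k}\<close> together
  with a coloring, and the only remaining ambiguity is the reflection of the cycle. For \<open>k \<ge> 3\<close>
  the reflection acts freely, which yields \<open>S(s,k) (k-1)! m\<^sup>k / 2\<close> cells of dimension \<open>k - 1\<close>. For
  \<open>k = 2\<close> it fixes the words whose two edges have the same color; there it folds the open edge to a
  half-open interval, which contributes nothing. The characteristic maps are closed because the
  points of one simplex related to a closed set of another form a finite union of closed sets,
  indexed by isomorphisms between collapsed graphs.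
\<close>

section \<open>Ranks of abelian groups\<close>

text \<open>Two obstacles shape the development. First, Betti numbers are ranks over the integers,
  and torsion rules out bases: a maximal independent set spans each element only up to a nonzero
  multiple. The rank arithmetic therefore works with multiples throughout, and finiteness is carried
  along with every Euler characteristic, because \<open>abelian_rank\<close> means nothing without
  it. Second, the moduli space is a quotient of infinitely many simplices, one for each colored
  graph on natural numbers, so neither compactness nor the Hausdorff property comes for free.
  Closedness of the characteristic maps replaces both: it makes open cells homeomorphic to open
  simplices, makes finite unions of closed cells closed, and lets homotopies descend from the
  simplex. This closedness is itself delicate, since \<open>cmg_rel\<close> speaks of exact zero
  sets, and having exactly a given zero set is not a closed condition on metrics. The remedy is to
  require only that a metric vanishes on a given set, and to let further zero edges be collapsed on
  both sides simultaneously.\<close>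

text \<open>Fraction-free Gaussian elimination: a pivot row clears one column by
  cross-multiplication, so all coefficients stay integers.\<close>

lemma int_rows_dependent:
  fixes a :: "'a \<Rightarrow> 'b \<Rightarrow> int"
  assumes "finite J" "finite R" "card J < card R"
  shows "\<exists>k. (\<exists>i\<in>R. k i \<noteq> 0) \<and> (\<forall>j\<in>J. (\<Sum>i\<in>R. k i * a i j) = 0)"
  using assms
proof (induction J arbitrary: R a rule: finite_induct)
  case empty
  then show ?case
    by (intro exI[of _ "\<lambda>_. 1"]) (auto simp: card_gt_0_iff)
next
  case (insert j J)
  show ?case
  proof (cases "\<forall>i\<in>R. a i j = 0")
    case True
    obtain k where "\<exists>i\<in>R. k i \<noteq> 0" "\<forall>j\<in>J. (\<Sum>i\<in>R. k i * a i j) = 0"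
      using insert.IH[of R a] insert.prems insert.hyps by auto
    with True show ?thesis
      by (intro exI[of _ k]) auto
  next
    case False
    then obtain p where p: "p \<in> R" "a p j \<noteq> 0" by auto
    define b where "b i t = a p j * a i t - a i j * a p t" for i t
    have "finite (R - {p})" "card J < card (R - {p})"
      using insert.prems insert.hyps p by auto
    from insert.IH[OF this, of b] obtain k
      where k: "\<exists>i\<in>R - {p}. k i \<noteq> 0" "\<forall>t\<in>J. (\<Sum>i\<in>R - {p}. k i * b i t) = 0"
      by auto
    \<comment> \<open>Undoing the cross-multiplication: each coefficient is scaled by the pivot
      entry, and the pivot row absorbs all subtracted copies of itself. Nonzero coefficients stay
      nonzero because \<open>a p j\<close> is.\<close>
    define k' where "k' i = (if i = p then - (\<Sum>i\<in>R - {p}. k i * a i j) else k i * a p j)" for i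
    have sum: "(\<Sum>i\<in>R. k' i * a i t) = (\<Sum>i\<in>R - {p}. k i * b i t)" for t
    proof -
      have "(\<Sum>i\<in>R. k' i * a i t) = k' p * a p t + (\<Sum>i\<in>R - {p}. k' i * a i t)"
        using p insert.prems by (simp add: sum.remove)
      also have "(\<Sum>i\<in>R - {p}. k' i * a i t) = (\<Sum>i\<in>R - {p}. k i * a p j * a i t)"
        by (intro sum.cong) (auto simp: k'_def)
      also have "k' p * a p t = (\<Sum>i\<in>R - {p}. - (k i * a i j * a p t))"
        by (simp add: k'_def sum_distrib_right sum_negf)
      finally show ?thesis
        by (simp add: b_def algebra_simps flip: sum.distrib)
    qed
    have "\<exists>i\<in>R. k' i \<noteq> 0"
      using k(1) p(2) by (auto simp: k'_def)
    moreover have "(\<Sum>i\<in>R - {p}. k i * b i j) = 0"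
      by (simp add: b_def)
    ultimately show ?thesis
      using k(2) sum by (intro exI[of _ k']) auto
  qed
qed

section \<open>Linear combinations and ranks of subsets\<close>

definition lincomb :: "('a, 'b) monoid_scheme \<Rightarrow> 'a set \<Rightarrow> ('a \<Rightarrow> int) \<Rightarrow> 'a" where
  "lincomb G B k = finprod G (\<lambda>x. x [^]\<^bsub>G\<^esub> k x) B"

text \<open>Ranks are attached to subsets so that kernels and images can be measured inside the
  ambient group, without passing to subgroups. As a relation it also asserts that the maximum
  exists, which the supremum in \<open>abelian_rank\<close> does not.\<close>

definition is_rank :: "('a, 'b) monoid_scheme \<Rightarrow> 'a set \<Rightarrow> nat \<Rightarrow> bool" where
  "is_rank G S n \<longleftrightarrow> (\<exists>B\<subseteq>S. int_independent G B \<and> card B = n) \<and>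
     (\<forall>B\<subseteq>S. int_independent G B \<longrightarrow> card B \<le> n)"

lemma int_independent_alt:
  "int_independent G B \<longleftrightarrow> finite B \<and> B \<subseteq> carrier G \<and>
     (\<forall>k. lincomb G B k = \<one>\<^bsub>G\<^esub> \<longrightarrow> (\<forall>x\<in>B. k x = 0))"
  by (simp add: int_independent_def lincomb_def)

lemma int_independentD:
  "int_independent G B \<Longrightarrow> lincomb G B k = \<one>\<^bsub>G\<^esub> \<Longrightarrow> x \<in> B \<Longrightarrow> k x = 0"
  unfolding int_independent_alt by blast

lemma int_independentI:
  assumes "finite B" "B \<subseteq> carrier G"
    and "\<And>k x. lincomb G B k = \<one>\<^bsub>G\<^esub> \<Longrightarrow> x \<in> B \<Longrightarrow> k x = 0"
  shows "int_independent G B"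
  using assms unfolding int_independent_alt by simp

lemma int_independent_empty [simp]: "int_independent G {}"
  by (simp add: int_independent_def)

lemma is_rank_unique: "is_rank G S n \<Longrightarrow> is_rank G S n' \<Longrightarrow> n = n'"
  unfolding is_rank_def by (metis le_antisym)

lemma is_rank_exists:
  fixes S :: "'a set"
  assumes "\<And>B. B \<subseteq> S \<Longrightarrow> int_independent G B \<Longrightarrow> card B \<le> N"
  obtains n where "is_rank G S n" "n \<le> N"
proof -
  let ?C = "card ` {B. B \<subseteq> S \<and> int_independent G B}"
  have fin: "finite ?C"
    by (rule finite_subset[of _ "{..N}"]) (use assms in auto)
  have "card ({} :: 'a set) \<in> ?C" by (intro imageI) simp
  then have max: "Max ?C \<in> ?C"
    using fin by (intro Max_in) auto
  then obtain B0 where B0: "Max ?C = card B0" "B0 \<subseteq> S" "int_independent G B0"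
    by blast
  have "card B \<le> Max ?C" if "B \<subseteq> S" "int_independent G B" for B
    using fin that by (intro Max_ge) auto
  then have "is_rank G S (Max ?C)"
    unfolding is_rank_def using B0 by (intro conjI exI[of _ B0]) simp_all
  moreover have "Max ?C \<le> N"
    using assms[OF B0(2,3)] B0(1) by simp
  ultimately show ?thesis by (rule that)
qed

lemma is_rank_subset:
  assumes T: "is_rank G T n" and "S \<subseteq> T"
  obtains n' where "is_rank G S n'"
proof (rule is_rank_exists)
  fix B assume "B \<subseteq> S" "int_independent G B"
  then show "card B \<le> n"
    using T \<open>S \<subseteq> T\<close> unfolding is_rank_def by (meson order_trans)
qed

lemma int_independent_subset_carrier: "int_independent G B \<Longrightarrow> B \<subseteq> carrier G"
  by (simp add: int_independent_def)

lemma is_rank_carrier: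
  "is_rank G (carrier G) n \<longleftrightarrow> finite_rank G \<and> abelian_rank G = n"
proof
  assume r: "is_rank G (carrier G) n"
  let ?C = "card ` {B. int_independent G B}"
  have le: "x \<le> n" if "x \<in> ?C" for x
    using that r int_independent_subset_carrier unfolding is_rank_def by blast
  have "n \<in> ?C" using r unfolding is_rank_def by blast
  then have "Sup ?C = n" using le by (rule cSup_eq_maximum)
  moreover have "finite_rank G"
    unfolding finite_rank_def using le by (rule bdd_aboveI)
  ultimately have "finite_rank G" "Sup ?C = n" by simp_all
  then show "finite_rank G \<and> abelian_rank G = n"
    by (simp add: abelian_rank_def)
next
  assume "finite_rank G \<and> abelian_rank G = n"
  then obtain N where N: "\<And>B. int_independent G B \<Longrightarrow> card B \<le> N" and n: "abelian_rank G = n"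
    unfolding finite_rank_def bdd_above_def by blast
  obtain n' where n': "is_rank G (carrier G) n'"
    using is_rank_exists[of "carrier G" G N] N by blast
  let ?C = "card ` {B. int_independent G B}"
  have le: "x \<le> n'" if "x \<in> ?C" for x
    using that n' int_independent_subset_carrier unfolding is_rank_def by blast
  have "n' \<in> ?C" using n' unfolding is_rank_def by blast
  then have "Sup ?C = n'" using le by (rule cSup_eq_maximum)
  with n n' show "is_rank G (carrier G) n"
    by (simp add: abelian_rank_def)
qed

context comm_group
begin

lemma lincomb_closed [simp, intro]: "B \<subseteq> carrier G \<Longrightarrow> lincomb G B k \<in> carrier G"
  unfolding lincomb_def by (intro finprod_closed) auto

lemma lincomb_empty [simp]: "lincomb G {} k = \<one>"
  by (simp add: lincomb_def)

lemma lincomb_insert: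
  "finite B \<Longrightarrow> x \<notin> B \<Longrightarrow> B \<subseteq> carrier G \<Longrightarrow> x \<in> carrier G \<Longrightarrow>
     lincomb G (insert x B) k = x [^] k x \<otimes> lincomb G B k"
  unfolding lincomb_def by (intro finprod_insert) auto

lemma lincomb_cong: "B \<subseteq> carrier G \<Longrightarrow> (\<And>x. x \<in> B \<Longrightarrow> k x = k' x) \<Longrightarrow> lincomb G B k = lincomb G B k'"
  unfolding lincomb_def by (intro finprod_cong') auto

lemma lincomb_Un:
  "finite A \<Longrightarrow> finite B \<Longrightarrow> A \<inter> B = {} \<Longrightarrow> A \<subseteq> carrier G \<Longrightarrow> B \<subseteq> carrier G \<Longrightarrow>
     lincomb G (A \<union> B) k = lincomb G A k \<otimes> lincomb G B k"
  unfolding lincomb_def by (intro finprod_Un_disjoint) auto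

lemma lincomb_zero: "B \<subseteq> carrier G \<Longrightarrow> (\<And>x. x \<in> B \<Longrightarrow> k x = 0) \<Longrightarrow> lincomb G B k = \<one>"
  unfolding lincomb_def by (intro finprod_one_eqI) auto

lemma lincomb_add:
  "finite B \<Longrightarrow> B \<subseteq> carrier G \<Longrightarrow> lincomb G B (\<lambda>x. k x + k' x) = lincomb G B k \<otimes> lincomb G B k'"
  unfolding lincomb_def by (subst finprod_multf[symmetric]) (auto intro!: finprod_cong' simp: int_pow_mult)

lemma lincomb_scale:
  assumes "finite B" "B \<subseteq> carrier G"
  shows "lincomb G B (\<lambda>x. n * k x) = lincomb G B k [^] (n::int)"
  using assms
proof (induction B rule: finite_induct)
  case (insert x B)
  then show ?case
    by (simp add: lincomb_insert int_pow_distrib int_pow_pow mult.commute)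
qed simp

lemma lincomb_uminus:
  "finite B \<Longrightarrow> B \<subseteq> carrier G \<Longrightarrow> lincomb G B (\<lambda>x. - k x) = inv (lincomb G B k)"
  using lincomb_scale[of B "-1" k] by (simp add: int_pow_neg)

lemma lincomb_sum:
  assumes "finite R" "finite B" "B \<subseteq> carrier G"
  shows "lincomb G B (\<lambda>x. \<Sum>i\<in>R. k i x) = finprod G (\<lambda>i. lincomb G B (k i)) R"
  using assms(1)
proof (induction R rule: finite_induct)
  case empty
  then show ?case using assms by (simp add: lincomb_zero)
next
  case (insert x R)
  have "(\<lambda>i. lincomb G B (k i)) \<in> R \<rightarrow> carrier G" using assms by auto
  with insert assms show ?case by (simp add: lincomb_add)
qed

text \<open>Each member of \<open>S\<close> contributes the row of its coefficients over
  \<open>M\<close>. With more rows than columns the rows are dependent, and this dependence, scaled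
  by the multiples \<open>n\<close>, is a forbidden relation in \<open>S\<close>.\<close>

lemma card_le_if_spanned:
  assumes S: "int_independent G S" and M: "finite M" "M \<subseteq> carrier G"
    and span: "\<And>g. g \<in> S \<Longrightarrow> \<exists>n k. n \<noteq> 0 \<and> g [^] (n::int) = lincomb G M k"
  shows "card S \<le> card M"
proof (rule ccontr)
  assume "\<not> card S \<le> card M"
  have fin: "finite S" and sub: "S \<subseteq> carrier G"
    using S by (auto simp: int_independent_def)
  obtain n a where na: "\<And>g. g \<in> S \<Longrightarrow> n g \<noteq> 0 \<and> g [^] (n g :: int) = lincomb G M (a g)"
    using span by metis
  obtain c where c: "\<exists>g\<in>S. c g \<noteq> 0" "\<forall>x\<in>M. (\<Sum>g\<in>S. c g * a g x) = 0"
    using int_rows_dependent[of M S a] M(1) fin \<open>\<not> card S \<le> card M\<close> by auto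
  have "lincomb G S (\<lambda>g. n g * c g) = finprod G (\<lambda>g. lincomb G M (\<lambda>x. c g * a g x)) S"
    unfolding lincomb_def[of G S]
  proof (rule finprod_cong')
    fix g assume "g \<in> S"
    then have "g [^] (n g * c g) = lincomb G M (a g) [^] c g"
      using na sub by (simp add: subset_iff flip: int_pow_pow)
    then show "g [^] (n g * c g) = lincomb G M (\<lambda>x. c g * a g x)"
      using M by (simp add: lincomb_scale)
  qed (use M in auto)
  also have "\<dots> = lincomb G M (\<lambda>x. \<Sum>g\<in>S. c g * a g x)"
    using lincomb_sum[OF fin M, of "\<lambda>g x. c g * a g x"] by simp
  also have "\<dots> = \<one>"
    using c(2) M by (intro lincomb_zero) auto
  finally have "\<forall>g\<in>S. n g * c g = 0"
    by (intro ballI int_independentD[OF S])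
  with c(1) na show False by auto
qed

text \<open>Maximality makes \<open>insert y B\<close> dependent, and in such a relation the
  exponent of \<open>y\<close> cannot vanish. In an arbitrary abelian group no more than a nonzero
  power of \<open>y\<close> can be expected in the span.\<close>

lemma maximal_independent_spans:
  assumes T: "is_rank G T r" and B: "B \<subseteq> T" "int_independent G B" "card B = r"
    and y: "y \<in> T" "y \<in> carrier G"
  shows "\<exists>n k. n \<noteq> 0 \<and> y [^] (n::int) = lincomb G B k"
proof (cases "y \<in> B")
  case True
  have fin: "finite B" and sub: "B \<subseteq> carrier G"
    using B by (auto simp: int_independent_def)
  have "lincomb G B (\<lambda>x. if x = y then 1 else 0) =
      lincomb G (insert y (B - {y})) (\<lambda>x. if x = y then 1 else 0)"
    using True by (simp add: insert_absorb)
  also have "\<dots> = y [^] (1::int) \<otimes> lincomb G (B - {y}) (\<lambda>x. if x = y then 1 else 0)"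
    using fin sub y by (subst lincomb_insert) auto
  also have "lincomb G (B - {y}) (\<lambda>x. if x = y then 1 else 0) = \<one>"
    using sub by (intro lincomb_zero) auto
  finally show ?thesis using y
    by (intro exI[of _ 1] exI[of _ "\<lambda>x. if x = y then 1 else 0"]) simp
next
  case False
  have fin: "finite B" and sub: "B \<subseteq> carrier G"
    using B by (auto simp: int_independent_def)
  have "\<not> int_independent G (insert y B)"
  proof
    assume "int_independent G (insert y B)"
    then have "card (insert y B) \<le> r"
      using T B(1) y(1) unfolding is_rank_def by blast
    then show False using False fin B(3) by simp
  qed
  then obtain k where k: "lincomb G (insert y B) k = \<one>" "\<exists>x\<in>insert y B. k x \<noteq> 0"
    using fin sub y(2) unfolding int_independent_alt
    by (simp only: finite_insert insert_subset simp_thms) blast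
  then have eq: "y [^] k y \<otimes> lincomb G B k = \<one>"
    using lincomb_insert[OF fin False sub y(2)] by simp
  have "k y \<noteq> 0"
  proof
    assume "k y = 0"
    then have "lincomb G B k = \<one>" using eq sub by simp
    then have "\<forall>x\<in>B. k x = 0" by (intro ballI int_independentD[OF B(2)])
    with k(2) \<open>k y = 0\<close> show False by auto
  qed
  moreover have "y [^] k y = lincomb G B (\<lambda>x. - k x)"
    using eq fin sub y by (simp add: lincomb_uminus inv_solve_right' inv_equality)
  ultimately show ?thesis by blast
qed

end

lemma hom_lincomb:
  assumes "comm_group G" "comm_group H" and h: "h \<in> hom G H"
    and "finite B" "B \<subseteq> carrier G" "inj_on h B"
  shows "h (lincomb G B k) = lincomb H (h ` B) (\<lambda>y. k (inv_into B h y))"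
proof -
  interpret G: comm_group G by fact
  interpret H: comm_group H by fact
  have hc: "h x \<in> carrier H" if "x \<in> carrier G" for x
    using h that by (auto simp: hom_def)
  have h1: "h \<one>\<^bsub>G\<^esub> = \<one>\<^bsub>H\<^esub>"
    using h G.is_group H.is_group by (metis hom_one)
  have "h (lincomb G A k) = lincomb H (h ` A) (\<lambda>y. k (inv_into B h y))"
    if "finite A" "A \<subseteq> B" for A
    using that
  proof (induction A rule: finite_induct)
    case empty
    then show ?case by (simp add: h1)
  next
    case (insert x A)
    have xB: "x \<in> B" "x \<in> carrier G" and A: "A \<subseteq> carrier G" using insert assms by auto
    have "h x \<notin> h ` A"
      using insert assms(6) by (auto simp: inj_on_def)
    then have "lincomb H (h ` insert x A) (\<lambda>y. k (inv_into B h y)) =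
        h x [^]\<^bsub>H\<^esub> k x \<otimes>\<^bsub>H\<^esub> lincomb H (h ` A) (\<lambda>y. k (inv_into B h y))"
      using insert xB A hc assms(6) by (subst image_insert, subst H.lincomb_insert) auto
    moreover have "h (x [^]\<^bsub>G\<^esub> k x \<otimes>\<^bsub>G\<^esub> lincomb G A k) = h x [^]\<^bsub>H\<^esub> k x \<otimes>\<^bsub>H\<^esub> h (lincomb G A k)"
      using h xB A G.is_group H.is_group by (simp add: hom_mult hom_int_pow)
    ultimately show ?case
      using insert xB A by (simp add: G.lincomb_insert)
  qed
  then show ?thesis using assms by blast
qed

section \<open>Additivity of the rank along a homomorphism\<close>

locale comm_group_hom =
  fixes G :: "('a, 'c) monoid_scheme" and H :: "('b, 'd) monoid_scheme" and h
  assumes comm_G: "comm_group G" and comm_H: "comm_group H" and hom: "h \<in> hom G H"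
begin

sublocale G: comm_group G by (rule comm_G)
sublocale H: comm_group H by (rule comm_H)

lemma h_closed: "x \<in> carrier G \<Longrightarrow> h x \<in> carrier H"
  using hom by (auto simp: hom_def)

text \<open>A relation on \<open>K\<close> and \<open>L\<close> together maps to a relation on
  \<open>B\<close>, which kills the coefficients on \<open>L\<close>; what remains is a relation on
  \<open>K\<close>.\<close>

lemma independent_lift:
  assumes K: "K \<subseteq> kernel G H h" "int_independent G K"
    and B: "B \<subseteq> h ` carrier G" "int_independent H B"
  obtains L where "L \<subseteq> carrier G" "inj_on h L" "h ` L = B" "K \<inter> L = {}"
    "int_independent G (K \<union> L)"
proof -
  define L where "L = inv_into (carrier G) h ` B"
  have inv: "inv_into (carrier G) h y \<in> carrier G" "h (inv_into (carrier G) h y) = y" if "y \<in> B" for y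
    using that B(1) by (meson inv_into_into subsetD, meson f_inv_into_f subsetD)
  have L: "L \<subseteq> carrier G" "h ` L = B" "inj_on h L"
    using inv by (auto simp: L_def image_image intro: inj_onI)
  have fin: "finite K" "finite B" "finite L" and KG: "K \<subseteq> carrier G"
    using K B by (auto simp: int_independent_def L_def)
  \<comment> \<open>The identity is dependent already on its own. Excluding it from \<open>B\<close>
    keeps the lifts out of the kernel.\<close>
  have one: "\<one>\<^bsub>H\<^esub> \<notin> B"
  proof
    assume 1: "\<one>\<^bsub>H\<^esub> \<in> B"
    have "lincomb H B (\<lambda>x. if x = \<one>\<^bsub>H\<^esub> then 1 else 0) = \<one>\<^bsub>H\<^esub>"
      unfolding lincomb_def by (rule H.finprod_one_eqI) auto
    from int_independentD[OF B(2) this 1] show False by simp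
  qed
  have disj: "K \<inter> L = {}"
    using K(1) one unfolding kernel_def L(2)[symmetric] by force
  have "\<forall>x\<in>K \<union> L. k x = 0" if "lincomb G (K \<union> L) k = \<one>\<^bsub>G\<^esub>" for k
  proof -
    have eq: "lincomb G K k \<otimes>\<^bsub>G\<^esub> lincomb G L k = \<one>\<^bsub>G\<^esub>"
      using that G.lincomb_Un[OF fin(1,3) disj KG L(1)] by simp
    have hK: "h (lincomb G K k) = \<one>\<^bsub>H\<^esub>"
    proof -
      have "h (lincomb G A k) = \<one>\<^bsub>H\<^esub>" if "finite A" "A \<subseteq> K" for A
        using that
      proof (induction A rule: finite_induct)
        case empty
        then show ?case using hom by (simp add: hom_one[OF hom G.is_group H.is_group])
      next
        case (insert x A)
        have x: "x \<in> carrier G" "h x = \<one>\<^bsub>H\<^esub>" "A \<subseteq> carrier G"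
          using insert K by (auto simp: kernel_def)
        then have "h (lincomb G (insert x A) k) = h x [^]\<^bsub>H\<^esub> k x \<otimes>\<^bsub>H\<^esub> h (lincomb G A k)"
          using insert hom G.is_group H.is_group
          by (simp add: G.lincomb_insert hom_mult[OF hom] hom_int_pow[OF hom])
        then show ?case using insert x by simp
      qed
      then show ?thesis using fin by blast
    qed
    have "h (lincomb G L k) = \<one>\<^bsub>H\<^esub>"
      using arg_cong[OF eq, of h] hK KG L(1) hom_one[OF hom G.is_group H.is_group]
      by (simp add: hom_mult[OF hom] h_closed)
    then have "lincomb H B (\<lambda>y. k (inv_into L h y)) = \<one>\<^bsub>H\<^esub>"
      using hom_lincomb[OF comm_G comm_H hom fin(3) L(1,3)] L(2) by simp
    then have "\<forall>y\<in>B. k (inv_into L h y) = 0"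
      by (intro ballI int_independentD[OF B(2), where k = "\<lambda>y. k (inv_into L h y)"])
    then have kL: "\<forall>x\<in>L. k x = 0" using L(2,3) by (metis imageI inv_into_f_f)
    then have "lincomb G K k = \<one>\<^bsub>G\<^esub>"
      using eq KG L(1) by (simp add: G.lincomb_zero)
    then have "\<forall>x\<in>K. k x = 0" by (intro ballI int_independentD[OF K(2)])
    with kL show ?thesis by blast
  qed
  then have "int_independent G (K \<union> L)"
    using fin KG L(1) by (intro int_independentI) auto
  with L disj show ?thesis by (intro that)
qed

text \<open>Spanning up to multiples is used twice: some power of \<open>h g\<close> lies in the
  span of \<open>B\<close>; after division by a lift the defect lies in the kernel, and some power
  of the defect lies in the span of \<open>K\<close>.\<close>

lemma rank_nullity:
  assumes K: "is_rank G (kernel G H h) r" and I: "is_rank H (h ` carrier G) q"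
  shows "is_rank G (carrier G) (r + q)"
proof -
  obtain K where K': "K \<subseteq> kernel G H h" "int_independent G K" "card K = r"
    using assms unfolding is_rank_def by blast
  obtain B where B': "B \<subseteq> h ` carrier G" "int_independent H B" "card B = q"
    using assms unfolding is_rank_def by blast
  obtain L where L: "L \<subseteq> carrier G" "inj_on h L" "h ` L = B" "K \<inter> L = {}"
    "int_independent G (K \<union> L)"
    using independent_lift[OF K'(1,2) B'(1,2)] by blast
  have KG: "K \<subseteq> carrier G" and fin: "finite K" "finite L"
    using K' L by (auto simp: int_independent_def)
  have card: "card (K \<union> L) = r + q"
    using fin L K' B' by (simp add: card_Un_disjoint card_image flip: L(3))
  have "card S \<le> r + q" if S: "S \<subseteq> carrier G" "int_independent G S" for S
    unfolding card[symmetric]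
  proof (rule G.card_le_if_spanned[OF S(2)])
    fix g assume "g \<in> S"
    then have g: "g \<in> carrier G" using S by auto
    obtain n k where nk: "n \<noteq> 0" "h g [^]\<^bsub>H\<^esub> (n::int) = lincomb H B k"
      using H.maximal_independent_spans[OF I B' imageI[OF g] h_closed[OF g]] by blast
    have "h (lincomb G L (k \<circ> h)) = lincomb H B k"
    proof -
      have "h (lincomb G L (k \<circ> h)) = lincomb H B (\<lambda>y. k (h (inv_into L h y)))"
        using hom_lincomb[OF comm_G comm_H hom fin(2) L(1,2)] L(3) by simp
      also have "\<dots> = lincomb H B k"
        using B' L by (intro H.lincomb_cong) (auto simp: f_inv_into_f int_independent_def)
      finally show ?thesis .
    qed
    then have "g [^]\<^bsub>G\<^esub> n \<otimes>\<^bsub>G\<^esub> inv\<^bsub>G\<^esub> lincomb G L (k \<circ> h) \<in> kernel G H h" (is "?z \<in> _")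
      using g nk L(1) hom h_closed H.r_inv[of "lincomb H B k"] int_independent_subset_carrier[OF B'(2)]
      by (simp add: kernel_def hom_mult[OF hom] hom_int_pow[OF hom g G.is_group H.is_group]
          group_hom.hom_inv[OF group_hom.intro[OF G.is_group H.is_group group_hom_axioms.intro[OF hom]]])
    moreover have z: "?z \<in> carrier G" using g L by simp
    ultimately obtain n' k' where n'k': "n' \<noteq> 0" "?z [^]\<^bsub>G\<^esub> (n'::int) = lincomb G K k'"
      using G.maximal_independent_spans[OF K K'(1,2,3)] by blast
    let ?k = "\<lambda>x. if x \<in> K then k' x else n' * (k \<circ> h) x"
    have "g [^]\<^bsub>G\<^esub> (n * n') = (?z \<otimes>\<^bsub>G\<^esub> lincomb G L (k \<circ> h)) [^]\<^bsub>G\<^esub> n'"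
      using g L(1) by (simp add: G.m_assoc G.int_pow_pow)
    also have "\<dots> = lincomb G K k' \<otimes>\<^bsub>G\<^esub> lincomb G L (\<lambda>x. n' * (k \<circ> h) x)"
      using z n'k' L(1) fin by (simp only: G.int_pow_distrib G.lincomb_closed G.lincomb_scale)
    also have "\<dots> = lincomb G (K \<union> L) ?k"
    proof -
      have "lincomb G K k' = lincomb G K ?k"
        by (rule G.lincomb_cong[OF KG]) simp
      moreover have "lincomb G L (\<lambda>x. n' * (k \<circ> h) x) = lincomb G L ?k"
        by (rule G.lincomb_cong[OF L(1)]) (use L(4) in auto)
      ultimately show ?thesis
        using G.lincomb_Un[OF fin L(4) KG L(1), of ?k] by simp
    qed
    finally show "\<exists>n k. n \<noteq> 0 \<and> g [^]\<^bsub>G\<^esub> (n::int) = lincomb G (K \<union> L) k"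
      using nk(1) n'k'(1) by (intro exI[of _ "n * n'"] exI[of _ ?k]) auto
  qed (use fin KG L in auto)
  then show ?thesis
    unfolding is_rank_def using card L(1,5) KG by (intro conjI exI[of _ "K \<union> L"]) auto
qed

text \<open>\<open>rank_nullity\<close> presupposes the two ranks; here finiteness of the whole
  forces both. Independent sets in the image are bounded because they lift to independent sets in
  \<open>G\<close>.\<close>

lemma finite_rank_kernel_image:
  assumes "is_rank G (carrier G) n"
  obtains r q where "is_rank G (kernel G H h) r" "is_rank H (h ` carrier G) q" "n = r + q"
proof -
  obtain r where r: "is_rank G (kernel G H h) r"
    using is_rank_subset[OF assms, of "kernel G H h"] by (auto simp: kernel_def)
  have "card B \<le> n" if B: "B \<subseteq> h ` carrier G" "int_independent H B" for B
  proof -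
    obtain L where L: "L \<subseteq> carrier G" "inj_on h L" "h ` L = B" "int_independent G ({} \<union> L)"
      using independent_lift[of "{}" B, OF _ _ B] by auto
    then have "card L \<le> n" using assms unfolding is_rank_def by auto
    then show ?thesis using L by (simp add: card_image flip: L(3))
  qed
  then obtain q where q: "is_rank H (h ` carrier G) q"
    using is_rank_exists[of "h ` carrier G" H n] by blast
  have "n = r + q"
    using assms rank_nullity[OF r q] by (rule is_rank_unique)
  with r q show ?thesis by (rule that)
qed

end

lemma is_rank_one:
  fixes G (structure)
  assumes "comm_group G"
  shows "is_rank G {\<one>\<^bsub>G\<^esub>} 0"
proof -
  interpret comm_group G by fact
  have "B = {}" if "B \<subseteq> {\<one>}" "int_independent G B" for B
  proof (rule ccontr)
    assume "B \<noteq> {}"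
    then have "B = {\<one>}" using that by auto
    moreover have "lincomb G {\<one>} (\<lambda>_. 1) = \<one>" by (simp add: lincomb_def)
    ultimately show False using int_independentD[OF that(2), of "\<lambda>_. 1" \<one>] by simp
  qed
  then have "card B \<le> 0" if "B \<subseteq> {\<one>}" "int_independent G B" for B
    using that by (metis card.empty order_refl)
  then show ?thesis unfolding is_rank_def by (intro conjI exI[of _ "{}"]) simp_all
qed

lemma is_rank_trivial:
  assumes "comm_group G" "trivial_group G"
  shows "is_rank G (carrier G) 0"
  using is_rank_one[OF assms(1)] assms(2) by (simp add: trivial_group_def)

lemma is_rank_iso:
  assumes "comm_group G" "comm_group H" "G \<cong> H" "is_rank G (carrier G) n"
  shows "is_rank H (carrier H) n"
proof -
  obtain h where h: "h \<in> iso G H" using assms(3) by (auto simp: is_iso_def)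
  interpret comm_group_hom G H h
    using assms h by (intro comm_group_hom.intro) (auto simp: iso_def)
  obtain r q where rq: "is_rank G (kernel G H h) r" "is_rank H (h ` carrier G) q" "n = r + q"
    using finite_rank_kernel_image[OF assms(4)] by blast
  have img: "h ` carrier G = carrier H" using h by (auto simp: iso_def bij_betw_def)
  have "inj_on h (carrier G)" using h by (auto simp: iso_def bij_betw_def)
  then have "x = \<one>\<^bsub>G\<^esub>" if "x \<in> kernel G H h" for x
    using that hom_one[OF hom G.is_group H.is_group] G.one_closed
    unfolding kernel_def by (metis (mono_tags, lifting) inj_onD mem_Collect_eq)
  moreover have "\<one>\<^bsub>G\<^esub> \<in> kernel G H h"
    using hom_one[OF hom G.is_group H.is_group] by (simp add: kernel_def)
  ultimately have "kernel G H h = {\<one>\<^bsub>G\<^esub>}" by blast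
  then have "is_rank G {\<one>\<^bsub>G\<^esub>} r" using rq(1) by simp
  then have "r = 0" using is_rank_one[OF comm_G] by (rule is_rank_unique)
  with rq img show ?thesis by simp
qed

lemma is_rank_integer_group: "is_rank integer_group (carrier integer_group) 1"
proof -
  interpret comm_group integer_group
    by (simp add: abelian_integer_group)
  have "int_independent integer_group {1}"
    unfolding int_independent_alt lincomb_def by simp
  moreover have "card B \<le> card {1::int}" if "int_independent integer_group B" for B
    using that
  proof (rule card_le_if_spanned)
    show "\<exists>n k. n \<noteq> 0 \<and> g [^]\<^bsub>integer_group\<^esub> (n::int) = lincomb integer_group {1} k" for g
      by (rule exI[of _ 1], rule exI[of _ "\<lambda>_. g"]) (simp add: lincomb_def)
  qed auto
  ultimately show ?thesis
    unfolding is_rank_def by (intro conjI exI[of _ "{1}"] allI impI) auto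
qed

section \<open>Euler characteristics of pairs\<close>

definition betti_sequence :: "'a topology \<Rightarrow> 'a set \<Rightarrow> (nat \<Rightarrow> nat) \<Rightarrow> nat \<Rightarrow> bool" where
  "betti_sequence X S b N \<longleftrightarrow>
     (\<forall>p. is_rank (relative_homology_group (int p) X S)
            (carrier (relative_homology_group (int p) X S)) (b p)) \<and>
     (\<forall>p\<ge>N. b p = 0)"

text \<open>Finite rank in every degree and vanishing from \<open>N\<close> on are part of the
  assertion, since \<open>euler_characteristic\<close> is meaningful only then. Pairs are included
  for the sake of excision; the absolute case is \<open>S = {}\<close>.\<close>

definition has_euler :: "'a topology \<Rightarrow> 'a set \<Rightarrow> int \<Rightarrow> bool" where
  "has_euler X S c \<longleftrightarrow> (\<exists>b N. betti_sequence X S b N \<and> c = (\<Sum>p<N. (-1) ^ p * int (b p)))"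

lemma has_eulerI:
  assumes "\<And>p. is_rank (relative_homology_group (int p) X S)
            (carrier (relative_homology_group (int p) X S)) (b p)"
    and "\<And>p. p \<ge> N \<Longrightarrow> b p = 0" and "(\<Sum>p<N. (-1) ^ p * int (b p)) = c"
  shows "has_euler X S c"
proof -
  have "betti_sequence X S b N"
    using assms(1,2) by (simp add: betti_sequence_def)
  then show ?thesis
    unfolding has_euler_def using assms(3) by blast
qed

lemma sum_eventually_zero:
  fixes f :: "nat \<Rightarrow> int"
  assumes "\<And>p. p \<ge> N \<Longrightarrow> f p = 0" "N \<le> M"
  shows "sum f {..<M} = sum f {..<N}"
  using assms by (intro sum.mono_neutral_right) auto

text \<open>Every larger cutoff is offered, so that alternating sums of different spaces can be
  truncated at a common degree.\<close>

lemma has_eulerE: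
  assumes "has_euler X S c"
  obtains b N where "\<forall>p. is_rank (relative_homology_group (int p) X S)
            (carrier (relative_homology_group (int p) X S)) (b p)"
    "\<forall>p\<ge>N. b p = 0" "\<forall>M\<ge>N. c = (\<Sum>p<M. (-1) ^ p * int (b p))"
proof -
  obtain b N where bN: "betti_sequence X S b N" and c: "c = (\<Sum>p<N. (-1) ^ p * int (b p))"
    using assms unfolding has_euler_def by blast
  note b = bN[unfolded betti_sequence_def, THEN conjunct1]
    and N = bN[unfolded betti_sequence_def, THEN conjunct2] c
  have "\<forall>M\<ge>N. c = (\<Sum>p<M. (-1) ^ p * int (b p))"
  proof (intro allI impI)
    fix M assume "M \<ge> N"
    have "(-1) ^ p * int (b p) = 0" if "p \<ge> N" for p
      using N(1)[rule_format, OF that] by (simp only: of_nat_0 mult_zero_right)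
    from sum_eventually_zero[OF this \<open>M \<ge> N\<close>] show "c = (\<Sum>p<M. (-1) ^ p * int (b p))"
      unfolding c by (rule sym)
  qed
  with b N(1) show ?thesis by (rule that)
qed

lemma has_euler_absolute:
  assumes "has_euler X {} c"
  shows "has_finite_betti_numbers X \<and> euler_characteristic X = c"
proof -
  obtain b N where b': "\<forall>p. is_rank (homology_group (int p) X) (carrier (homology_group (int p) X)) (b p)"
    and N': "\<forall>p\<ge>N. b p = 0" "\<forall>M\<ge>N. c = (\<Sum>p<M. (-1) ^ p * int (b p))"
    by (rule has_eulerE[OF assms])
  note b = b'[rule_format] and N = N'[rule_format]
  have betti: "betti_number p X = b p" and fr: "finite_rank (homology_group (int p) X)" for p
    using b[of p] by (simp_all add: is_rank_carrier betti_number_def)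
  have sub: "{p. b p \<noteq> 0} \<subseteq> {..<N}"
    using N(1) by (metis (mono_tags, lifting) lessThan_iff mem_Collect_eq not_le subsetI)
  have "euler_characteristic X = (\<Sum>p<N. (-1) ^ p * int (b p))"
    unfolding euler_characteristic_def betti
    using sub by (intro sum.mono_neutral_left) auto
  moreover have "finite {p. b p \<noteq> 0}"
    using sub finite_subset by blast
  ultimately show ?thesis
    using N(2)[OF order_refl] fr unfolding has_finite_betti_numbers_def betti by metis
qed

lemma has_euler_iso:
  assumes "has_euler X S c"
    and "\<And>p. relative_homology_group (int p) X S \<cong> relative_homology_group (int p) Y T"
  shows "has_euler Y T c"
proof -
  obtain b N where b': "\<forall>p. is_rank (relative_homology_group (int p) X S)
            (carrier (relative_homology_group (int p) X S)) (b p)"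
    and N': "\<forall>p\<ge>N. b p = 0" "\<forall>M\<ge>N. c = (\<Sum>p<M. (-1) ^ p * int (b p))"
    by (rule has_eulerE[OF assms(1)])
  note b = b'[rule_format] and N = N'[rule_format]
  have "is_rank (relative_homology_group (int p) Y T)
      (carrier (relative_homology_group (int p) Y T)) (b p)" for p
    using is_rank_iso[OF _ _ assms(2) b] by simp
  then show ?thesis
    by (rule has_eulerI) (erule N(1), rule N(2)[OF order_refl, symmetric])
qed

lemma has_euler_homotopy_equivalent:
  "has_euler X {} c \<Longrightarrow> X homotopy_equivalent_space Y \<Longrightarrow> has_euler Y {} c"
  by (erule has_euler_iso) (rule homotopy_equivalent_space_imp_isomorphic_homology_groups)

text \<open>\<open>x\<close>, \<open>a\<close>, \<open>r\<close> stand for the ranks of the space,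
  the subspace and the pair, \<open>d p\<close> for the rank of the boundary map out of degree
  \<open>p\<close>. Each \<open>d p\<close> enters two adjacent degrees with opposite signs, so only
  the end term survives.\<close>

lemma alternating_sum_telescope:
  fixes x a r d :: "nat \<Rightarrow> int"
  assumes "\<And>p. x p = a p + r p - d (Suc p) - d p" "d 0 = 0"
  shows "(\<Sum>p<N. (-1) ^ p * x p) = (\<Sum>p<N. (-1) ^ p * a p) + (\<Sum>p<N. (-1) ^ p * r p) + (-1) ^ N * d N"
  by (induction N) (auto simp: assms algebra_simps)

section \<open>Euler characteristics along the long exact sequence\<close>

lemma homology_comm_group_hom_inclusion:
  "comm_group_hom (homology_group p (subtopology X S)) (homology_group p X)
     (hom_induced p (subtopology X S) {} X {} id)"
  by (intro comm_group_hom.intro abelian_homology_group hom_induced_empty_hom)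

lemma homology_comm_group_hom_relativization:
  "comm_group_hom (homology_group p X) (relative_homology_group p X S) (hom_induced p X {} X S id)"
  by (intro comm_group_hom.intro abelian_relative_homology_group hom_induced_hom)

lemma homology_comm_group_hom_boundary:
  "comm_group_hom (relative_homology_group p X S) (homology_group (p - 1) (subtopology X S))
     (hom_boundary p X S)"
  by (intro comm_group_hom.intro abelian_relative_homology_group hom_boundary_hom)

lemma long_exact_sequence:
  shows "kernel (homology_group p X) (relative_homology_group p X S) (hom_induced p X {} X S id) =
      hom_induced p (subtopology X S) {} X {} id ` carrier (homology_group p (subtopology X S))"
    and "kernel (relative_homology_group p X S) (homology_group (p - 1) (subtopology X S)) (hom_boundary p X S) =
      hom_induced p X {} X S id ` carrier (homology_group p X)"
    and "kernel (homology_group (p - 1) (subtopology X S)) (homology_group (p - 1) X)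
        (hom_induced (p - 1) (subtopology X S) {} X {} id) =
      hom_boundary p X S ` carrier (relative_homology_group p X S)"
  using homology_exactness_axiom_3[of p X S] homology_exactness_axiom_1[of p X S]
    homology_exactness_axiom_2[of p X S] by simp_all

text \<open>Homology in degree -1 is trivial; this is the starting condition \<open>d 0 = 0\<close>
  of the telescoping sum.\<close>

lemma boundary_image_rank_zero:
  "is_rank (homology_group (0 - 1) (subtopology X S))
     (hom_boundary 0 X S ` carrier (relative_homology_group 0 X S)) 0"
proof -
  let ?H = "homology_group (0 - 1) (subtopology X S)"
  have c: "carrier ?H = {\<one>\<^bsub>?H\<^esub>}"
    using trivial_relative_homology_group[of "0 - 1" "subtopology X S" "{}"]
    by (simp add: trivial_group_def)
  interpret comm_group_hom "relative_homology_group 0 X S" ?H "hom_boundary 0 X S"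
    by (rule homology_comm_group_hom_boundary)
  have "is_rank ?H {\<one>\<^bsub>?H\<^esub>} 0"
    by (rule is_rank_one) simp
  moreover have "hom_boundary 0 X S ` carrier (relative_homology_group 0 X S) = {\<one>\<^bsub>?H\<^esub>}"
  proof -
    have "hom_boundary 0 X S ` carrier (relative_homology_group 0 X S) \<subseteq> {\<one>\<^bsub>?H\<^esub>}"
      using h_closed unfolding c by blast
    moreover have "hom_boundary 0 X S ` carrier (relative_homology_group 0 X S) \<noteq> {}"
      using G.one_closed by blast
    ultimately show ?thesis by blast
  qed
  ultimately show ?thesis by simp
qed

text \<open>The space is the middle term of the exact sequence. Finite ranks on both sides give the
  ranks of the kernels and images there, and \<open>rank_nullity\<close> turns these into a rank in
  the middle.\<close>

lemma has_euler_from_pair: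
  assumes "has_euler (subtopology X S) {} a" "has_euler X S r"
  shows "has_euler X {} (a + r)"
proof -
  let ?HA = "\<lambda>p. homology_group (int p) (subtopology X S)"
  let ?HX = "\<lambda>p. homology_group (int p) X"
  let ?HR = "\<lambda>p. relative_homology_group (int p) X S"
  let ?i = "\<lambda>p. hom_induced (int p) (subtopology X S) {} X {} id"
  let ?j = "\<lambda>p. hom_induced (int p) X {} X S id"
  let ?d = "\<lambda>p. hom_boundary (int p) X S"
  obtain ba Na where ba': "\<forall>p. is_rank (?HA p) (carrier (?HA p)) (ba p)"
    and Na': "\<forall>p\<ge>Na. ba p = 0" "\<forall>M\<ge>Na. a = (\<Sum>p<M. (-1) ^ p * int (ba p))"
    by (rule has_eulerE[OF assms(1)])
  note ba = ba'[rule_format] and Na = Na'[rule_format]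
  obtain br Nr where br': "\<forall>p. is_rank (?HR p) (carrier (?HR p)) (br p)"
    and Nr': "\<forall>p\<ge>Nr. br p = 0" "\<forall>M\<ge>Nr. r = (\<Sum>p<M. (-1) ^ p * int (br p))"
    by (rule has_eulerE[OF assms(2)])
  note br = br'[rule_format] and Nr = Nr'[rule_format]
  have "\<exists>k \<alpha>. is_rank (?HA p) (kernel (?HA p) (?HX p) (?i p)) k \<and>
      is_rank (?HX p) (?i p ` carrier (?HA p)) \<alpha> \<and> ba p = k + \<alpha>" for p
    using comm_group_hom.finite_rank_kernel_image[OF homology_comm_group_hom_inclusion ba] by metis
  then obtain k \<alpha> where k: "\<And>p. is_rank (?HA p) (kernel (?HA p) (?HX p) (?i p)) (k p)"
    and \<alpha>: "\<And>p. is_rank (?HX p) (?i p ` carrier (?HA p)) (\<alpha> p)" and ba_eq: "\<And>p. ba p = k p + \<alpha> p"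
    by metis
  have "\<exists>\<beta> \<delta>. is_rank (?HR p) (?j p ` carrier (?HX p)) \<beta> \<and>
      is_rank (homology_group (int p - 1) (subtopology X S)) (?d p ` carrier (?HR p)) \<delta> \<and> br p = \<beta> + \<delta>" for p
    using comm_group_hom.finite_rank_kernel_image[OF homology_comm_group_hom_boundary br]
    unfolding long_exact_sequence by metis
  then obtain \<beta> \<delta> where \<beta>: "\<And>p. is_rank (?HR p) (?j p ` carrier (?HX p)) (\<beta> p)"
    and \<delta>: "\<And>p. is_rank (homology_group (int p - 1) (subtopology X S)) (?d p ` carrier (?HR p)) (\<delta> p)"
    and br_eq: "\<And>p. br p = \<beta> p + \<delta> p"
    by metis
  \<comment> \<open>Exactness at the subspace: what the inclusion kills in degree \<open>p\<close>
    is the boundary image from degree \<open>p + 1\<close>.\<close>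
  have k\<delta>: "k p = \<delta> (Suc p)" for p
    using long_exact_sequence(3)[of "int (Suc p)" X S] k[of p] \<delta>[of "Suc p"]
    by (auto intro: is_rank_unique)
  have "is_rank (homology_group (0 - 1) (subtopology X S)) (hom_boundary 0 X S ` carrier (relative_homology_group 0 X S)) (\<delta> 0)"
    using \<delta>[of 0] by simp
  then have \<delta>0: "\<delta> 0 = 0"
    using boundary_image_rank_zero by (rule is_rank_unique)
  have bx: "is_rank (?HX p) (carrier (?HX p)) (\<alpha> p + \<beta> p)" for p
    by (rule comm_group_hom.rank_nullity[OF homology_comm_group_hom_relativization])
      (use \<alpha>[of p] \<beta>[of p] long_exact_sequence(1)[of "int p" X S] in simp_all)
  let ?N = "max Na Nr"
  have "(\<Sum>p<?N. (-1) ^ p * int (\<alpha> p + \<beta> p)) =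
     (\<Sum>p<?N. (-1) ^ p * int (ba p)) + (\<Sum>p<?N. (-1) ^ p * int (br p)) + (-1) ^ ?N * int (\<delta> ?N)"
    by (rule alternating_sum_telescope) (auto simp: ba_eq br_eq k\<delta> \<delta>0)
  also have "\<delta> ?N = 0"
    using Nr(1)[of ?N] br_eq[of ?N] by simp
  finally have "(\<Sum>p<?N. (-1) ^ p * int (\<alpha> p + \<beta> p)) = a + r"
    using Na(2)[of ?N] Nr(2)[of ?N] by simp
  moreover have "\<alpha> p + \<beta> p = 0" if "p \<ge> ?N" for p
    using Na(1)[of p] Nr(1)[of p] ba_eq[of p] br_eq[of p] that by simp
  ultimately show ?thesis
    using bx by (intro has_eulerI)
qed

text \<open>Here the pair is the unknown term. Its boundary image is not known beforehand to have a
  rank; it receives one as the kernel of the inclusion one degree lower.\<close>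

lemma has_euler_relative:
  assumes "has_euler (subtopology X S) {} a" "has_euler X {} x"
  shows "has_euler X S (x - a)"
proof -
  let ?HA = "\<lambda>p. homology_group (int p) (subtopology X S)"
  let ?HX = "\<lambda>p. homology_group (int p) X"
  let ?HR = "\<lambda>p. relative_homology_group (int p) X S"
  let ?i = "\<lambda>p. hom_induced (int p) (subtopology X S) {} X {} id"
  let ?j = "\<lambda>p. hom_induced (int p) X {} X S id"
  let ?d = "\<lambda>p. hom_boundary (int p) X S"
  obtain ba Na where ba': "\<forall>p. is_rank (?HA p) (carrier (?HA p)) (ba p)"
    and Na': "\<forall>p\<ge>Na. ba p = 0" "\<forall>M\<ge>Na. a = (\<Sum>p<M. (-1) ^ p * int (ba p))"
    by (rule has_eulerE[OF assms(1)])
  note ba = ba'[rule_format] and Na = Na'[rule_format]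
  obtain bx Nx where bx': "\<forall>p. is_rank (?HX p) (carrier (?HX p)) (bx p)"
    and Nx': "\<forall>p\<ge>Nx. bx p = 0" "\<forall>M\<ge>Nx. x = (\<Sum>p<M. (-1) ^ p * int (bx p))"
    by (rule has_eulerE[OF assms(2)])
  note bx = bx'[rule_format] and Nx = Nx'[rule_format]
  have "\<exists>k \<alpha>. is_rank (?HA p) (kernel (?HA p) (?HX p) (?i p)) k \<and>
      is_rank (?HX p) (?i p ` carrier (?HA p)) \<alpha> \<and> ba p = k + \<alpha>" for p
    using comm_group_hom.finite_rank_kernel_image[OF homology_comm_group_hom_inclusion ba] by metis
  then obtain k \<alpha> where k: "\<And>p. is_rank (?HA p) (kernel (?HA p) (?HX p) (?i p)) (k p)"
    and \<alpha>: "\<And>p. is_rank (?HX p) (?i p ` carrier (?HA p)) (\<alpha> p)" and ba_eq: "\<And>p. ba p = k p + \<alpha> p"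
    by metis
  have "\<exists>\<alpha>' \<beta>. is_rank (?HX p) (?i p ` carrier (?HA p)) \<alpha>' \<and>
      is_rank (?HR p) (?j p ` carrier (?HX p)) \<beta> \<and> bx p = \<alpha>' + \<beta>" for p
    using comm_group_hom.finite_rank_kernel_image[OF homology_comm_group_hom_relativization bx]
    unfolding long_exact_sequence by metis
  then obtain \<alpha>' \<beta> where \<alpha>': "\<And>p. is_rank (?HX p) (?i p ` carrier (?HA p)) (\<alpha>' p)"
    and \<beta>: "\<And>p. is_rank (?HR p) (?j p ` carrier (?HX p)) (\<beta> p)" and bx_eq': "\<And>p. bx p = \<alpha>' p + \<beta> p"
    by metis
  have bx_eq: "bx p = \<alpha> p + \<beta> p" for p
    using bx_eq'[of p] is_rank_unique[OF \<alpha>[of p] \<alpha>'[of p]] by simp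
  define \<delta> where "\<delta> p = (case p of 0 \<Rightarrow> 0 | Suc q \<Rightarrow> k q)" for p
  have \<delta>: "is_rank (homology_group (int p - 1) (subtopology X S)) (?d p ` carrier (?HR p)) (\<delta> p)" for p
  proof (cases p)
    case 0
    then show ?thesis using boundary_image_rank_zero[of X S] by (simp add: \<delta>_def)
  next
    case (Suc q)
    then show ?thesis
      using k[of q] long_exact_sequence(3)[of "int p" X S] by (simp add: \<delta>_def)
  qed
  have br: "is_rank (?HR p) (carrier (?HR p)) (\<beta> p + \<delta> p)" for p
    by (rule comm_group_hom.rank_nullity[OF homology_comm_group_hom_boundary])
      (use \<delta>[of p] \<beta>[of p] long_exact_sequence(2)[of "int p" X S] in simp_all)
  \<comment> \<open>One degree beyond both cutoffs, because \<open>\<delta>\<close> shifts the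
    kernel ranks up by one.\<close>
  let ?N = "Suc (max Na Nx)"
  have \<delta>N: "\<delta> p = 0" if "p \<ge> ?N" for p
    using Na(1) ba_eq that by (cases p) (auto simp: \<delta>_def)
  have "(\<Sum>p<?N. (-1) ^ p * int (bx p)) =
     (\<Sum>p<?N. (-1) ^ p * int (ba p)) + (\<Sum>p<?N. (-1) ^ p * int (\<beta> p + \<delta> p)) + (-1) ^ ?N * int (\<delta> ?N)"
    by (rule alternating_sum_telescope) (auto simp: ba_eq bx_eq \<delta>_def)
  then have "(\<Sum>p<?N. (-1) ^ p * int (\<beta> p + \<delta> p)) = x - a"
    using Na(2)[of ?N] Nx(2)[of ?N] \<delta>N[of ?N] by (simp del: sum.lessThan_Suc)
  moreover have "\<beta> p + \<delta> p = 0" if "p \<ge> ?N" for p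
    using Nx(1)[of p] bx_eq[of p] \<delta>N[of p] that by simp
  ultimately show ?thesis
    using br by (intro has_eulerI)
qed

section \<open>Contractible spaces and spheres\<close>

lemma has_euler_empty:
  assumes "topspace X = {}"
  shows "has_euler X {} 0"
  using is_rank_trivial[OF abelian_homology_group trivial_homology_group_empty[OF assms]]
  by (intro has_eulerI[of X "{}" "\<lambda>_. 0" 0]) simp_all

text \<open>Reduced homology is the kernel of the map to the homology of a point. A point of
  \<open>X\<close> provides a section, so that map is onto a copy of the integers, and rank-nullity
  adds one.\<close>

lemma is_rank_homology_reduced:
  assumes X: "topspace X \<noteq> {}"
    and n: "is_rank (reduced_homology_group p X) (carrier (reduced_homology_group p X)) n"
    and p: "p = 0"
  shows "is_rank (homology_group p X) (carrier (homology_group p X)) (Suc n)"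
proof -
  let ?P = "discrete_topology {()}"
  let ?h = "hom_induced p X {} ?P {} (\<lambda>x. ())"
  interpret comm_group_hom "homology_group p X" "homology_group p ?P" ?h
    by (intro comm_group_hom.intro abelian_homology_group hom_induced_empty_hom)
  obtain a where a: "a \<in> topspace X" using X by blast
  have "continuous_map ?P X (\<lambda>_. a)" "continuous_map X ?P (\<lambda>_. ())"
    using a by (auto simp: continuous_map_const)
  then have comp: "?h \<circ> hom_induced p ?P {} X {} (\<lambda>_. a) = hom_induced p ?P {} ?P {} ((\<lambda>_. ()) \<circ> (\<lambda>_. a))"
    by (subst hom_induced_compose_empty) auto
  have "?h ` carrier (homology_group p X) = carrier (homology_group p ?P)"
  proof (intro equalityI subsetI)
    fix y assume y: "y \<in> carrier (homology_group p ?P)"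
    have "(\<lambda>_. ()) \<circ> (\<lambda>_::unit. a) = id" by auto
    then have "?h (hom_induced p ?P {} X {} (\<lambda>_. a) y) = y"
      using comp y hom_induced_id[of y p ?P "{}"] by (metis comp_apply)
    moreover have "hom_induced p ?P {} X {} (\<lambda>_. a) y \<in> carrier (homology_group p X)"
      using hom_induced_carrier by blast
    ultimately show "y \<in> ?h ` carrier (homology_group p X)" by (metis imageI)
  qed (use h_closed in blast)
  moreover have "homology_group p ?P \<cong> integer_group"
    unfolding p by (rule homology_coefficients[of _ "()"]) simp
  ultimately have im: "is_rank (homology_group p ?P) (?h ` carrier (homology_group p X)) 1"
    using is_rank_iso[OF abelian_integer_group abelian_homology_group _ is_rank_integer_group]
      group.iso_sym[OF comm_group.axioms(2)[OF abelian_homology_group]] by metis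
  have "carrier (reduced_homology_group p X) \<subseteq> carrier (homology_group p X)"
    by (rule carrier_reduced_homology_group_subset)
  then have "comm_group_hom (reduced_homology_group p X) (homology_group p X) id"
    by (intro comm_group_hom.intro abelian_homology_group)
      (auto simp: reduced_homology_group_def hom_def intro: group.abelian_subgroup_generated)
  \<comment> \<open>The reduced group is a subgroup; its rank is carried over to the full group
    along the inclusion, whose kernel is trivial.\<close>
  then interpret R: comm_group_hom "reduced_homology_group p X" "homology_group p X" id .
  have one: "kernel (reduced_homology_group p X) (homology_group p X) id = {\<one>\<^bsub>reduced_homology_group p X\<^esub>}"
    using R.G.one_closed unfolding one_reduced_homology_group kernel_def by force
  obtain r q where rq: "is_rank (reduced_homology_group p X)
      (kernel (reduced_homology_group p X) (homology_group p X) id) r"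
    "is_rank (homology_group p X) (id ` carrier (reduced_homology_group p X)) q" "n = r + q"
    by (rule R.finite_rank_kernel_image[OF n])
  have "r = 0"
    using rq(1) is_rank_one[OF R.comm_G] unfolding one by (rule is_rank_unique)
  then have "is_rank (homology_group p X) (carrier (reduced_homology_group p X)) n"
    using rq(2,3) by simp
  then have "is_rank (homology_group p X) (kernel (homology_group p X) (homology_group p ?P) ?h) n"
    by (simp add: carrier_reduced_homology_group)
  from rank_nullity[OF this im] show ?thesis by simp
qed

lemma has_euler_reduced:
  assumes X: "topspace X \<noteq> {}"
    and b: "\<And>p. is_rank (reduced_homology_group (int p) X)
              (carrier (reduced_homology_group (int p) X)) (b p)"
    and N: "\<And>p. p \<ge> N \<Longrightarrow> b p = 0"
  shows "has_euler X {} (1 + (\<Sum>p<N. (-1) ^ p * int (b p)))"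
proof -
  define b' where "b' p = (if p = 0 then Suc (b p) else b p)" for p
  have "is_rank (homology_group (int p) X) (carrier (homology_group (int p) X)) (b' p)" for p
    using is_rank_homology_reduced[OF X b[of p]] b[of p] un_reduced_homology_group[of "int p" X]
    by (cases "p = 0") (simp_all add: b'_def)
  moreover have "b' p = 0" if "p \<ge> Suc N" for p
    using that N by (simp add: b'_def)
  moreover have "(\<Sum>p<Suc N. (-1) ^ p * int (b' p)) = 1 + (\<Sum>p<Suc N. (-1) ^ p * int (b p))"
    by (subst (1 2) sum.lessThan_Suc_shift) (simp add: b'_def)
  moreover have "b N = 0" using N by simp
  ultimately show ?thesis
    by (intro has_eulerI[of X "{}" b' "Suc N"]) simp_all
qed

lemma comm_group_reduced_homology_group: "comm_group (reduced_homology_group p X)"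
  unfolding reduced_homology_group_def
  by (intro group.abelian_subgroup_generated comm_group.axioms(2) abelian_homology_group)

lemma has_euler_contractible:
  assumes "contractible_space X" "topspace X \<noteq> {}"
  shows "has_euler X {} 1"
  using has_euler_reduced[OF assms(2), of "\<lambda>_. 0" 0]
    is_rank_trivial[OF comm_group_reduced_homology_group
      trivial_reduced_homology_group_contractible_space[OF assms(1)]] by simp

lemma has_euler_nsphere: "has_euler (nsphere n) {} (1 + (-1) ^ n)"
proof -
  define b where "b p = (if p = n then 1 else 0 :: nat)" for p
  have "is_rank (reduced_homology_group (int p) (nsphere n))
      (carrier (reduced_homology_group (int p) (nsphere n))) (b p)" for p
  proof (cases "p = n")
    case True
    then show ?thesis
      using is_rank_iso[OF abelian_integer_group comm_group_reduced_homology_group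
          group.iso_sym[OF group_reduced_homology_group reduced_homology_group_nsphere(1)]
          is_rank_integer_group]
      by (simp add: b_def)
  next
    case False
    then show ?thesis
      using is_rank_trivial[OF comm_group_reduced_homology_group reduced_homology_group_nsphere(2)]
      by (simp add: b_def)
  qed
  then have "has_euler (nsphere n) {} (1 + (\<Sum>p<Suc n. (-1) ^ p * int (b p)))"
    by (intro has_euler_reduced) (auto simp: b_def)
  moreover have "(\<Sum>p<Suc n. (-1) ^ p * int (b p)) = (-1) ^ n"
    by (simp add: b_def)
  ultimately show ?thesis by (simp only:)
qed

section \<open>Attaching a cell\<close>

abbreviation simplex_space :: "nat \<Rightarrow> (nat \<Rightarrow> real) topology" where
  "simplex_space n \<equiv> subtopology (powertop_real UNIV) (standard_simplex n)"

definition simplex_interior :: "nat \<Rightarrow> (nat \<Rightarrow> real) set" where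
  "simplex_interior n = {x \<in> standard_simplex n. \<forall>i\<le>n. x i > 0}"

definition barycenter :: "nat \<Rightarrow> nat \<Rightarrow> real" where
  "barycenter n i = (if i \<le> n then 1 / real (Suc n) else 0)"

lemma standard_simplex_iff:
  "x \<in> standard_simplex n \<longleftrightarrow> (\<forall>i\<le>n. 0 \<le> x i) \<and> (\<forall>i>n. x i = 0) \<and> (\<Sum>i\<le>n. x i) = 1"
proof
  assume *: "(\<forall>i\<le>n. 0 \<le> x i) \<and> (\<forall>i>n. x i = 0) \<and> (\<Sum>i\<le>n. x i) = 1"
  have "x i \<le> 1" if "i \<le> n" for i
    using member_le_sum[of i "{..n}" x] * that by auto
  moreover have "0 \<le> x i" for i using * by (cases "i \<le> n") auto
  moreover have "x i \<le> 1" for i using * calculation(1)[of i] by (cases "i \<le> n") auto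
  ultimately show "x \<in> standard_simplex n"
    unfolding standard_simplex_def using * by simp
qed (auto simp: standard_simplex_def)

lemma simplex_interior_iff:
  "x \<in> simplex_interior n \<longleftrightarrow> (\<forall>i\<le>n. 0 < x i) \<and> (\<forall>i>n. x i = 0) \<and> (\<Sum>i\<le>n. x i) = 1"
  unfolding simplex_interior_def standard_simplex_iff by (auto intro: less_imp_le)

lemma simplex_interior_subset: "simplex_interior n \<subseteq> standard_simplex n"
  by (auto simp: simplex_interior_def)

lemma barycenter_interior: "barycenter n \<in> simplex_interior n"
  by (simp add: simplex_interior_iff barycenter_def)

lemma continuous_map_coordinate:
  "continuous_map (subtopology (powertop_real UNIV) S) euclideanreal (\<lambda>x. x i)"
  by (intro continuous_map_from_subtopology continuous_map_product_projection) simp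

lemma continuous_map_into_powertop:
  assumes "\<And>i. continuous_map X euclideanreal (\<lambda>x. f x i)" "\<And>x. x \<in> topspace X \<Longrightarrow> f x \<in> S"
  shows "continuous_map X (subtopology (powertop_real UNIV) S) f"
  using assms by (simp add: continuous_map_in_subtopology continuous_map_componentwise_UNIV Pi_iff)

lemma straight_line_homotopy:
  fixes f g :: "'a \<Rightarrow> 'b \<Rightarrow> real"
  assumes f: "continuous_map X (subtopology (powertop_real UNIV) S) f"
    and g: "continuous_map X (subtopology (powertop_real UNIV) S) g"
    and S: "\<And>x t. x \<in> topspace X \<Longrightarrow> 0 \<le> t \<Longrightarrow> t \<le> 1 \<Longrightarrow> (\<lambda>i. (1 - t) * f x i + t * g x i) \<in> S"
  shows "homotopic_with (\<lambda>_. True) X (subtopology (powertop_real UNIV) S) f g"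
proof -
  let ?I = "top_of_set {0..1::real}"
  let ?h = "\<lambda>z i. (1 - fst z) * f (snd z) i + fst z * g (snd z) i"
  have coord: "continuous_map (prod_topology ?I X) euclideanreal (\<lambda>z. k (snd z) i)"
    if "continuous_map X (subtopology (powertop_real UNIV) S) k" for k :: "'a \<Rightarrow> 'b \<Rightarrow> real" and i
  proof -
    have "continuous_map X euclideanreal (\<lambda>x. k x i)"
      using that by (simp add: continuous_map_in_subtopology continuous_map_componentwise_UNIV)
    from continuous_map_compose[OF continuous_map_snd[of ?I X] this]
    show ?thesis by (simp add: o_def)
  qed
  have t: "continuous_map (prod_topology ?I X) euclideanreal fst"
    by (rule continuous_map_into_fulltopology[OF continuous_map_fst])
  have "continuous_map (prod_topology ?I X) (subtopology (powertop_real UNIV) S) ?h"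
  proof (rule continuous_map_into_powertop)
    show "continuous_map (prod_topology ?I X) euclideanreal (\<lambda>z. ?h z i)" for i
      by (intro continuous_intros t coord f g) auto
  qed (use S in auto)
  then show ?thesis
    unfolding homotopic_with_def by (intro exI[of _ ?h]) auto
qed

lemma simplex_interior_convex:
  assumes "x \<in> simplex_interior n" "y \<in> simplex_interior n" "0 \<le> t" "t \<le> 1"
  shows "(\<lambda>i. (1 - t) * x i + t * y i) \<in> simplex_interior n"
proof -
  have "0 < (1 - t) * x i + t * y i" if "i \<le> n" for i
    using assms that by (cases "t = 0") (auto simp: simplex_interior_iff intro!: add_nonneg_pos)
  moreover have "(\<Sum>i\<le>n. (1 - t) * x i + t * y i) = 1"
    using assms by (simp add: simplex_interior_iff sum.distrib flip: sum_distrib_left)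
  ultimately show ?thesis
    using assms by (simp add: simplex_interior_iff)
qed

lemma has_euler_simplex_interior:
  "has_euler (subtopology (powertop_real UNIV) (simplex_interior n)) {} 1"
proof (rule has_euler_contractible)
  let ?X = "subtopology (powertop_real UNIV) (simplex_interior n)"
  have "homotopic_with (\<lambda>_. True) ?X ?X id (\<lambda>_. barycenter n)"
    by (rule straight_line_homotopy)
      (use barycenter_interior[of n] in \<open>auto simp: simplex_interior_convex\<close>)
  then show "contractible_space ?X"
    unfolding contractible_space_def by blast
qed (use barycenter_interior in auto)

text \<open>The last barycentric coordinate is determined by the others, so the first
  \<open>m + 1\<close> coordinates serve as a chart. The direction from the barycenter gives a map
  to the sphere, and a small sphere around the barycenter gives its homotopy inverse.\<close>

lemma punctured_simplex_interior_nsphere: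
  "subtopology (powertop_real UNIV) (simplex_interior (Suc m) - {barycenter (Suc m)})
     homotopy_equivalent_space nsphere m"
proof -
  \<comment> \<open>\<open>b\<close> is the common coordinate of the barycenter and \<open>e\<close>
    the radius of the small sphere. The coordinates of a unit vector add up to at most
    \<open>m + 1\<close>, so \<open>e * (m + 1) < b\<close> keeps all coordinates of
    \<open>g u\<close> positive.\<close>
  define b where "b = 1 / real (Suc (Suc m))"
  define e where "e = b * b"
  have b0: "b > 0" and e0: "e > 0" by (simp_all add: b_def e_def)
  have e_small: "e * real (Suc m) < b"
    unfolding e_def b_def by (simp add: divide_simps)
  define S where "S = simplex_interior (Suc m) - {barycenter (Suc m)}"
  define T where "T = {x::nat\<Rightarrow>real. (\<Sum>i\<le>m. (x i)\<^sup>2) = 1 \<and> (\<forall>i>m. x i = 0)}"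
  let ?X = "subtopology (powertop_real UNIV) S"
  have Y: "nsphere m = subtopology (powertop_real UNIV) T"
    by (simp add: nsphere T_def)
  define N where "N x = sqrt (\<Sum>i\<le>m. (x i - b)\<^sup>2)" for x :: "nat \<Rightarrow> real"
  define f where "f x i = (if i \<le> m then (x i - b) / N x else 0)" for x i
  define g where "g u i = (if i \<le> m then b + e * u i else if i = Suc m then b - e * (\<Sum>j\<le>m. u j) else 0)"
    for u i
  have sum_S: "(\<Sum>i\<le>m. x i - b) = b - x (Suc m)" if "x \<in> simplex_interior (Suc m)" for x
  proof -
    have "(\<Sum>i\<le>m. x i) + x (Suc m) = 1" using that by (simp add: simplex_interior_iff)
    moreover have "real (Suc m) * b = 1 - b" by (simp add: b_def field_simps)
    ultimately show ?thesis by (simp add: sum_subtractf)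
  qed
  have eq_b: "x = barycenter (Suc m)" if x: "x \<in> simplex_interior (Suc m)" and 0: "\<And>i. i \<le> m \<Longrightarrow> x i = b" for x
  proof
    fix i
    have "x (Suc m) = b" using sum_S[OF x] 0 by simp
    then have "x i = b" if "i \<le> Suc m" using that 0 by (cases "i = Suc m") auto
    moreover have "x i = 0" if "i > Suc m" using x that by (simp add: simplex_interior_iff)
    ultimately show "x i = barycenter (Suc m) i"
      by (cases "i \<le> Suc m") (auto simp: barycenter_def b_def)
  qed
  have N_pos: "N x > 0" if "x \<in> S" for x
  proof -
    have "\<exists>i\<le>m. x i \<noteq> b" using eq_b that by (auto simp: S_def)
    then obtain i where "i \<le> m" "x i \<noteq> b" by blast
    then have "(\<Sum>i\<le>m. (x i - b)\<^sup>2) > 0"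
      by (intro sum_pos2[of _ i]) auto
    then show ?thesis by (simp add: N_def)
  qed
  have fT: "f x \<in> T" if "x \<in> S" for x
  proof -
    have "(\<Sum>i\<le>m. (f x i)\<^sup>2) = (\<Sum>i\<le>m. (x i - b)\<^sup>2) / (N x)\<^sup>2"
      by (simp add: f_def power_divide sum_divide_distrib)
    also have "\<dots> = 1"
      using N_pos[OF that] by (simp add: N_def)
    finally show ?thesis by (simp add: T_def f_def)
  qed
  have gN: "N (g u) = e" if "u \<in> T" for u
  proof -
    have "(\<Sum>i\<le>m. (g u i - b)\<^sup>2) = e\<^sup>2 * (\<Sum>i\<le>m. (u i)\<^sup>2)"
      by (simp add: g_def power_mult_distrib sum_distrib_left)
    then show ?thesis using that e0 by (simp add: N_def T_def)
  qed
  have gS: "g u \<in> S" if u: "u \<in> T" for u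
  proof -
    have le1: "\<bar>u i\<bar> \<le> 1" if "i \<le> m" for i
    proof -
      have "(u i)\<^sup>2 \<le> (\<Sum>i\<le>m. (u i)\<^sup>2)"
        using that by (intro member_le_sum) auto
      then have "(u i)\<^sup>2 \<le> 1" using u by (simp add: T_def)
      then show ?thesis by (simp add: abs_square_le_1)
    qed
    have eb: "e \<le> e * real (Suc m)" using e0 by simp
    have 1: "0 < b + e * u i" if "i \<le> m" for i
    proof -
      have "e * - u i \<le> e * 1" using le1[OF that] e0 by (intro mult_left_mono) auto
      then show ?thesis using e_small eb by simp
    qed
    have "(\<Sum>j\<le>m. u j) \<le> (\<Sum>j\<le>m. 1)" using le1 by (intro sum_mono) (auto simp: abs_le_iff)
    then have "e * (\<Sum>j\<le>m. u j) \<le> e * real (Suc m)" using e0 by (intro mult_left_mono) auto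
    then have 2: "0 < b - e * (\<Sum>j\<le>m. u j)" using e_small by simp
    have "(\<Sum>i\<le>Suc m. g u i) = (\<Sum>i\<le>m. b + e * u i) + (b - e * (\<Sum>j\<le>m. u j))"
      by (simp add: g_def)
    also have "\<dots> = real (Suc (Suc m)) * b"
      by (simp add: sum.distrib sum_distrib_left algebra_simps)
    also have "\<dots> = 1" by (simp add: b_def)
    finally have "g u \<in> simplex_interior (Suc m)"
      using 1 2 by (auto simp: simplex_interior_iff g_def le_Suc_eq)
    moreover have "g u \<noteq> barycenter (Suc m)"
    proof
      assume "g u = barycenter (Suc m)"
      then have "N (g u) = 0" by (simp add: N_def barycenter_def b_def)
      then show False using gN[OF u] e0 by simp
    qed
    ultimately show ?thesis by (simp add: S_def)
  qed
  have cN: "continuous_map ?X euclideanreal N"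
    unfolding N_def
    by (intro continuous_intros continuous_map_coordinate continuous_map_sqrt) auto
  have cf: "continuous_map ?X (subtopology (powertop_real UNIV) T) f"
  proof (rule continuous_map_into_powertop)
    show "continuous_map ?X euclideanreal (\<lambda>x. f x i)" for i
    proof (cases "i \<le> m")
      case True
      have "continuous_map ?X euclideanreal (\<lambda>x. (x i - b) / N x)"
        by (intro continuous_map_real_divide continuous_intros continuous_map_coordinate cN)
          (use N_pos in fastforce)+
      then show ?thesis using True by (simp add: f_def)
    qed (simp add: f_def)
  qed (use fT in auto)
  have cg: "continuous_map (subtopology (powertop_real UNIV) T) ?X g"
  proof (rule continuous_map_into_powertop)
    show "continuous_map (subtopology (powertop_real UNIV) T) euclideanreal (\<lambda>x. g x i)" for i
      unfolding g_def
      by (cases "i \<le> m"; cases "i = Suc m")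
        (auto intro!: continuous_intros continuous_map_coordinate)
  qed (use gS in auto)
  have "f (g u) = u" if "u \<in> T" for u
  proof
    fix i show "f (g u) i = u i"
      using gN[OF that] e0 that by (auto simp: f_def g_def T_def)
  qed
  then have fg: "homotopic_with (\<lambda>_. True) (subtopology (powertop_real UNIV) T)
      (subtopology (powertop_real UNIV) T) (f \<circ> g) id"
    using continuous_map_compose[OF cg cf] by (intro homotopic_with_equal) auto
  have gf: "homotopic_with (\<lambda>_. True) ?X ?X (g \<circ> f) id"
  proof (rule straight_line_homotopy)
    show "continuous_map ?X ?X (g \<circ> f)" by (rule continuous_map_compose[OF cf cg])
    show "continuous_map ?X ?X id" by simp
    fix x :: "nat \<Rightarrow> real" and t :: real
    assume x': "x \<in> topspace ?X" and t: "0 \<le> t" "t \<le> 1"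
    then have x: "x \<in> S" by simp
    let ?y = "\<lambda>i. (1 - t) * (g \<circ> f) x i + t * id x i"
    have "?y \<in> simplex_interior (Suc m)"
      using x gS[OF fT[OF x]] t by (intro simplex_interior_convex) (auto simp: S_def)
    moreover have "?y \<noteq> barycenter (Suc m)"
    proof
      assume eq: "?y = barycenter (Suc m)"
      \<comment> \<open>Along the segment, the deviation from \<open>b\<close> in each chart
        coordinate is that of \<open>x\<close> times this positive factor. It vanishes throughout
        only if \<open>x\<close> is the barycenter.\<close>
      have pos: "(1 - t) * (e / N x) + t > 0"
        using t e0 N_pos[OF x] by (cases "t = 0") (auto intro!: add_nonneg_pos)
      have "x i = b" if i: "i \<le> m" for i
      proof -
        have "?y i - b = ((1 - t) * (e / N x) + t) * (x i - b)"
          using i by (simp add: g_def f_def algebra_simps)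
        moreover have "?y i = b" using eq i by (simp add: barycenter_def b_def fun_eq_iff)
        ultimately show ?thesis using pos by simp
      qed
      then show False using eq_b x by (auto simp: S_def)
    qed
    ultimately show "?y \<in> S" by (simp add: S_def)
  qed
  have "?X homotopy_equivalent_space subtopology (powertop_real UNIV) T"
    unfolding homotopy_equivalent_space_def using cf cg fg gf by blast
  then show ?thesis by (simp add: Y S_def)
qed

text \<open>A point becomes empty when punctured; otherwise a sphere of dimension
  \<open>n - 1\<close> remains. Both cases fit the formula.\<close>

lemma has_euler_punctured_simplex_interior:
  "has_euler (subtopology (powertop_real UNIV) (simplex_interior n - {barycenter n})) {} (1 - (-1) ^ n)"
proof (cases n)
  case 0
  have "simplex_interior 0 - {barycenter 0} = {}"
  proof -
    have "x = barycenter 0" if "x \<in> simplex_interior 0" for x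
      using that by (auto simp: simplex_interior_iff barycenter_def)
    then show ?thesis by blast
  qed
  then show ?thesis using 0 by (simp add: has_euler_empty)
next
  case (Suc m)
  show ?thesis
    using has_euler_homotopy_equivalent[OF has_euler_nsphere[of m]
        homotopy_equivalent_space_sym[THEN iffD1, OF punctured_simplex_interior_nsphere]] Suc
    by simp
qed

section \<open>Radial projection onto the boundary of a simplex\<close>

lemma continuous_map_Min:
  fixes f :: "'i \<Rightarrow> 'a \<Rightarrow> real"
  assumes "finite I" "I \<noteq> {}" "\<And>i. i \<in> I \<Longrightarrow> continuous_map X euclideanreal (f i)"
  shows "continuous_map X euclideanreal (\<lambda>x. Min ((\<lambda>i. f i x) ` I))"
  using assms
proof (induction I rule: finite_ne_induct)
  case (insert i I)
  have "continuous_map X euclideanreal (\<lambda>x. min (f i x) (Min ((\<lambda>i. f i x) ` I)))"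
    using insert by (intro continuous_map_real_min) auto
  then show ?case using insert by simp
qed simp

context
  fixes n :: nat
begin

definition min_coord :: "(nat \<Rightarrow> real) \<Rightarrow> real" where
  "min_coord x = Min ((\<lambda>i. x i) ` {..n})"

text \<open>The point where the ray from the barycenter through \<open>x\<close> leaves the simplex.\<close>

definition radial :: "(nat \<Rightarrow> real) \<Rightarrow> nat \<Rightarrow> real" where
  "radial x i = (if i \<le> n then (x i - min_coord x) / (1 - real (Suc n) * min_coord x) else 0)"

lemma min_coord_le: "i \<le> n \<Longrightarrow> min_coord x \<le> x i"
  unfolding min_coord_def by (intro Min_le) auto

lemma min_coord_attained: "\<exists>i\<le>n. x i = min_coord x"
proof -
  have "min_coord x \<in> (\<lambda>i. x i) ` {..n}"
    unfolding min_coord_def by (intro Min_in) auto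
  then show ?thesis by auto
qed

lemma min_coord_boundary:
  assumes "x \<in> standard_simplex n - simplex_interior n"
  shows "min_coord x = 0"
proof -
  obtain i where "i \<le> n" "x i = 0"
    using assms by (force simp: standard_simplex_iff simplex_interior_iff)
  then have "min_coord x \<le> 0" using min_coord_le[of i x] by simp
  moreover have "min_coord x \<ge> 0"
    using min_coord_attained[of x] assms by (auto simp: standard_simplex_iff)
  ultimately show ?thesis by simp
qed

lemma all_equal_barycenter:
  assumes x: "x \<in> standard_simplex n" and eq: "\<And>i. i \<le> n \<Longrightarrow> x i = c"
  shows "x = barycenter n"
proof
  fix i
  have "real (Suc n) * c = 1"
    using x eq by (simp add: standard_simplex_iff)
  then have "c = 1 / real (Suc n)" by (simp add: field_simps)
  then show "x i = barycenter n i"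
    using x eq by (auto simp: barycenter_def standard_simplex_iff)
qed

lemma min_coord_less:
  assumes x: "x \<in> standard_simplex n" "x \<noteq> barycenter n"
  shows "real (Suc n) * min_coord x < 1"
proof -
  obtain i where "i \<le> n" "x i \<noteq> min_coord x"
    using all_equal_barycenter[OF x(1), of "min_coord x"] x(2) by blast
  then have "(\<Sum>i\<le>n. min_coord x) < (\<Sum>i\<le>n. x i)"
    using min_coord_le[of _ x] by (intro sum_strict_mono_ex1) (auto intro!: bexI[of _ i] simp: less_le)
  then show ?thesis using x by (simp add: standard_simplex_iff)
qed

text \<open>Subtracting the least coordinate from all of them makes one coordinate zero and leaves
  the total \<open>1 - (n + 1) * min_coord x\<close>. Away from the barycenter this is positive, and
  division by it returns to the simplex.\<close>

lemma radial_boundary: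
  assumes x: "x \<in> standard_simplex n" "x \<noteq> barycenter n"
  shows "radial x \<in> standard_simplex n - simplex_interior n"
proof -
  let ?m = "min_coord x"
  have pos: "1 - real (Suc n) * ?m > 0" using min_coord_less[OF x] by simp
  have "(\<Sum>i\<le>n. radial x i) = (\<Sum>i\<le>n. x i - ?m) / (1 - real (Suc n) * ?m)"
    by (simp add: radial_def sum_divide_distrib)
  also have "(\<Sum>i\<le>n. x i - ?m) = 1 - real (Suc n) * ?m"
    using x by (simp add: sum_subtractf standard_simplex_iff)
  finally have "(\<Sum>i\<le>n. radial x i) = 1" using pos by simp
  moreover have "0 \<le> radial x i" if "i \<le> n" for i
    using that pos min_coord_le[of i x] by (simp add: radial_def)
  moreover obtain i where "i \<le> n" "x i = ?m" using min_coord_attained by blast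
  then have "i \<le> n" "radial x i = 0" by (auto simp: radial_def)
  ultimately show ?thesis
    by (force simp: standard_simplex_iff simplex_interior_iff radial_def)
qed

lemma radial_fixed:
  assumes "x \<in> standard_simplex n - simplex_interior n"
  shows "radial x = x"
  using min_coord_boundary[OF assms] assms by (auto simp: radial_def fun_eq_iff standard_simplex_iff)

text \<open>At a fixed time every coordinate of the moving point is the same increasing affine
  function, with slope \<open>(1 - t) + t / ?q\<close>, of the corresponding coordinate of
  \<open>x\<close>. If the coordinates became equal, those of \<open>x\<close> would have been
  equal.\<close>

lemma radial_line:
  assumes x: "x \<in> standard_simplex n" "x \<noteq> barycenter n" and t: "0 \<le> t" "t \<le> 1"
  shows "(\<lambda>i. (1 - t) * x i + t * radial x i) \<in> standard_simplex n - {barycenter n}"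
proof -
  let ?m = "min_coord x" and ?y = "\<lambda>i. (1 - t) * x i + t * radial x i"
  let ?q = "1 - real (Suc n) * ?m"
  have q: "?q > 0" using min_coord_less[OF x] by simp
  have "?y \<in> standard_simplex n"
    using radial_boundary[OF x] x t by (intro convex_standard_simplex) auto
  moreover have "?y \<noteq> barycenter n"
  proof
    assume eq: "?y = barycenter n"
    let ?c = "(1 - t) + t / ?q"
    have "?c > 0"
      using t q by (cases "t = 0") (auto intro!: add_nonneg_pos)
    have "x i = (barycenter n 0 + t * ?m / ?q) / ?c" if i: "i \<le> n" for i
    proof -
      have "?y i = barycenter n 0" using eq i by (simp add: fun_eq_iff barycenter_def)
      then have "?c * x i = barycenter n 0 + t * ?m / ?q"
        using i by (simp add: radial_def algebra_simps diff_divide_distrib)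
      then show ?thesis using \<open>?c > 0\<close> by (simp add: field_simps)
    qed
    then have "x = barycenter n" by (rule all_equal_barycenter[OF x(1)])
    with x(2) show False ..
  qed
  ultimately show ?thesis by simp
qed

lemma continuous_map_radial_line:
  "continuous_map (prod_topology (top_of_set {0..1})
       (subtopology (powertop_real UNIV) (standard_simplex n - {barycenter n})))
     (subtopology (powertop_real UNIV) (standard_simplex n - {barycenter n}))
     (\<lambda>z i. (1 - fst z) * snd z i + fst z * radial (snd z) i)"
    (is "continuous_map (prod_topology ?I ?P) _ _")
proof (rule continuous_map_into_powertop)
  have t: "continuous_map (prod_topology ?I ?P) euclideanreal fst"
    by (rule continuous_map_into_fulltopology[OF continuous_map_fst])
  have c: "continuous_map (prod_topology ?I ?P) euclideanreal (\<lambda>z. g (snd z))"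
    if "continuous_map ?P euclideanreal g" for g
    using continuous_map_compose[OF continuous_map_snd[of ?I ?P] that] by (simp add: o_def)
  have m: "continuous_map ?P euclideanreal min_coord"
    unfolding min_coord_def by (intro continuous_map_Min continuous_map_coordinate) auto
  have r: "continuous_map ?P euclideanreal (\<lambda>x. radial x i)" for i
  proof (cases "i \<le> n")
    case True
    have "continuous_map ?P euclideanreal (\<lambda>x. (x i - min_coord x) / (1 - real (Suc n) * min_coord x))"
      by (intro continuous_map_real_divide continuous_intros continuous_map_coordinate m)
        (use min_coord_less in fastforce)+
    then show ?thesis using True by (simp add: radial_def)
  qed (simp add: radial_def)
  show "continuous_map (prod_topology ?I ?P) euclideanreal
      (\<lambda>z. (1 - fst z) * snd z i + fst z * radial (snd z) i)" for i
    by (intro continuous_intros t c[of "\<lambda>x. x i"] c[of "\<lambda>x. radial x i"] r continuous_map_coordinate) auto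
qed (use radial_line in auto)

end

section \<open>One cell attached to a closed subspace\<close>

lemma Hausdorff_space_simplex: "Hausdorff_space (subtopology (powertop_real UNIV) (S :: (nat \<Rightarrow> real) set))"
  by (intro Hausdorff_space_subtopology) (simp add: Hausdorff_space_product_topology)

text \<open>No pushout description of \<open>X\<close> is assumed. That \<open>\<Phi>\<close> is a
  closed map supplies what a quotient topology would: the open cell is a homeomorphic image, the
  center is a closed point, and maps out of the punctured cell may be checked on the
  simplex.\<close>

locale attached_cell =
  fixes X :: "'a topology" and A :: "'a set" and n :: nat and \<Phi> :: "(nat \<Rightarrow> real) \<Rightarrow> 'a"
  assumes A: "closedin X A"
    and cont: "continuous_map (simplex_space n) X \<Phi>"
    and clo: "closed_map (simplex_space n) X \<Phi>"
    and inj: "inj_on \<Phi> (simplex_interior n)"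
    and im: "\<Phi> ` simplex_interior n = topspace X - A"
    and bd: "\<Phi> ` (standard_simplex n - simplex_interior n) \<subseteq> A"
begin

definition center where "center = \<Phi> (barycenter n)"
definition punctured where "punctured = topspace X - {center}"

lemma A_subset: "A \<subseteq> topspace X"
  using A by (rule closedin_subset)

lemma center_notin: "center \<in> topspace X" "center \<notin> A"
  using im barycenter_interior[of n] by (auto simp: center_def)

lemma \<Phi>_eq_center_iff: "x \<in> standard_simplex n \<Longrightarrow> \<Phi> x = center \<longleftrightarrow> x = barycenter n"
  using inj bd center_notin barycenter_interior[of n]
  by (cases "x \<in> simplex_interior n") (auto simp: center_def inj_on_def)

lemma \<Phi>_in_A_iff: "x \<in> standard_simplex n \<Longrightarrow> \<Phi> x \<in> A \<longleftrightarrow> x \<notin> simplex_interior n"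
  using im bd by auto

lemma \<Phi>_topspace: "x \<in> standard_simplex n \<Longrightarrow> \<Phi> x \<in> topspace X"
  using im bd A_subset by (cases "x \<in> simplex_interior n") auto

lemma A_punctured: "A \<subseteq> punctured"
  using A_subset center_notin by (auto simp: punctured_def)

lemma openin_punctured: "openin X punctured"
proof -
  have "closedin (simplex_space n) {barycenter n}"
    using barycenter_interior[of n] simplex_interior_subset[of n]
    by (intro closedin_Hausdorff_singleton Hausdorff_space_simplex) auto
  then have "closedin X (\<Phi> ` {barycenter n})"
    using clo by (meson closed_map_def)
  then show ?thesis by (simp add: punctured_def center_def openin_diff)
qed

text \<open>A closed map stays closed on a full preimage. Since \<open>T\<close> avoids
  \<open>A\<close>, this preimage lies in the open simplex, where \<open>\<Phi>\<close> is
  injective.\<close>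

lemma homeomorphic_restriction:
  assumes "T \<subseteq> topspace X - A"
  shows "subtopology (powertop_real UNIV) {x \<in> simplex_interior n. \<Phi> x \<in> T} homeomorphic_space subtopology X T"
proof -
  let ?S = "{x \<in> simplex_interior n. \<Phi> x \<in> T}"
  have S: "{x \<in> topspace (simplex_space n). \<Phi> x \<in> T} = ?S"
    using assms \<Phi>_in_A_iff simplex_interior_subset[of n] by auto
  have sub: "subtopology (simplex_space n) ?S = subtopology (powertop_real UNIV) ?S"
    using simplex_interior_subset[of n] by (simp add: subtopology_subtopology Int_absorb1 subset_iff)
  have img: "\<Phi> ` ?S = T" using im assms by auto
  have "closed_map (subtopology (powertop_real UNIV) ?S) (subtopology X T) \<Phi>"
    using closed_map_restriction[OF clo S] by (simp add: sub)
  moreover have "continuous_map (subtopology (powertop_real UNIV) ?S) (subtopology X T) \<Phi>"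
    unfolding sub[symmetric] using img
    by (auto simp: continuous_map_in_subtopology intro: continuous_map_from_subtopology cont)
  moreover have "inj_on \<Phi> ?S" using inj by (rule inj_on_subset) auto
  ultimately have "homeomorphic_map (subtopology (powertop_real UNIV) ?S) (subtopology X T) \<Phi>"
    using img assms A_subset by (intro bijective_closed_imp_homeomorphic_map) auto
  then show ?thesis by (rule homeomorphic_map_imp_homeomorphic_space)
qed

lemma has_euler_pair: "has_euler X punctured ((-1) ^ n)"
proof -
  let ?V = "subtopology X (topspace X - A)"
  have "has_euler ?V {} 1"
  proof (rule has_euler_homotopy_equivalent[OF has_euler_simplex_interior[of n]])
    have "{x \<in> simplex_interior n. \<Phi> x \<in> topspace X - A} = simplex_interior n"
      using im by auto
    then show "subtopology (powertop_real UNIV) (simplex_interior n) homotopy_equivalent_space ?V"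
      using homeomorphic_restriction[OF order_refl] homeomorphic_imp_homotopy_equivalent_space by metis
  qed
  moreover have "has_euler (subtopology ?V (punctured - A)) {} (1 - (-1) ^ n)"
  proof (rule has_euler_homotopy_equivalent[OF has_euler_punctured_simplex_interior[of n]])
    have "{x \<in> simplex_interior n. \<Phi> x \<in> punctured - A} = simplex_interior n - {barycenter n}"
      using im \<Phi>_eq_center_iff simplex_interior_subset[of n] by (auto simp: punctured_def)
    moreover have "subtopology ?V (punctured - A) = subtopology X (punctured - A)"
      by (auto simp: subtopology_subtopology punctured_def intro!: arg_cong[of _ _ "subtopology X"])
    moreover have "punctured - A \<subseteq> topspace X - A" by (auto simp: punctured_def)
    ultimately show "subtopology (powertop_real UNIV) (simplex_interior n - {barycenter n})
        homotopy_equivalent_space subtopology ?V (punctured - A)"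
      using homeomorphic_restriction homeomorphic_imp_homotopy_equivalent_space by metis
  qed
  ultimately have "has_euler ?V (punctured - A) ((-1) ^ n)"
    using has_euler_relative[of ?V "punctured - A" "1 - (-1) ^ n" 1] by simp
  then show ?thesis
  proof (rule has_euler_iso)
    fix p
    \<comment> \<open>Excision asks for the closure of \<open>A\<close> inside the interior of
      \<open>punctured\<close>; as \<open>A\<close> is closed and \<open>punctured\<close> open,
      this is plain inclusion.\<close>
    have "X closure_of A \<subseteq> X interior_of punctured"
      using A openin_punctured A_punctured by (simp add: closure_of_closedin interior_of_openin)
    moreover have "punctured \<subseteq> topspace X" by (auto simp: punctured_def)
    ultimately show "relative_homology_group (int p) ?V (punctured - A) \<cong>
        relative_homology_group (int p) X punctured"
      using homology_excision_axiom[of X A punctured "topspace X" "int p"]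
      unfolding subtopology_topspace by (blast intro: is_isoI)
  qed
qed

definition pull where
  "pull z = (if snd z \<in> A then snd z
     else let x = inv_into (simplex_interior n) \<Phi> (snd z)
          in \<Phi> (\<lambda>i. (1 - fst z) * x i + fst z * radial n x i))"

lemma pull_A: "u \<in> A \<Longrightarrow> pull (t, u) = u"
  by (simp add: pull_def)

text \<open>On the boundary of the simplex \<open>radial\<close> is the identity, so the formula
  agrees there with the constant homotopy on \<open>A\<close>. Hence it does not matter which point
  of the closed simplex represents a point of \<open>X\<close>.\<close>

lemma pull_\<Phi>:
  assumes "x \<in> standard_simplex n"
  shows "pull (t, \<Phi> x) = \<Phi> (\<lambda>i. (1 - t) * x i + t * radial n x i)"
proof (cases "x \<in> simplex_interior n")
  case True
  then show ?thesis
    using \<Phi>_in_A_iff[OF assms] inj by (simp add: pull_def)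
next
  case False
  then have "radial n x = x" using assms by (intro radial_fixed) auto
  moreover have "(\<lambda>i. (1 - t) * x i + t * x i) = x" by (simp add: algebra_simps)
  ultimately show ?thesis
    using \<Phi>_in_A_iff[OF assms] False by (simp add: pull_A)
qed

lemma punctured_cases:
  assumes "u \<in> punctured"
  obtains "u \<in> A" | x where "x \<in> standard_simplex n" "x \<noteq> barycenter n" "u = \<Phi> x"
proof (cases "u \<in> A")
  case False
  then have "u \<in> \<Phi> ` simplex_interior n" using assms im by (auto simp: punctured_def)
  then show ?thesis
    using that(2) assms simplex_interior_subset[of n] by (auto simp: punctured_def center_def)
qed

text \<open>The homotopy is pasted from two relatively closed pieces: \<open>A\<close>, where it is
  constant, and the image \<open>W\<close> of the punctured closed simplex, where continuity is
  tested upstairs.\<close>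

lemma continuous_map_pull:
  "continuous_map (prod_topology (top_of_set {0..1}) (subtopology X punctured)) (subtopology X punctured) pull"
proof -
  let ?I = "top_of_set {0..1::real}"
  let ?S = "standard_simplex n - {barycenter n}"
  let ?P = "subtopology (powertop_real UNIV) ?S"
  define W where "W = \<Phi> ` ?S"
  have W: "W = \<Phi> ` standard_simplex n \<inter> punctured"
    using \<Phi>_eq_center_iff \<Phi>_topspace by (auto simp: W_def punctured_def)
  have subP: "subtopology (simplex_space n) ?S = ?P"
    by (simp add: subtopology_subtopology Int_absorb1 Diff_subset)
  have "closedin X (\<Phi> ` standard_simplex n)"
    using clo closedin_topspace[of "simplex_space n"] unfolding closed_map_def by fastforce
  then have cW: "closedin (subtopology X punctured) W"
    unfolding W by (auto simp: closedin_subtopology)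
  have cA: "closedin (subtopology X punctured) A"
    using A A_punctured by (simp add: closedin_closed_subtopology closedin_subset_topspace)
  have cover: "punctured \<subseteq> A \<union> W"
    using punctured_cases unfolding W_def by blast
  have contW: "continuous_map (prod_topology ?I (subtopology X W)) (subtopology X punctured) pull"
  proof -
    have pre: "{x \<in> topspace (simplex_space n). \<Phi> x \<in> W} = ?S"
      using \<Phi>_eq_center_iff by (auto simp: W punctured_def \<Phi>_topspace)
    have "closed_map ?P (subtopology X W) \<Phi>"
      using closed_map_restriction[OF clo pre] by (simp add: subP)
    moreover have "continuous_map ?P (subtopology X W) \<Phi>"
      unfolding subP[symmetric]
      by (auto simp: continuous_map_in_subtopology W_def intro: continuous_map_from_subtopology cont)
    moreover have "\<Phi> ` topspace ?P = topspace (subtopology X W)"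
      using \<Phi>_topspace by (auto simp: W_def)
    ultimately have "quotient_map ?P (subtopology X W) \<Phi>"
      by (intro continuous_closed_imp_quotient_map)
    \<comment> \<open>A quotient map need not stay one after taking products; here the other factor
      is the unit interval, which is locally compact Hausdorff.\<close>
    then have q: "quotient_map (prod_topology ?I ?P) (prod_topology ?I (subtopology X W)) (\<lambda>(t, x). (t, \<Phi> x))"
      by (intro quotient_map_prod_right)
        (auto simp: Hausdorff_space_subtopology compact_imp_locally_compact_space compact_space_subtopology)
    have "continuous_map ?P (subtopology X punctured) \<Phi>"
      unfolding subP[symmetric] using \<Phi>_eq_center_iff \<Phi>_topspace
      by (auto simp: continuous_map_in_subtopology punctured_def intro: continuous_map_from_subtopology cont)
    from continuous_map_compose[OF continuous_map_radial_line this]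
    have "continuous_map (prod_topology ?I ?P) (subtopology X punctured) (pull \<circ> (\<lambda>(t, x). (t, \<Phi> x)))"
      by (rule continuous_map_eq) (auto simp: pull_\<Phi>)
    then show ?thesis
      by (rule continuous_compose_quotient_map[OF q])
  qed
  have contA: "continuous_map (prod_topology ?I (subtopology X A)) (subtopology X punctured) pull"
  proof -
    have "continuous_map (prod_topology ?I (subtopology X A)) (subtopology X punctured) snd"
      using A_punctured continuous_map_snd[of ?I "subtopology X A"]
      by (auto simp: continuous_map_in_subtopology)
    then show ?thesis
      by (rule continuous_map_eq) (auto simp: pull_A)
  qed
  show ?thesis
  proof (rule pasting_lemma_closed[where I = "{A, W}" and T = "\<lambda>B. {0..1} \<times> B" and f = "\<lambda>_. pull"])
    fix B assume "B \<in> {A, W}"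
    then have B: "closedin (subtopology X punctured) B" "B \<subseteq> punctured"
      "continuous_map (prod_topology ?I (subtopology X B)) (subtopology X punctured) pull"
      using cA cW contA contW A_punctured by (auto simp: W)
    show "closedin (prod_topology ?I (subtopology X punctured)) ({0..1} \<times> B)"
      using B(1) by (simp add: closedin_prod_Times_iff)
    have "subtopology (prod_topology ?I (subtopology X punctured)) ({0..1} \<times> B) =
        prod_topology ?I (subtopology X B)"
      using B(2) by (simp add: subtopology_Times subtopology_subtopology Int_absorb1)
    with B(3) show "continuous_map (subtopology (prod_topology ?I (subtopology X punctured)) ({0..1} \<times> B))
        (subtopology X punctured) pull" by simp
  qed (use cover in auto)
qed

lemma has_euler_punctured:
  assumes "has_euler (subtopology X A) {} a"
  shows "has_euler (subtopology X punctured) {} a"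
proof (rule has_euler_homotopy_equivalent[OF assms])
  let ?U = "subtopology X punctured"
  let ?r = "\<lambda>u. pull (1, u)"
  have h: "homotopic_with (\<lambda>_. True) ?U ?U (\<lambda>u. pull (0, u)) ?r"
    unfolding homotopic_with_def using continuous_map_pull by (intro exI[of _ pull]) auto
  have p0: "pull (0, u) = u" if "u \<in> punctured" for u
    using that by (cases rule: punctured_cases) (auto simp: pull_A pull_\<Phi>)
  have p1: "pull (1, u) \<in> A" if "u \<in> punctured" for u
    using that
  proof (cases rule: punctured_cases)
    case (2 x)
    then show ?thesis
      using radial_boundary[OF 2(1,2)] \<Phi>_in_A_iff by (simp add: pull_\<Phi>)
  qed (simp add: pull_A)
  have "homotopic_with (\<lambda>_. True) ?U ?U ?r id"
    by (rule homotopic_with_eq[OF homotopic_with_symD[OF h]]) (auto simp: p0)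
  moreover have "retraction_maps ?U (subtopology X A) ?r id"
  proof -
    have "continuous_map ?U ?U ?r" using homotopic_with_imp_continuous_maps[OF h] by blast
    then have "continuous_map ?U (subtopology X A) ?r"
      using p1 by (auto simp: continuous_map_in_subtopology)
    then show ?thesis
      using A_punctured by (auto simp: retraction_maps_def pull_A continuous_map_in_subtopology)
  qed
  ultimately have "?U homotopy_equivalent_space subtopology X A"
    by (rule deformation_retract_imp_homotopy_equivalent_space)
  then show "subtopology X A homotopy_equivalent_space ?U"
    by (rule homotopy_equivalent_space_sym[THEN iffD1])
qed

lemma has_euler_attach:
  assumes "has_euler (subtopology X A) {} a"
  shows "has_euler X {} (a + (-1) ^ n)"
  by (rule has_euler_from_pair[OF has_euler_punctured[OF assms] has_euler_pair])

end

text \<open>A cell of maximal dimension is removed. Boundaries lie in cells of strictly smaller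
  dimension, hence never in the removed cell, so the remaining cells satisfy all hypotheses on their
  union.\<close>

theorem has_euler_finite_cell_complex:
  assumes "finite I"
    and "\<And>i. i \<in> I \<Longrightarrow> continuous_map (simplex_space (d i)) X (\<Phi> i)"
    and "\<And>i. i \<in> I \<Longrightarrow> closed_map (simplex_space (d i)) X (\<Phi> i)"
    and "\<And>i. i \<in> I \<Longrightarrow> inj_on (\<Phi> i) (simplex_interior (d i))"
    and "\<And>i j. i \<in> I \<Longrightarrow> j \<in> I \<Longrightarrow> i \<noteq> j \<Longrightarrow>
           \<Phi> i ` simplex_interior (d i) \<inter> \<Phi> j ` simplex_interior (d j) = {}"
    and "topspace X = (\<Union>i\<in>I. \<Phi> i ` simplex_interior (d i))"
    and "\<And>i. i \<in> I \<Longrightarrow> \<Phi> i ` (standard_simplex (d i) - simplex_interior (d i)) \<subseteq>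
           (\<Union>j\<in>{j \<in> I. d j < d i}. \<Phi> j ` simplex_interior (d j))"
  shows "has_euler X {} (\<Sum>i\<in>I. (-1) ^ d i)"
  using assms
proof (induction I arbitrary: X rule: finite_psubset_induct)
  case (psubset I)
  show ?case
  proof (cases "I = {}")
    case True
    then show ?thesis using psubset.prems(5) by (simp add: has_euler_empty)
  next
    case False
    then have "Max (d ` I) \<in> d ` I" using psubset.hyps by (intro Max_in) auto
    then obtain i where i: "i \<in> I" and "d i = Max (d ` I)" by auto
    then have max: "d j \<le> d i" if "j \<in> I" for j
      using that psubset.hyps by simp
    define J where "J = I - {i}"
    define A where "A = (\<Union>j\<in>J. \<Phi> j ` simplex_interior (d j))"
    have J: "J \<subset> I" "J \<subseteq> I" "finite J" using i psubset.hyps by (auto simp: J_def)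
    have bdJ: "\<Phi> j ` (standard_simplex (d j) - simplex_interior (d j)) \<subseteq>
        (\<Union>k\<in>{k \<in> J. d k < d j}. \<Phi> k ` simplex_interior (d k))" if "j \<in> I" for j
      using psubset.prems(6)[OF that] max[OF that] unfolding J_def by fastforce
    have bdA: "\<Phi> j ` (standard_simplex (d j) - simplex_interior (d j)) \<subseteq> A" if "j \<in> I" for j
      by (rule order_trans[OF bdJ[OF that]]) (auto simp: A_def)
    have imJ: "\<Phi> j ` standard_simplex (d j) \<subseteq> A" if "j \<in> J" for j
    proof -
      have "\<Phi> j ` simplex_interior (d j) \<subseteq> A" using that by (auto simp: A_def)
      then show ?thesis using bdA[of j] that J(2) by blast
    qed
    \<comment> \<open>Rewritten with closed simplices, the union becomes a finite union of images of
      closed sets under closed maps.\<close>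
    have "A = (\<Union>j\<in>J. \<Phi> j ` standard_simplex (d j))"
      using imJ simplex_interior_subset by (fastforce simp: A_def)
    moreover have "closedin X (\<Phi> j ` standard_simplex (d j))" if "j \<in> J" for j
      using psubset.prems(2)[of j] closedin_topspace[of "simplex_space (d j)"] that J(2)
      unfolding closed_map_def by fastforce
    ultimately have closed: "closedin X A"
      using J(3) by (auto intro!: closedin_Union)
    have "has_euler (subtopology X A) {} (\<Sum>j\<in>J. (-1) ^ d j)"
    proof (rule psubset.IH[OF J(1)])
      show "continuous_map (simplex_space (d j)) (subtopology X A) (\<Phi> j)" if "j \<in> J" for j
        using imJ[OF that] psubset.prems(1)[of j] that J(2)
        by (auto simp: continuous_map_in_subtopology)
      show "closed_map (simplex_space (d j)) (subtopology X A) (\<Phi> j)" if "j \<in> J" for j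
        using imJ[OF that] psubset.prems(2)[of j] that J(2)
        by (intro closed_map_into_subtopology) auto
      show "inj_on (\<Phi> j) (simplex_interior (d j))" if "j \<in> J" for j
        using psubset.prems(3)[of j] that J(2) by blast
      show "\<Phi> j ` simplex_interior (d j) \<inter> \<Phi> k ` simplex_interior (d k) = {}"
        if "j \<in> J" "k \<in> J" "j \<noteq> k" for j k
        using psubset.prems(4)[of j k] that J(2) by blast
      show "topspace (subtopology X A) = (\<Union>j\<in>J. \<Phi> j ` simplex_interior (d j))"
        using closedin_subset[OF closed] by (auto simp: A_def)
      show "\<Phi> j ` (standard_simplex (d j) - simplex_interior (d j)) \<subseteq>
          (\<Union>k\<in>{k \<in> J. d k < d j}. \<Phi> k ` simplex_interior (d k))" if "j \<in> J" for j
        using bdJ that J(2) by blast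
    qed
    moreover have "attached_cell X A (d i) (\<Phi> i)"
    proof (rule attached_cell.intro[OF closed])
      have "\<Phi> i ` simplex_interior (d i) \<inter> A = {}"
      proof -
        have "\<Phi> i ` simplex_interior (d i) \<inter> \<Phi> j ` simplex_interior (d j) = {}" if "j \<in> J" for j
          using that by (intro psubset.prems(4)[OF i]) (auto simp: J_def)
        then show ?thesis unfolding A_def by blast
      qed
      moreover have "topspace X = \<Phi> i ` simplex_interior (d i) \<union> A"
        unfolding psubset.prems(5) A_def J_def using i by blast
      ultimately show "\<Phi> i ` simplex_interior (d i) = topspace X - A" by blast
    qed (rule psubset.prems(1)[OF i] psubset.prems(2)[OF i] psubset.prems(3)[OF i] bdA[OF i])+
    ultimately have "has_euler X {} ((\<Sum>j\<in>J. (-1) ^ d j) + (-1) ^ d i)"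
      by (intro attached_cell.has_euler_attach)
    moreover have "(\<Sum>j\<in>I. (-1) ^ d j) = (\<Sum>j\<in>J. (-1) ^ d j) + ((-1) ^ d i :: int)"
      using i psubset.hyps by (simp add: J_def sum.remove[of I i])
    ultimately show ?thesis by (simp only:)
  qed
qed

section \<open>Contractions of graphs\<close>

lemma joined_by_subset_verts: "(u, v) \<in> joined_by G F \<Longrightarrow> u \<in> verts G \<and> v \<in> verts G"
  by (auto simp: joined_by_def)

lemma joined_by_mono: "F \<subseteq> F' \<Longrightarrow> joined_by G F \<subseteq> joined_by G F'"
proof -
  assume "F \<subseteq> F'"
  then have "{(x, y). \<exists>e\<in>F. ends G e = Upair x y} \<subseteq> {(x, y). \<exists>e\<in>F'. ends G e = Upair x y}"
    by blast
  from rtrancl_mono[OF this] show ?thesis by (auto simp: joined_by_def)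
qed

lemma joined_by_refl: "u \<in> verts G \<Longrightarrow> (u, u) \<in> joined_by G F"
  by (simp add: joined_by_def)

lemma joined_by_sym: "(u, v) \<in> joined_by G F \<Longrightarrow> (v, u) \<in> joined_by G F"
  using equiv_joined_by[of G F] by (meson equivE symD)

lemma joined_by_trans: "(u, v) \<in> joined_by G F \<Longrightarrow> (v, w) \<in> joined_by G F \<Longrightarrow> (u, w) \<in> joined_by G F"
  using equiv_joined_by[of G F] by (meson equivE transD)

lemma joined_by_edge:
  "e \<in> F \<Longrightarrow> ends G e = Upair x y \<Longrightarrow> x \<in> verts G \<Longrightarrow> y \<in> verts G \<Longrightarrow> (x, y) \<in> joined_by G F"
  by (auto simp: joined_by_def)

lemma joined_by_class_eq:
  "u \<in> verts G \<Longrightarrow> v \<in> verts G \<Longrightarrow>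
     joined_by G F `` {u} = joined_by G F `` {v} \<longleftrightarrow> (u, v) \<in> joined_by G F"
  using eq_equiv_class_iff[OF equiv_joined_by] .

lemma edge_ends_verts:
  "\<forall>e\<in>edges G. set_uprod (ends G e) \<subseteq> verts G \<Longrightarrow> e \<in> edges G \<Longrightarrow> ends G e = Upair x y \<Longrightarrow>
     x \<in> verts G \<and> y \<in> verts G"
  by force

lemma joined_by_induct [consumes 2, case_names refl step]:
  assumes "(u, v) \<in> joined_by G F"
    and ends: "\<forall>e\<in>F. set_uprod (ends G e) \<subseteq> verts G"
    and "P u"
    and step: "\<And>x y e. (u, x) \<in> joined_by G F \<Longrightarrow> P x \<Longrightarrow> e \<in> F \<Longrightarrow> ends G e = Upair x y \<Longrightarrow>
       x \<in> verts G \<Longrightarrow> y \<in> verts G \<Longrightarrow> P y"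
  shows "P v"
proof -
  have uv: "(u, v) \<in> {(x, y). \<exists>e\<in>F. ends G e = Upair x y}\<^sup>*" and u: "u \<in> verts G"
    using assms(1) by (auto simp: joined_by_def)
  from uv have "P v \<and> v \<in> verts G"
  proof (induction rule: rtrancl_induct)
    case base
    then show ?case using assms(3) u by simp
  next
    case (step x y)
    then obtain e where e: "e \<in> F" "ends G e = Upair x y" by auto
    then have xy: "x \<in> verts G" "y \<in> verts G" using ends by force+
    moreover have "(u, x) \<in> joined_by G F"
      using step.hyps(1) u xy by (simp add: joined_by_def)
    ultimately show ?case using assms(4)[OF _ _ e] step.IH by blast
  qed
  then show ?thesis ..
qed

lemma quotient_eq_image: "A // r = (\<lambda>x. r `` {x}) ` A"
  by (auto simp: quotient_def)

text \<open>\<open>H\<close> is \<open>G\<close> with \<open>Y\<close> collapsed, described by maps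
  so that the vertex type of \<open>H\<close> stays free. Isomorphisms are the case
  \<open>Y = {}\<close>; for the graph built by \<open>collapse\<close>, \<open>h\<close> sends a
  vertex to its class.\<close>

locale contraction =
  fixes s :: nat and G :: "('v, 'e) legged_graph" and H :: "('w, 'f) legged_graph"
    and Y :: "'e set" and h :: "'v \<Rightarrow> 'w" and \<phi> :: "'e \<Rightarrow> 'f"
  assumes ends_G: "\<forall>e\<in>edges G. set_uprod (ends G e) \<subseteq> verts G"
    and legs_G: "\<forall>i\<in>{1..s}. leg G i \<in> verts G"
    and Y: "Y \<subseteq> edges G"
    and surj: "h ` verts G = verts H"
    and fibres: "\<And>u v. u \<in> verts G \<Longrightarrow> v \<in> verts G \<Longrightarrow> h u = h v \<longleftrightarrow> (u, v) \<in> joined_by G Y"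
    and bij: "bij_betw \<phi> (edges G - Y) (edges H)"
    and ends: "\<And>e. e \<in> edges G - Y \<Longrightarrow> ends H (\<phi> e) = map_uprod h (ends G e)"
    and legs: "\<And>i. i \<in> {1..s} \<Longrightarrow> leg H i = h (leg G i)"
begin

lemma ends_H: "\<forall>e\<in>edges H. set_uprod (ends H e) \<subseteq> verts H"
proof
  fix e assume "e \<in> edges H"
  then obtain d where d: "d \<in> edges G - Y" "e = \<phi> d" using bij by (auto simp: bij_betw_def)
  then have "set_uprod (ends H e) = h ` set_uprod (ends G d)" by (simp add: ends uprod.set_map)
  moreover have "set_uprod (ends G d) \<subseteq> verts G" using ends_G d by blast
  ultimately show "set_uprod (ends H e) \<subseteq> verts H" using surj by blast
qed

text \<open>Projecting a path is direct. A path in \<open>H\<close> lifts edge by edge, and where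
  consecutive lifts do not meet, their ends lie in one fibre of \<open>h\<close> and are joined
  inside \<open>Y\<close>.\<close>

lemma joined_iff:
  assumes Z: "Y \<subseteq> Z" "Z \<subseteq> edges G" and u: "u \<in> verts G" and v: "v \<in> verts G"
  shows "(h u, h v) \<in> joined_by H (\<phi> ` (Z - Y)) \<longleftrightarrow> (u, v) \<in> joined_by G Z"
proof
  have endsZ: "\<forall>e\<in>Z. set_uprod (ends G e) \<subseteq> verts G" using ends_G Z by blast
  assume "(u, v) \<in> joined_by G Z"
  then show "(h u, h v) \<in> joined_by H (\<phi> ` (Z - Y))"
    using endsZ
  proof (induction rule: joined_by_induct)
    case refl
    show ?case using u surj by (intro joined_by_refl) auto
  next
    case (step x y e)
    show ?case
    proof (cases "e \<in> Y")
      case True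
      then have "(x, y) \<in> joined_by G Y" using step by (intro joined_by_edge)
      then have "h x = h y" using fibres step by simp
      then show ?thesis using step.IH by simp
    next
      case False
      then have "ends H (\<phi> e) = Upair (h x) (h y)" using ends[of e] step Z by auto
      then have "(h x, h y) \<in> joined_by H (\<phi> ` (Z - Y))"
        using step False surj by (intro joined_by_edge[of "\<phi> e"]) auto
      then show ?thesis using step.IH joined_by_trans by metis
    qed
  qed
next
  have endsZ: "\<forall>e\<in>\<phi> ` (Z - Y). set_uprod (ends H e) \<subseteq> verts H"
  proof
    fix e assume "e \<in> \<phi> ` (Z - Y)"
    then have "e \<in> edges H" using bij Z by (auto simp: bij_betw_def)
    then show "set_uprod (ends H e) \<subseteq> verts H" using ends_H by blast
  qed
  assume "(h u, h v) \<in> joined_by H (\<phi> ` (Z - Y))"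
  \<comment> \<open>The claim is strengthened to the whole fibre over the current vertex, because
    the next edge may start at any vertex of it.\<close>
  then have "\<forall>z\<in>verts G. h z = h v \<longrightarrow> (u, z) \<in> joined_by G Z"
    using endsZ
  proof (induction rule: joined_by_induct)
    case refl
    show ?case
      using fibres[OF u] joined_by_mono[OF Z(1), of G] by (metis subsetD)
  next
    case (step x y e')
    then obtain e where e: "e \<in> Z" "e \<notin> Y" "e' = \<phi> e" by auto
    obtain p q where pq: "ends G e = Upair p q" by (metis uprod_exhaust)
    have pqv: "p \<in> verts G" "q \<in> verts G" using edge_ends_verts[OF ends_G _ pq] e Z by auto
    have "Upair x y = Upair (h p) (h q)"
      using step ends[of e] e Z pq by auto
    then obtain p' q' where p'q': "ends G e = Upair p' q'" "h p' = x" "h q' = y"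
      "p' \<in> verts G" "q' \<in> verts G"
    proof -
      have "Upair p q = Upair q p" by simp
      moreover have "x = h p \<and> y = h q \<or> x = h q \<and> y = h p"
        using \<open>Upair x y = Upair (h p) (h q)\<close> by simp
      ultimately show ?thesis using that pq pqv by metis
    qed
    have "(u, p') \<in> joined_by G Z" using step.IH p'q' by blast
    moreover have "(p', q') \<in> joined_by G Z" using p'q' e by (intro joined_by_edge)
    ultimately have uq: "(u, q') \<in> joined_by G Z" by (rule joined_by_trans)
    show ?case
    proof (intro ballI impI)
      fix z assume "z \<in> verts G" "h z = y"
      then have "(q', z) \<in> joined_by G Y" using fibres[of q' z] p'q' by simp
      then have "(q', z) \<in> joined_by G Z" using joined_by_mono[OF Z(1), of G] by blast
      with uq show "(u, z) \<in> joined_by G Z" by (rule joined_by_trans)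
    qed
  qed
  then show "(u, v) \<in> joined_by G Z" using v by blast
qed

text \<open>The analogue of the third isomorphism theorem: collapsing \<open>Y\<close> and then the
  images of the rest of \<open>Z\<close> amounts to collapsing \<open>Z\<close>.\<close>

lemma collapse_iso:
  assumes Z: "Y \<subseteq> Z" "Z \<subseteq> edges G"
  shows "\<exists>f. graph_iso s (collapse G Z) (collapse H (\<phi> ` (Z - Y))) f \<phi>"
proof -
  let ?Z = "\<phi> ` (Z - Y)"
  \<comment> \<open>All members of a class of \<open>G\<close> yield the same class of
    \<open>H\<close>, so this union is a single class.\<close>
  define f where "f C = (\<Union>u\<in>C. joined_by H ?Z `` {h u})" for C
  have hv: "h u \<in> verts H" if "u \<in> verts G" for u using surj that by blast
  have f: "f (joined_by G Z `` {u}) = joined_by H ?Z `` {h u}" if u: "u \<in> verts G" for u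
  proof -
    have "joined_by H ?Z `` {h z} = joined_by H ?Z `` {h u}" if "z \<in> joined_by G Z `` {u}" for z
    proof -
      have z: "(u, z) \<in> joined_by G Z" "z \<in> verts G"
        using that joined_by_subset_verts[of u z G Z] by auto
      then have "(h u, h z) \<in> joined_by H ?Z" using joined_iff[OF Z u] by simp
      then show ?thesis using joined_by_class_eq[OF hv[OF u] hv[OF z(2)], of ?Z] by metis
    qed
    moreover have "u \<in> joined_by G Z `` {u}" using joined_by_refl[OF u] by simp
    ultimately show ?thesis unfolding f_def by blast
  qed
  have "bij_betw f (verts G // joined_by G Z) (verts H // joined_by H ?Z)"
    unfolding bij_betw_def
  proof
    show "inj_on f (verts G // joined_by G Z)"
    proof (rule inj_onI)
      fix C D assume "C \<in> verts G // joined_by G Z" "D \<in> verts G // joined_by G Z" and eq: "f C = f D"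
      then obtain u v where uv: "u \<in> verts G" "C = joined_by G Z `` {u}" "v \<in> verts G" "D = joined_by G Z `` {v}"
        by (auto elim!: quotientE)
      then have "(h u, h v) \<in> joined_by H ?Z"
        using eq f joined_by_class_eq[OF hv hv] by simp
      then show "C = D" using uv joined_iff[OF Z] joined_by_class_eq by metis
    qed
    have "f ` (verts G // joined_by G Z) = (\<lambda>u. joined_by H ?Z `` {h u}) ` verts G"
      unfolding quotient_eq_image image_image by (rule image_cong[OF refl f])
    also have "\<dots> = verts H // joined_by H ?Z"
      unfolding quotient_eq_image surj[symmetric] image_image by (rule refl)
    finally show "f ` (verts G // joined_by G Z) = verts H // joined_by H ?Z" .
  qed
  moreover have "bij_betw \<phi> (edges G - Z) (edges H - ?Z)"
  proof -
    have "\<phi> ` ((edges G - Y) - (Z - Y)) = \<phi> ` (edges G - Y) - ?Z"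
      by (rule inj_on_image_set_diff[of _ "edges G - Y"]) (use bij Z in \<open>auto simp: bij_betw_def\<close>)
    moreover have "(edges G - Y) - (Z - Y) = edges G - Z" using Z by blast
    ultimately have "edges H - ?Z = \<phi> ` (edges G - Z)"
      using bij by (simp add: bij_betw_def)
    moreover have "inj_on \<phi> (edges G - Z)"
      using bij Z unfolding bij_betw_def by (auto intro: inj_on_subset)
    ultimately show ?thesis by (simp add: bij_betw_def)
  qed
  moreover have "map_uprod (\<lambda>v. joined_by H ?Z `` {v}) (ends H (\<phi> e)) =
      map_uprod f (map_uprod (\<lambda>v. joined_by G Z `` {v}) (ends G e))" if e: "e \<in> edges G - Z" for e
  proof -
    have "set_uprod (ends G e) \<subseteq> verts G" using ends_G e by blast
    then have "map_uprod (\<lambda>v. joined_by H ?Z `` {h v}) (ends G e) =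
        map_uprod (\<lambda>v. f (joined_by G Z `` {v})) (ends G e)"
      by (intro uprod.map_cong0) (auto simp: f)
    moreover have "ends H (\<phi> e) = map_uprod h (ends G e)" using e Z by (intro ends) auto
    ultimately show ?thesis by (simp add: uprod.map_comp o_def)
  qed
  moreover have "joined_by H ?Z `` {leg H i} = f (joined_by G Z `` {leg G i})" if "i \<in> {1..s}" for i
    using legs legs_G f that by simp
  ultimately show ?thesis
    unfolding graph_iso_def collapse_def by (intro exI[of _ f]) simp
qed

end

lemma contraction_collapse:
  assumes "is_graph s G" "Z \<subseteq> edges G"
    and iso: "graph_iso s (collapse G Z) H f \<phi>"
  shows "contraction s G H Z (\<lambda>v. f (joined_by G Z `` {v})) \<phi>"
proof
  show "\<forall>e\<in>edges G. set_uprod (ends G e) \<subseteq> verts G" "\<forall>i\<in>{1..s}. leg G i \<in> verts G"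
    using assms(1) by (auto simp: is_graph_def)
  have bij: "bij_betw f (verts G // joined_by G Z) (verts H)"
    using iso by (simp add: graph_iso_def collapse_def)
  show "(\<lambda>v. f (joined_by G Z `` {v})) ` verts G = verts H"
    using bij unfolding bij_betw_def quotient_def by auto
  show "f (joined_by G Z `` {u}) = f (joined_by G Z `` {v}) \<longleftrightarrow> (u, v) \<in> joined_by G Z"
    if "u \<in> verts G" "v \<in> verts G" for u v
    using bij joined_by_class_eq[OF that, of Z] that
    unfolding bij_betw_def by (auto dest!: inj_onD intro: quotientI)
  show "bij_betw \<phi> (edges G - Z) (edges H)"
    using iso by (simp add: graph_iso_def collapse_def)
  show "ends H (\<phi> e) = map_uprod (\<lambda>v. f (joined_by G Z `` {v})) (ends G e)" if "e \<in> edges G - Z" for e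
    using iso that by (simp add: graph_iso_def collapse_def uprod.map_comp o_def)
  show "leg H i = f (joined_by G Z `` {leg G i})" if "i \<in> {1..s}" for i
    using iso that by (simp add: graph_iso_def collapse_def)
qed (fact assms(2))

lemma graph_iso_id: "graph_iso s G G id id"
  by (auto simp: graph_iso_def uprod.map_id)

lemma graph_iso_edge_cong:
  assumes "graph_iso s G H f \<phi>" "\<And>e. e \<in> edges G \<Longrightarrow> \<phi> e = \<psi> e"
  shows "graph_iso s G H f \<psi>"
  using assms bij_betw_cong[of "edges G" \<phi> \<psi> "edges H"] by (simp add: graph_iso_def)

text \<open>Both graphs contract onto \<open>collapse G' Z'\<close>, where the remaining collapses agree.\<close>

lemma collapse_iso_mono:
  assumes G: "is_graph s G" and G': "is_graph s G'"
    and Z: "Z \<subseteq> Y" "Y \<subseteq> edges G" and Z': "Z' \<subseteq> edges G'"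
    and iso: "graph_iso s (collapse G Z) (collapse G' Z') f \<phi>"
  shows "\<exists>f. graph_iso s (collapse G Y) (collapse G' (Z' \<union> \<phi> ` (Y - Z))) f \<phi>"
proof -
  let ?H = "collapse G' Z'" and ?Y' = "Z' \<union> \<phi> ` (Y - Z)"
  have bij: "bij_betw \<phi> (edges G - Z) (edges G' - Z')"
    using iso by (simp add: graph_iso_def collapse_def)
  have Y': "\<phi> ` (Y - Z) \<subseteq> edges G' - Z'" using bij Z by (auto simp: bij_betw_def)
  interpret c1: contraction s G ?H Z "\<lambda>v. f (joined_by G Z `` {v})" \<phi>
    using G _ iso by (rule contraction_collapse) (use Z in auto)
  interpret c2: contraction s G' ?H Z' "\<lambda>v. id (joined_by G' Z' `` {v})" id
    using G' Z' graph_iso_id by (rule contraction_collapse)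
  obtain f1 where f1: "graph_iso s (collapse G Y) (collapse ?H (\<phi> ` (Y - Z))) f1 \<phi>"
    using c1.collapse_iso[OF Z] by blast
  have "id ` (?Y' - Z') = \<phi> ` (Y - Z)" using Y' by auto
  then obtain f2 where f2: "graph_iso s (collapse G' ?Y') (collapse ?H (\<phi> ` (Y - Z))) f2 id"
    using c2.collapse_iso[of ?Y'] Y' Z' by auto
  let ?g = "inv_into (edges (collapse G' ?Y')) (id :: 'd \<Rightarrow> 'd)"
  have "graph_iso s (collapse ?H (\<phi> ` (Y - Z))) (collapse G' ?Y')
      (inv_into (verts (collapse G' ?Y')) f2) ?g"
    by (rule graph_iso_sym[OF f2 collapse_ends[OF G'] collapse_legs[OF G']])
  from graph_iso_trans[OF f1 this]
  have "graph_iso s (collapse G Y) (collapse G' ?Y') (inv_into (verts (collapse G' ?Y')) f2 \<circ> f1) (?g \<circ> \<phi>)" .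
  moreover have "(?g \<circ> \<phi>) e = \<phi> e" if "e \<in> edges (collapse G Y)" for e
  proof -
    have "\<phi> e \<in> edges (collapse ?H (\<phi> ` (Y - Z)))"
      using f1 that unfolding graph_iso_def bij_betw_def by blast
    then have "\<phi> e \<in> edges (collapse G' ?Y')" by (auto simp: collapse_def)
    then show ?thesis using inv_into_f_f[OF inj_on_id, of "\<phi> e"] by simp
  qed
  ultimately have "graph_iso s (collapse G Y) (collapse G' ?Y')
      (inv_into (verts (collapse G' ?Y')) f2 \<circ> f1) \<phi>"
    by (rule graph_iso_edge_cong)
  then show ?thesis by blast
qed

lemma contraction_of_iso:
  assumes "is_graph s G" and iso: "graph_iso s G H f \<phi>"
  shows "contraction s G H {} f \<phi>"
proof
  have "joined_by G {} = Id_on (verts G)" by (auto simp: joined_by_def)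
  then show "f u = f v \<longleftrightarrow> (u, v) \<in> joined_by G {}" if "u \<in> verts G" "v \<in> verts G" for u v
    using that iso by (auto simp: graph_iso_def bij_betw_def inj_on_def)
qed (use assms in \<open>auto simp: graph_iso_def is_graph_def bij_betw_def\<close>)

text \<open>Even an empty collapse replaces vertices by singleton classes; the isomorphism is
  conjugated back through these relabellings.\<close>

lemma graph_iso_of_trivial_collapse:
  assumes G: "is_graph s G" and H: "is_graph s H"
    and iso: "graph_iso s (collapse G {}) (collapse H {}) f \<phi>"
  obtains g where "graph_iso s G H g \<phi>"
proof -
  have *: "graph_iso s K (collapse K {}) (\<lambda>v. joined_by K {} `` {v}) id" if K: "is_graph s K" for K :: "('x, 'y) legged_graph"
  proof -
    have "joined_by K {} = Id_on (verts K)" by (auto simp: joined_by_def)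
    then have "inj_on (\<lambda>v. joined_by K {} `` {v}) (verts K)"
      by (auto simp: inj_on_def Id_on_def)
    then show ?thesis
      unfolding graph_iso_def collapse_def by (auto simp: bij_betw_def quotient_def)
  qed
  have "graph_iso s (collapse H {}) H (inv_into (verts H) (\<lambda>v. joined_by H {} `` {v})) (inv_into (edges H) id)"
    using H by (intro graph_iso_sym *) (auto simp: is_graph_def)
  from graph_iso_trans[OF graph_iso_trans[OF *[OF G] iso] this]
  have "graph_iso s G H (inv_into (verts H) (\<lambda>v. joined_by H {} `` {v}) \<circ>
     (f \<circ> (\<lambda>v. joined_by G {} `` {v}))) (inv_into (edges H) id \<circ> (\<phi> \<circ> id))" .
  moreover have "(inv_into (edges H) id \<circ> (\<phi> \<circ> id)) e = \<phi> e" if "e \<in> edges G" for e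
  proof -
    have "\<phi> e \<in> edges H" using iso that by (auto simp: graph_iso_def collapse_def bij_betw_def)
    then show ?thesis using inv_into_f_f[OF inj_on_id, of "\<phi> e"] by simp
  qed
  ultimately show ?thesis using that graph_iso_edge_cong by blast
qed

section \<open>One-loop graphs are cycles\<close>

locale one_loop =
  fixes s :: nat and G :: "('v, 'e) legged_graph"
  assumes admissible: "admissible s G" and betti: "first_betti G = 1"
begin

lemma graph: "is_graph s G"
  using admissible by (simp add: admissible_def)

lemma finite_verts: "finite (verts G)" and finite_edges: "finite (edges G)"
  and verts_nonempty: "verts G \<noteq> {}"
  and ends_verts: "\<forall>e\<in>edges G. set_uprod (ends G e) \<subseteq> verts G"
  and leg_verts: "i \<in> {1..s} \<Longrightarrow> leg G i \<in> verts G"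
  using graph by (auto simp: is_graph_def)

lemma connected: "u \<in> verts G \<Longrightarrow> v \<in> verts G \<Longrightarrow> (u, v) \<in> joined_by G (edges G)"
  using admissible by (simp add: admissible_def connected_by_def)

lemma bridgeless:
  "e \<in> edges G \<Longrightarrow> u \<in> verts G \<Longrightarrow> v \<in> verts G \<Longrightarrow> (u, v) \<in> joined_by G (edges G - {e})"
  using admissible by (simp add: admissible_def connected_by_def)

lemma card_edges: "card (edges G) = card (verts G)"
proof -
  have "joined_by G (edges G) `` {u} = verts G" if "u \<in> verts G" for u
    using connected[OF that] joined_by_subset_verts[of u _ G "edges G"] by auto
  then have "verts G // joined_by G (edges G) = {verts G}"
    using verts_nonempty unfolding quotient_eq_image by auto
  then show ?thesis using betti by (simp add: first_betti_def)
qed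

definition edge_degree :: "'v \<Rightarrow> nat" where
  "edge_degree v = card {e \<in> edges G. v \<in> set_uprod (ends G e)} + card {e \<in> edges G. ends G e = Upair v v}"

lemma edge_between_distinct:
  assumes "(u, v) \<in> joined_by G F" "u \<noteq> v"
  obtains e y where "e \<in> F" "ends G e = Upair u y" "y \<noteq> u"
proof -
  let ?r = "{(x, y). \<exists>e\<in>F. ends G e = Upair x y}"
  have "(u, v) \<in> ?r\<^sup>*" using assms(1) by (auto simp: joined_by_def)
  then have "u \<noteq> v \<longrightarrow> (\<exists>y. (u, y) \<in> ?r \<and> y \<noteq> u)"
    by (induction rule: converse_rtrancl_induct) auto
  then show ?thesis using assms(2) that by blast
qed

text \<open>Connectedness provides one edge to another vertex, and after deleting it bridgelessness
  provides a second. With a single vertex, the only edge is a loop, which counts twice.\<close>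

lemma edge_degree_ge: "v \<in> verts G \<Longrightarrow> edge_degree v \<ge> 2"
proof (cases "verts G = {v}")
  case True
  assume "v \<in> verts G"
  have "card (edges G) = 1" using True card_edges by simp
  then obtain e where e: "edges G = {e}" by (auto simp: card_1_singleton_iff)
  obtain x y where xy: "ends G e = Upair x y" by (metis uprod_exhaust)
  then have "ends G e = Upair v v" using edge_ends_verts[OF ends_verts _ xy] e True by simp
  then have "{e' \<in> edges G. v \<in> set_uprod (ends G e')} = {e}" "{e' \<in> edges G. ends G e' = Upair v v} = {e}"
    using e by auto
  then show ?thesis by (simp add: edge_degree_def)
next
  case False
  assume v: "v \<in> verts G"
  then obtain u where u: "u \<in> verts G" "u \<noteq> v" using False by blast
  obtain e1 y1 where e1: "e1 \<in> edges G" "ends G e1 = Upair v y1"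
    using edge_between_distinct[OF connected[OF v u(1)]] u(2) by metis
  obtain e2 y2 where e2: "e2 \<in> edges G - {e1}" "ends G e2 = Upair v y2"
    using edge_between_distinct[OF bridgeless[OF e1(1) v u(1)]] u(2) by metis
  have "card {e1, e2} \<le> card {e \<in> edges G. v \<in> set_uprod (ends G e)}"
    using e1 e2 finite_edges by (intro card_mono) auto
  moreover have "card {e1, e2} = 2" using e2 by auto
  ultimately show ?thesis by (simp add: edge_degree_def)
qed

lemma sum_edge_degree: "(\<Sum>v\<in>verts G. edge_degree v) = 2 * card (edges G)"
proof -
  have "(\<Sum>v\<in>verts G. edge_degree v) =
      (\<Sum>v\<in>verts G. \<Sum>e\<in>edges G. of_bool (v \<in> set_uprod (ends G e)) + of_bool (ends G e = Upair v v))"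
    using finite_edges by (simp add: edge_degree_def sum.distrib Int_def)
  also have "\<dots> = (\<Sum>e\<in>edges G. \<Sum>v\<in>verts G. of_bool (v \<in> set_uprod (ends G e)) + of_bool (ends G e = Upair v v))"
    by (rule sum.swap)
  also have "\<dots> = (\<Sum>e\<in>edges G. 2)"
  proof (rule sum.cong[OF refl])
    fix e assume e: "e \<in> edges G"
    obtain x y where xy: "ends G e = Upair x y" by (metis uprod_exhaust)
    have xyv: "x \<in> verts G" "y \<in> verts G" using edge_ends_verts[OF ends_verts e xy] by auto
    have "verts G \<inter> {v. v \<in> set_uprod (ends G e)} = {x, y}" using xyv xy by auto
    moreover have "verts G \<inter> {v. ends G e = Upair v v} = (if x = y then {x} else {})"
      using xyv xy by auto
    ultimately show "(\<Sum>v\<in>verts G. of_bool (v \<in> set_uprod (ends G e)) + of_bool (ends G e = Upair v v)) = (2::nat)"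
      using finite_verts by (simp add: sum.distrib)
  qed
  finally show ?thesis by simp
qed

text \<open>First Betti number one means as many edges as vertices, so the average degree is two,
  while no degree is smaller.\<close>

lemma edge_degree_eq: "v \<in> verts G \<Longrightarrow> edge_degree v = 2"
proof (rule ccontr)
  assume v: "v \<in> verts G" and "edge_degree v \<noteq> 2"
  then have "(\<Sum>v\<in>verts G. 2) < (\<Sum>v\<in>verts G. edge_degree v)"
    using edge_degree_ge finite_verts by (intro sum_strict_mono_ex1) (auto intro!: bexI[of _ v] simp: le_less)
  then show False using sum_edge_degree card_edges by simp
qed

lemma vertex_has_leg:
  assumes "v \<in> verts G"
  obtains i where "i \<in> {1..s}" "leg G i = v"
proof -
  have "valency s G v \<ge> 3" using admissible assms by (simp add: admissible_def)
  then have "card {i \<in> {1..s}. leg G i = v} \<noteq> 0"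
    using edge_degree_eq[OF assms] unfolding valency_def edge_degree_def by linarith
  then have "{i \<in> {1..s}. leg G i = v} \<noteq> {}" by (metis card.empty)
  then show ?thesis using that by blast
qed

text \<open>A cycle uses up the degree two of each of its vertices, so no further edge touches it,
  and connectedness leaves room for nothing else.\<close>

lemma cycle_covers:
  assumes cyc: "is_cycle G es vs"
  shows "set vs = verts G" "set es = edges G"
proof -
  define k where "k = length es"
  have k: "k > 0" "length vs = k" and de: "distinct es" and dv: "distinct vs"
    and es: "set es \<subseteq> edges G" and vs: "set vs \<subseteq> verts G"
    and ends: "\<And>i. i < k \<Longrightarrow> ends G (es ! i) = Upair (vs ! i) (vs ! (Suc i mod k))"
    using cyc by (auto simp: is_cycle_def k_def)
  have sat: "e \<in> set es" if v: "v \<in> set vs" and e: "e \<in> edges G" "v \<in> set_uprod (ends G e)" for v e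
  proof -
    obtain i where i: "i < k" "v = vs ! i" using v k(2) by (auto simp: in_set_conv_nth)
    have vG: "v \<in> verts G" using v vs by blast
    let ?I = "{e \<in> edges G. v \<in> set_uprod (ends G e)}"
    have fin: "finite ?I" using finite_edges by simp
    show ?thesis
    \<comment> \<open>For a loop the degree two comes from one edge counted in both summands of
      \<open>edge_degree\<close>; for longer cycles it comes from two different edges.\<close>
    proof (cases "k = 1")
      case True
      then have i0: "i = 0" using i by simp
      have "ends G (es ! 0) = Upair v v" "es ! 0 \<in> set es"
        using ends[of 0] i i0 True k_def by simp_all
      then have "es ! 0 \<in> {e \<in> edges G. ends G e = Upair v v}" using es by blast
      then have "card {e \<in> edges G. ends G e = Upair v v} \<ge> 1"
        using card_mono[of "{e \<in> edges G. ends G e = Upair v v}" "{es ! 0}"] finite_edges by simp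
      then have "card ?I \<le> 1" using edge_degree_eq[OF vG] by (simp add: edge_degree_def)
      moreover have "es ! 0 \<in> ?I" using \<open>ends G (es ! 0) = Upair v v\<close> \<open>es ! 0 \<in> set es\<close> es by auto
      ultimately have "e = es ! 0"
        using e fin card_le_Suc0_iff_eq[OF fin] by auto
      then show ?thesis using \<open>es ! 0 \<in> set es\<close> by simp
    next
      case False
      define j where "j = (if i = 0 then k - 1 else i - 1)"
      have j: "j < k" "Suc j mod k = i" "j \<noteq> i" using i False k by (auto simp: j_def)
      have "es ! i \<in> ?I" "es ! j \<in> ?I"
        using ends[OF i(1)] ends[OF j(1)] i j es k_def by auto
      moreover have "es ! i \<noteq> es ! j" using de i j k_def by (simp add: nth_eq_iff_index_eq)
      ultimately have sub: "{es ! i, es ! j} \<subseteq> ?I" and c: "card {es ! i, es ! j} = 2" by auto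
      have "card ?I \<le> 2" using edge_degree_eq[OF vG] by (simp add: edge_degree_def)
      then have "{es ! i, es ! j} = ?I" using sub c fin by (intro card_seteq) auto
      then have "e = es ! i \<or> e = es ! j" using e by blast
      then show ?thesis using i j k_def by auto
    qed
  qed
  have v0: "vs ! 0 \<in> set vs" using k by simp
  show V: "set vs = verts G"
  proof (intro equalityI subsetI)
    fix v assume "v \<in> verts G"
    then have "(vs ! 0, v) \<in> joined_by G (edges G)" using v0 vs by (intro connected) auto
    then show "v \<in> set vs"
      using ends_verts
    proof (induction rule: joined_by_induct)
      case refl
      show ?case by (rule v0)
    next
      case (step x y e)
      then have "e \<in> set es" using sat[of x e] by auto
      then obtain i where i: "i < k" "e = es ! i" by (auto simp: in_set_conv_nth k_def)
      then have "Upair x y = Upair (vs ! i) (vs ! (Suc i mod k))"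
        using ends[OF i(1)] step.hyps(3) by metis
      then have "y = vs ! i \<or> y = vs ! (Suc i mod k)" by auto
      moreover have "vs ! i \<in> set vs" "vs ! (Suc i mod k) \<in> set vs"
        using i(1) k by (simp_all del: mod_Suc_eq)
      ultimately show ?case by metis
    qed
  qed (use vs in blast)
  show "set es = edges G"
  proof (intro equalityI subsetI)
    fix e assume e: "e \<in> edges G"
    obtain x y where xy: "ends G e = Upair x y" by (metis uprod_exhaust)
    then have "x \<in> set vs" using edge_ends_verts[OF ends_verts e xy] V by simp
    then show "e \<in> set es" using sat[of x e] e xy by simp
  qed (use es in blast)
qed

lemma is_forest_proper: "Z \<subset> edges G \<Longrightarrow> is_forest G Z"
  unfolding is_forest_def using cycle_covers(2) by blast

lemma regular_metricI:
  assumes "l \<in> edges G \<rightarrow>\<^sub>E {0..}" "(\<Sum>e\<in>edges G. l e) = 1"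
  shows "l \<in> regular_metrics G"
proof -
  have "\<exists>e\<in>edges G. l e \<noteq> 0"
  proof (rule ccontr)
    assume "\<not> ?thesis"
    then have "(\<Sum>e\<in>edges G. l e) = 0" by (intro sum.neutral) auto
    with assms(2) show False by simp
  qed
  then have "zero_edges G l \<subset> edges G" by (auto simp: zero_edges_def)
  then show ?thesis using assms(1) is_forest_proper by (simp add: regular_metrics_def)
qed

text \<open>Loop erasure: when the path returns to a vertex, it is cut back to the earlier
  visit.\<close>

lemma simple_path:
  assumes F: "F \<subseteq> edges G" and ab: "(a, b) \<in> joined_by G F"
  shows "\<exists>p N. p 0 = a \<and> p N = b \<and> inj_on p {..N} \<and> p ` {..N} \<subseteq> verts G \<and>
    (\<forall>i<N. \<exists>e\<in>F. ends G e = Upair (p i) (p (Suc i)))"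
proof -
  have "\<forall>e\<in>F. set_uprod (ends G e) \<subseteq> verts G" using F ends_verts by blast
  from ab this show ?thesis
  proof (induction rule: joined_by_induct)
    case refl
    show ?case
      using joined_by_subset_verts[OF ab] by (intro exI[of _ "\<lambda>_. a"] exI[of _ 0]) auto
  next
    case (step x y e)
    then obtain p N where p: "p 0 = a" "p N = x" "inj_on p {..N}" "p ` {..N} \<subseteq> verts G"
      "\<forall>i<N. \<exists>e\<in>F. ends G e = Upair (p i) (p (Suc i))" by blast
    show ?case
    proof (cases "y \<in> p ` {..N}")
      case True
      then obtain n where n: "n \<le> N" "y = p n" by auto
      have "inj_on p {..n}" using p(3) by (rule inj_on_subset) (use n in auto)
      then show ?thesis using p n by (intro exI[of _ p] exI[of _ n]) auto
    next
      case False
      let ?q = "p(Suc N := y)"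
      have "inj_on ?q {..Suc N}"
        using p(3) False unfolding atMost_Suc by (auto simp: inj_on_def)
      moreover have "?q ` {..Suc N} \<subseteq> verts G"
        using p(4) step unfolding atMost_Suc by auto
      moreover have "\<forall>i<Suc N. \<exists>e\<in>F. ends G e = Upair (?q i) (?q (Suc i))"
      proof (intro allI impI)
        fix i assume "i < Suc N"
        then consider "i < N" | "i = N" by linarith
        then show "\<exists>e\<in>F. ends G e = Upair (?q i) (?q (Suc i))"
        proof cases
          case 1
          then show ?thesis using p(5) by simp
        next
          case 2
          then show ?thesis using step.hyps p(2) by (intro bexI[of _ e]) auto
        qed
      qed
      moreover have "?q 0 = a" "?q (Suc N) = y" using p(1) by simp_all
      ultimately show ?thesis by blast
    qed
  qed
qed

text \<open>As \<open>e\<close> is not a bridge, a simple path from \<open>a\<close> to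
  \<open>b\<close> avoids it, and \<open>e\<close> closes this path; for a loop the path has length
  zero. \<open>cycle_covers\<close> then exhausts the graph.\<close>

lemma cycle_through:
  assumes e: "e \<in> edges G" and ends_e: "ends G e = Upair b a"
  obtains k p \<epsilon> where "k > 0" "bij_betw p {..<k} (verts G)" "bij_betw \<epsilon> {..<k} (edges G)"
    "\<And>i. i < k \<Longrightarrow> ends G (\<epsilon> i) = Upair (p i) (p (Suc i mod k))" "p 0 = a" "\<epsilon> (k - 1) = e"
proof -
  have ab: "a \<in> verts G" "b \<in> verts G" using edge_ends_verts[OF ends_verts e ends_e] by auto
  obtain p N where p: "p 0 = a" "p N = b" "inj_on p {..N}" "p ` {..N} \<subseteq> verts G"
    "\<forall>i<N. \<exists>d\<in>edges G - {e}. ends G d = Upair (p i) (p (Suc i))"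
    using simple_path[OF _ bridgeless[OF e ab]] by blast
  obtain d where d: "\<And>i. i < N \<Longrightarrow> d i \<in> edges G - {e} \<and> ends G (d i) = Upair (p i) (p (Suc i))"
    using p(5) by metis
  let ?k = "Suc N"
  define \<epsilon> where "\<epsilon> i = (if i < N then d i else e)" for i
  have ends: "ends G (\<epsilon> i) = Upair (p i) (p (Suc i mod ?k))" if "i < ?k" for i
    using that d ends_e p(1,2) by (cases "i = N") (auto simp: \<epsilon>_def)
  have \<epsilon>E: "\<epsilon> i \<in> edges G" if "i < ?k" for i
    using that d e by (auto simp: \<epsilon>_def)
  have inj_p: "inj_on p {..<?k}" using p(3) by (simp add: lessThan_Suc_atMost)
  \<comment> \<open>Coinciding path edges with different indices would have to be traversed in
    opposite directions, forcing \<open>i = Suc j\<close> and \<open>j = Suc i\<close> at once. The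
    closing edge does not occur on the path.\<close>
  have "i = j" if ij: "i < ?k" "j < ?k" "\<epsilon> i = \<epsilon> j" for i j
  proof (cases "i < N \<and> j < N")
    case True
    then have "Upair (p i) (p (Suc i)) = Upair (p j) (p (Suc j))"
      using d ij by (metis \<epsilon>_def)
    then have "p i = p j \<or> (p i = p (Suc j) \<and> p (Suc i) = p j)" by auto
    then have "i = j \<or> (i = Suc j \<and> Suc i = j)"
      using inj_onD[OF inj_p] True by (metis Suc_mono lessThan_iff ij(1,2))
    then show ?thesis by auto
  next
    case False
    then show ?thesis using ij d[of i] d[of j] by (auto simp: \<epsilon>_def less_Suc_eq split: if_splits)
  qed
  then have inj_\<epsilon>: "inj_on \<epsilon> {..<?k}" by (auto intro: inj_onI)
  have "is_cycle G (map \<epsilon> [0..<?k]) (map p [0..<?k])"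
    unfolding is_cycle_def
    using inj_p inj_\<epsilon> ends \<epsilon>E p(4)
    by (auto simp: distinct_map atLeast0LessThan lessThan_Suc_atMost nth_append simp del: upt_Suc)
  from cycle_covers[OF this] have "p ` {..<?k} = verts G" "\<epsilon> ` {..<?k} = edges G"
    by (simp_all add: atLeast0LessThan del: upt_Suc)
  then show ?thesis
    using that[of ?k p \<epsilon>] inj_p inj_\<epsilon> ends p(1) by (simp add: bij_betw_def \<epsilon>_def)
qed

end

text \<open>Indices modulo \<open>k\<close> make \<open>k = 1\<close> a self-loop and
  \<open>k = 2\<close> a double edge without separate cases. \<open>ends\<close> is restricted
  because \<open>is_graph\<close> demands an extensional map.\<close>

definition cycle_graph :: "nat \<Rightarrow> (nat \<Rightarrow> nat) \<Rightarrow> ngraph" where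
  "cycle_graph k w = \<lparr>verts = {..<k}, edges = {..<k},
     ends = (\<lambda>j\<in>{..<k}. Upair j (Suc j mod k)), leg = w\<rparr>"

definition labellings :: "nat \<Rightarrow> nat \<Rightarrow> (nat \<Rightarrow> nat) set" where
  "labellings s k = {w \<in> {1..s} \<rightarrow>\<^sub>E {..<k}. w ` {1..s} = {..<k}}"

lemma cycle_graph_simps [simp]:
  "verts (cycle_graph k w) = {..<k}" "edges (cycle_graph k w) = {..<k}" "leg (cycle_graph k w) = w"
  "j < k \<Longrightarrow> ends (cycle_graph k w) j = Upair j (Suc j mod k)"
  by (simp_all add: cycle_graph_def)

text \<open>Prescribing the first vertex and the last edge serves two purposes: putting leg 1 at
  vertex 0, and putting an edge of length zero last, where it can be contracted without renumbering.
  The labelling is surjective because every vertex carries a leg.\<close>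

lemma (in one_loop) normal_form:
  assumes e: "e \<in> edges G" and ends_e: "ends G e = Upair b a"
  obtains k w p \<epsilon> where "k > 0" "w \<in> labellings s k" "graph_iso s (cycle_graph k w) G p \<epsilon>"
    "p 0 = a" "\<epsilon> (k - 1) = e"
proof -
  obtain k p \<epsilon> where k: "k > 0" and p: "bij_betw p {..<k} (verts G)" and \<epsilon>: "bij_betw \<epsilon> {..<k} (edges G)"
    and ends: "\<And>i. i < k \<Longrightarrow> ends G (\<epsilon> i) = Upair (p i) (p (Suc i mod k))" and pe: "p 0 = a" "\<epsilon> (k - 1) = e"
    using cycle_through[OF e ends_e] by metis
  define w where "w = (\<lambda>i\<in>{1..s}. inv_into {..<k} p (leg G i))"
  have pw: "p (w i) = leg G i" "w i < k" if "i \<in> {1..s}" for i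
    using that leg_verts[OF that] p by (auto simp: w_def bij_betw_def f_inv_into_f)
      (metis inv_into_into lessThan_iff)
  have "j \<in> w ` {1..s}" if "j < k" for j
  proof -
    have "p j \<in> verts G" using p that by (auto simp: bij_betw_def)
    then obtain i where i: "i \<in> {1..s}" "leg G i = p j" by (rule vertex_has_leg)
    then have "w i = j" using pw[OF i(1)] p that by (auto simp: bij_betw_def inj_on_def)
    then show ?thesis using i by blast
  qed
  then have "w \<in> labellings s k"
    using pw(2) by (auto simp: labellings_def w_def)
  moreover have "graph_iso s (cycle_graph k w) G p \<epsilon>"
    using p \<epsilon> ends pw by (simp add: graph_iso_def)
  ultimately show ?thesis using that k pe by blast
qed

text \<open>Without edge \<open>j\<close> the cycle is the path
  \<open>j + 1, ..., k - 1, 0, ..., j\<close>. Both stretches are climbed in increasing order, and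
  for \<open>j < k - 1\<close> the edge \<open>k - 1\<close> links them.\<close>

lemma cycle_graph_connected_by:
  assumes k: "k > 0" and F: "{..<k} - {j} \<subseteq> F"
  shows "connected_by (cycle_graph k w) F"
proof -
  let ?G = "cycle_graph k w"
  have step: "(i, Suc i) \<in> joined_by ?G F" if "Suc i < k" "i \<noteq> j" for i
    using that F by (intro joined_by_edge[of i]) auto
  have low: "(0, v) \<in> joined_by ?G F" if "v < k" "v \<le> j" for v
    using that
  proof (induction v)
    case 0
    then show ?case by (intro joined_by_refl) simp
  next
    case (Suc v)
    then show ?case using step[of v] joined_by_trans by (metis Suc_leD Suc_lessD Suc_n_not_le_n)
  qed
  have high: "(j + 1, v) \<in> joined_by ?G F" if "j < v" "v < k" for v
    using that
  proof (induction v)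
    case (Suc v)
    show ?case
    proof (cases "v = j")
      case True
      then show ?thesis using Suc by (auto intro: joined_by_refl)
    next
      case False
      then show ?thesis using step[of v] joined_by_trans Suc
        by (metis Suc_lessD less_antisym)
    qed
  qed simp
  have all: "(0, v) \<in> joined_by ?G F" if v: "v < k" for v
  proof (cases "v \<le> j")
    case True
    then show ?thesis using low v by simp
  next
    case False
    have "(0, k - 1) \<in> joined_by ?G F"
      by (rule joined_by_sym, rule joined_by_edge[of "k - 1"]) (use False v F k in auto)
    moreover have "(k - 1, j + 1) \<in> joined_by ?G F"
      by (rule joined_by_sym, rule high) (use False v in auto)
    moreover have "(j + 1, v) \<in> joined_by ?G F" using high False v by auto
    ultimately show ?thesis using joined_by_trans by metis
  qed
  show ?thesis
    unfolding connected_by_def using k by (auto intro: joined_by_trans[OF joined_by_sym[OF all] all])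
qed

lemma cycle_graph_one_loop:
  assumes k: "k > 0" and w: "w \<in> labellings s k"
  shows "one_loop s (cycle_graph k w)"
proof
  let ?G = "cycle_graph k w"
  have wk: "w ` {1..s} = {..<k}" and wE: "w \<in> {1..s} \<rightarrow>\<^sub>E {..<k}" using w by (auto simp: labellings_def)
  have "valency s ?G v \<ge> 3" if v: "v < k" for v
  proof -
    have "v \<in> w ` {1..s}" using wk v by simp
    then obtain i where "i \<in> {1..s}" "w i = v" by blast
    then have leg: "card {i \<in> {1..s}. w i = v} \<ge> 1"
      using card_mono[of "{i \<in> {1..s}. w i = v}" "{i}"] by simp
    let ?I = "{e \<in> edges ?G. v \<in> set_uprod (ends ?G e)}" and ?L = "{e \<in> edges ?G. ends ?G e = Upair v v}"
    have "card ?I + card ?L \<ge> 2"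
    proof (cases "k = 1")
      case True
      then have "?I = {0}" "?L = {0}" using v by auto
      then show ?thesis by simp
    next
      case False
      define j where "j = (if v = 0 then k - 1 else v - 1)"
      have j: "j < k" "Suc j mod k = v" "j \<noteq> v" using v False k by (auto simp: j_def)
      have "card {v, j} \<le> card ?I" using v j by (intro card_mono) auto
      moreover have "card {v, j} = 2" using j by auto
      ultimately show ?thesis by simp
    qed
    then show ?thesis using leg by (simp add: valency_def)
  qed
  moreover have "is_graph s ?G"
    unfolding is_graph_def using k wE by (auto simp: cycle_graph_def)
  moreover have conn: "connected_by ?G (edges ?G)"
    using cycle_graph_connected_by[OF k, of 0] by auto
  moreover have "\<forall>e\<in>edges ?G. connected_by ?G (edges ?G - {e})"
    using cycle_graph_connected_by[OF k] by auto
  ultimately show "admissible s ?G" by (simp add: admissible_def)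
  have "joined_by ?G (edges ?G) `` {u} = verts ?G" if "u \<in> verts ?G" for u
    using conn that joined_by_subset_verts[of u _ ?G "edges ?G"] unfolding connected_by_def by blast
  then have "verts ?G // joined_by ?G (edges ?G) = {verts ?G}"
    using k unfolding quotient_eq_image by auto
  then show "first_betti ?G = 1" by (simp add: first_betti_def)
qed

section \<open>Points of the moduli space\<close>

text \<open>Regularity is left out on purpose: total length one prevents all edges from vanishing,
  and in a one-loop graph every proper set of edges is a forest.\<close>

definition unit_metrics :: "('v, 'e) legged_graph \<Rightarrow> ('e \<Rightarrow> real) set" where
  "unit_metrics G = {l \<in> edges G \<rightarrow>\<^sub>E {0..}. (\<Sum>e\<in>edges G. l e) = 1}"

lemma one_loop_graphs_iff: "G \<in> one_loop_graphs s \<longleftrightarrow> one_loop s G"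
  by (simp add: one_loop_graphs_def one_loop_def)

lemma (in one_loop) regular_unit_metrics:
  "{l \<in> regular_metrics G. (\<Sum>e\<in>edges G. l e) = 1} = unit_metrics G"
  using regular_metricI by (auto simp: unit_metrics_def regular_metrics_def)

lemma (in one_loop) metric_simplex_eq:
  "metric_simplex G = subtopology (powertop_real (edges G)) (unit_metrics G)"
  unfolding metric_simplex_def regular_unit_metrics ..

lemma unit_metrics_extensional: "unit_metrics G \<subseteq> extensional (edges G)"
  by (auto simp: unit_metrics_def PiE_iff)

lemma (in one_loop) topspace_metric_simplex [simp]: "topspace (metric_simplex G) = unit_metrics G"
  unfolding metric_simplex_eq using unit_metrics_extensional[of G] by (auto simp: PiE_def)

lemma unit_metrics_nonneg: "l \<in> unit_metrics G \<Longrightarrow> e \<in> edges G \<Longrightarrow> 0 \<le> l e"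
  by (auto simp: unit_metrics_def)

lemma colored_metric_graphsI:
  assumes "one_loop s G" "l \<in> unit_metrics G" "c \<in> colorings m G"
  shows "(G, l, c) \<in> colored_metric_graphs s m"
  using assms one_loop.regular_metricI[OF assms(1)]
  by (auto simp: colored_metric_graphs_def one_loop_graphs_iff unit_metrics_def)

lemma cmg_relI:
  assumes "one_loop s G" "l \<in> unit_metrics G" "c \<in> colorings m G"
    and "one_loop s G'" "l' \<in> unit_metrics G'" "c' \<in> colorings m G'"
    and "graph_iso s (collapse G (zero_edges G l)) (collapse G' (zero_edges G' l')) f \<phi>"
    and "\<And>e. e \<in> edges G \<Longrightarrow> l e \<noteq> 0 \<Longrightarrow> l' (\<phi> e) = l e \<and> c' (\<phi> e) = c e"
  shows "((G, l, c), (G', l', c')) \<in> cmg_rel s m"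
proof -
  have "\<forall>e\<in>edges G - zero_edges G l. l' (\<phi> e) = 1 * l e \<and> c' (\<phi> e) = c e"
    using assms(8) by (simp add: zero_edges_def)
  then have "\<exists>f \<phi> a. graph_iso s (collapse G (zero_edges G l)) (collapse G' (zero_edges G' l')) f \<phi> \<and>
      a > 0 \<and> (\<forall>e\<in>edges G - zero_edges G l. l' (\<phi> e) = a * l e \<and> c' (\<phi> e) = c e)"
    using assms(7) zero_less_one by blast
  then show ?thesis
    using colored_metric_graphsI[OF assms(1-3)] colored_metric_graphsI[OF assms(4-6)]
    by (simp add: cmg_rel_def)
qed

lemma sum_nonzero_edges:
  assumes "finite (edges G)"
  shows "(\<Sum>e\<in>edges G - zero_edges G l. l e) = (\<Sum>e\<in>edges G. l e)"
  using assms by (intro sum.mono_neutral_left) (auto simp: zero_edges_def)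

text \<open>The scaling factor is one because both metrics have total length one.\<close>

lemma cmg_relD:
  assumes rel: "((G, l, c), (G', l', c')) \<in> cmg_rel s m"
    and l: "l \<in> unit_metrics G" and l': "l' \<in> unit_metrics G'"
  obtains f \<phi> where "graph_iso s (collapse G (zero_edges G l)) (collapse G' (zero_edges G' l')) f \<phi>"
    "bij_betw \<phi> (edges G - zero_edges G l) (edges G' - zero_edges G' l')"
    "\<And>e. e \<in> edges G - zero_edges G l \<Longrightarrow> l' (\<phi> e) = l e \<and> c' (\<phi> e) = c e"
proof -
  obtain f \<phi> a where iso: "graph_iso s (collapse G (zero_edges G l)) (collapse G' (zero_edges G' l')) f \<phi>"
    and "a > 0" and lc: "\<forall>e\<in>edges G - zero_edges G l. l' (\<phi> e) = a * l e \<and> c' (\<phi> e) = c e"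
    using rel by (auto simp: cmg_rel_def)
  have "one_loop s G" "one_loop s G'"
    using rel by (auto simp: cmg_rel_def colored_metric_graphs_def one_loop_graphs_iff)
  then have fin: "finite (edges G)" "finite (edges G')" by (auto intro: one_loop.finite_edges)
  have bij: "bij_betw \<phi> (edges G - zero_edges G l) (edges G' - zero_edges G' l')"
    using iso by (simp add: graph_iso_def collapse_def)
  have "1 = (\<Sum>e\<in>edges G' - zero_edges G' l'. l' e)"
    using l' sum_nonzero_edges[OF fin(2)] by (simp add: unit_metrics_def)
  also have "\<dots> = (\<Sum>e\<in>edges G - zero_edges G l. l' (\<phi> e))"
    using sum.reindex_bij_betw[OF bij] by metis
  also have "\<dots> = (\<Sum>e\<in>edges G - zero_edges G l. a * l e)"
    using lc by (intro sum.cong) auto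
  also have "\<dots> = a"
    using l sum_nonzero_edges[OF fin(1)] by (simp add: unit_metrics_def flip: sum_distrib_left)
  finally have "a = 1" by simp
  with lc show ?thesis using that[OF iso bij] by simp
qed

text \<open>\<open>Y\<close> may be a proper part of the zero set. The other zero edges survive in
  \<open>H\<close> with length zero, and by \<open>collapse_iso\<close> collapsing them there
  completes the collapse of \<open>G\<close>.\<close>

lemma cmg_rel_contraction:
  assumes "contraction s G H Y h \<phi>"
    and G: "one_loop s G" "l \<in> unit_metrics G" "c \<in> colorings m G"
    and H: "one_loop s H" "l' \<in> unit_metrics H" "c' \<in> colorings m H"
    and zero: "\<And>e. e \<in> Y \<Longrightarrow> l e = 0"
    and lc: "\<And>e. e \<in> edges G - Y \<Longrightarrow> l' (\<phi> e) = l e \<and> c' (\<phi> e) = c e"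
  shows "((G, l, c), (H, l', c')) \<in> cmg_rel s m"
proof -
  interpret contraction s G H Y h \<phi> by fact
  let ?Z = "zero_edges G l"
  have Z: "Y \<subseteq> ?Z" "?Z \<subseteq> edges G" using Y zero by (auto simp: zero_edges_def)
  have "zero_edges H l' = \<phi> ` (?Z - Y)"
  proof -
    have "edges H = \<phi> ` (edges G - Y)" using bij by (simp add: bij_betw_def)
    then show ?thesis using lc by (auto simp: zero_edges_def)
  qed
  then obtain f where "graph_iso s (collapse G ?Z) (collapse H (zero_edges H l')) f \<phi>"
    using collapse_iso[OF Z] by auto
  from cmg_relI[OF G H this] show ?thesis using lc zero by blast
qed

lemma cmg_rel_sym: "(x, y) \<in> cmg_rel s m \<Longrightarrow> (y, x) \<in> cmg_rel s m"
  using cmg_rel_equiv[of s m] by (meson equivE symD)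

lemma cmg_rel_trans: "(x, y) \<in> cmg_rel s m \<Longrightarrow> (y, z) \<in> cmg_rel s m \<Longrightarrow> (x, z) \<in> cmg_rel s m"
  using cmg_rel_equiv[of s m] by (meson equivE transD)

lemma cmg_rel_iso:
  assumes iso: "graph_iso s G H f \<phi>"
    and G: "one_loop s G" "c \<in> colorings m G"
    and H: "one_loop s H" "l \<in> unit_metrics H" "c' \<in> colorings m H"
    and c: "\<And>e. e \<in> edges G \<Longrightarrow> c e = c' (\<phi> e)"
  shows "(\<lambda>e\<in>edges G. l (\<phi> e)) \<in> unit_metrics G"
    and "((G, (\<lambda>e\<in>edges G. l (\<phi> e)), c), (H, l, c')) \<in> cmg_rel s m"
proof -
  have bij: "bij_betw \<phi> (edges G) (edges H)" using iso by (simp add: graph_iso_def)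
  then have "(\<Sum>e\<in>edges G. l (\<phi> e)) = (\<Sum>e\<in>edges H. l e)" by (rule sum.reindex_bij_betw)
  then show l': "(\<lambda>e\<in>edges G. l (\<phi> e)) \<in> unit_metrics G"
    using H(2) bij_betwE[OF bij] by (auto simp: unit_metrics_def)
  have "is_graph s G" using G(1) by (rule one_loop.graph)
  from contraction_of_iso[OF this iso]
  show "((G, (\<lambda>e\<in>edges G. l (\<phi> e)), c), (H, l, c')) \<in> cmg_rel s m"
    by (rule cmg_rel_contraction) (use G H l' c in auto)
qed

section \<open>Closedness of the relation between simplices\<close>

definition transport :: "'e set \<Rightarrow> 'f set \<Rightarrow> 'f set \<Rightarrow> ('e \<Rightarrow> 'f) \<Rightarrow> ('e \<Rightarrow> real) \<Rightarrow> 'f \<Rightarrow> real" where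
  "transport D E' Z' \<phi> l = (\<lambda>e'\<in>E'. if e' \<in> Z' then 0 else l (inv_into D \<phi> e'))"

text \<open>On the right \<open>l\<close> has to vanish on \<open>Z\<close> but may vanish elsewhere
  too, which turns each piece into a closed condition. Nothing is added by this relaxation, since
  \<open>collapse_iso_mono\<close> collapses the extra zero edges on both sides.\<close>

lemma related_unit_metrics:
  assumes G: "one_loop s G" "c \<in> colorings m G" and G': "one_loop s G'" "c' \<in> colorings m G'"
    and K: "K \<subseteq> unit_metrics G'"
  shows "{l \<in> unit_metrics G. \<exists>x\<in>K. ((G, l, c), (G', x, c')) \<in> cmg_rel s m} =
    (\<Union>(Z, Z', \<phi>) \<in> {(Z, Z', \<phi>). Z \<subseteq> edges G \<and> Z' \<subseteq> edges G' \<and> \<phi> \<in> (edges G - Z) \<rightarrow>\<^sub>E edges G' \<and>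
        (\<exists>f. graph_iso s (collapse G Z) (collapse G' Z') f \<phi>) \<and> (\<forall>e\<in>edges G - Z. c' (\<phi> e) = c e)}.
       {l \<in> unit_metrics G. (\<forall>e\<in>Z. l e = 0) \<and> transport (edges G - Z) (edges G') Z' \<phi> l \<in> K})"
    (is "?S = (\<Union>(Z, Z', \<phi>) \<in> ?T. ?F Z Z' \<phi>)")
proof (intro equalityI subsetI)
  fix l assume "l \<in> ?S"
  then obtain x where l: "l \<in> unit_metrics G" and x: "x \<in> K" "((G, l, c), (G', x, c')) \<in> cmg_rel s m"
    by blast
  have x': "x \<in> unit_metrics G'" using x K by blast
  let ?Z = "zero_edges G l" and ?Z' = "zero_edges G' x"
  obtain f \<phi> where iso: "graph_iso s (collapse G ?Z) (collapse G' ?Z') f \<phi>"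
    and bij: "bij_betw \<phi> (edges G - ?Z) (edges G' - ?Z')"
    and lc: "\<And>e. e \<in> edges G - ?Z \<Longrightarrow> x (\<phi> e) = l e \<and> c' (\<phi> e) = c e"
    using cmg_relD[OF x(2) l x'] by blast
  \<comment> \<open>Only the values of \<phi> off the zero set matter; restricting places it in a
    finite function space, so that the union is finite.\<close>
  let ?\<psi> = "restrict \<phi> (edges G - ?Z)"
  have iso': "graph_iso s (collapse G ?Z) (collapse G' ?Z') f ?\<psi>"
    using iso by (rule graph_iso_edge_cong) (simp add: collapse_def)
  have bij': "bij_betw ?\<psi> (edges G - ?Z) (edges G' - ?Z')"
    using bij by (subst bij_betw_cong[where g = \<phi>]) auto
  have "transport (edges G - ?Z) (edges G') ?Z' ?\<psi> l = x"
  proof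
    fix e' show "transport (edges G - ?Z) (edges G') ?Z' ?\<psi> l e' = x e'"
    proof (cases "e' \<in> edges G' - ?Z'")
      case True
      then obtain e where e: "e \<in> edges G - ?Z" "?\<psi> e = e'"
        using bij' unfolding bij_betw_def by (metis imageE)
      then have "inv_into (edges G - ?Z) ?\<psi> e' = e"
        using bij' unfolding bij_betw_def by (metis inv_into_f_f)
      then show ?thesis using True e lc[OF e(1)] by (simp add: transport_def)
    next
      case False
      then show ?thesis
        using subsetD[OF unit_metrics_extensional x']
        by (auto simp: transport_def zero_edges_def extensional_def)
    qed
  qed
  then have "l \<in> ?F ?Z ?Z' ?\<psi>" using l x(1) by (simp add: zero_edges_def)
  moreover have "?\<psi> \<in> (edges G - ?Z) \<rightarrow>\<^sub>E edges G'"
    using bij_betwE[OF bij] by (intro restrict_PiE_iff[THEN iffD2]) auto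
  then have "(?Z, ?Z', ?\<psi>) \<in> ?T"
    unfolding mem_Collect_eq prod.case
    using iso' lc by (intro conjI exI[of _ f] ballI) (simp_all add: zero_edges_def)
  ultimately show "l \<in> (\<Union>(Z, Z', \<phi>) \<in> ?T. ?F Z Z' \<phi>)" 
    by (intro UN_I[of "(?Z, ?Z', ?\<psi>)"]) (simp_all only: prod.case)
next
  fix l assume "l \<in> (\<Union>(Z, Z', \<phi>) \<in> ?T. ?F Z Z' \<phi>)"
  then obtain Z Z' \<phi> f where Z: "Z \<subseteq> edges G" "Z' \<subseteq> edges G'"
    and iso: "graph_iso s (collapse G Z) (collapse G' Z') f \<phi>"
    and c: "\<forall>e\<in>edges G - Z. c' (\<phi> e) = c e"
    and l: "l \<in> unit_metrics G" "\<forall>e\<in>Z. l e = 0"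
    and xK: "transport (edges G - Z) (edges G') Z' \<phi> l \<in> K"
    by blast
  define x where "x = transport (edges G - Z) (edges G') Z' \<phi> l"
  have bij: "bij_betw \<phi> (edges G - Z) (edges G' - Z')"
    using iso by (simp add: graph_iso_def collapse_def)
  have x\<phi>: "x (\<phi> e) = l e" if "e \<in> edges G - Z" for e
  proof -
    have "\<phi> e \<in> edges G' - Z'" using bij that by (auto simp: bij_betw_def)
    moreover have "inv_into (edges G - Z) \<phi> (\<phi> e) = e" using bij that by (simp add: bij_betw_def)
    ultimately show ?thesis by (simp add: x_def transport_def)
  qed
  let ?Y = "zero_edges G l"
  have Y: "Z \<subseteq> ?Y" "?Y \<subseteq> edges G" using Z l(2) by (auto simp: zero_edges_def)
  \<comment> \<open>Zeros of \<open>l\<close> beyond \<open>Z\<close> reappear in \<open>x\<close>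
    at their images under \<phi>, so the zero sets grow by matching edges, as
    \<open>collapse_iso_mono\<close> requires.\<close>
  have "zero_edges G' x = Z' \<union> \<phi> ` (?Y - Z)"
  proof -
    have "edges G' = Z' \<union> \<phi> ` (edges G - Z)" using bij Z by (auto simp: bij_betw_def)
    moreover have "x e' = 0" if "e' \<in> Z'" for e' using that Z by (auto simp: x_def transport_def)
    ultimately show ?thesis using x\<phi> by (auto simp: zero_edges_def)
  qed
  then obtain f' where iso': "graph_iso s (collapse G ?Y) (collapse G' (zero_edges G' x)) f' \<phi>"
    using collapse_iso_mono[OF one_loop.graph[OF G(1)] one_loop.graph[OF G'(1)] Y Z(2) iso] by auto
  have "x \<in> unit_metrics G'" using xK K by (auto simp: x_def)
  from cmg_relI[OF G(1) l(1) G(2) G'(1) this G'(2) iso'] x\<phi> c l(2)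
  have "((G, l, c), (G', x, c')) \<in> cmg_rel s m" by blast
  then show "l \<in> ?S" using l(1) xK by (auto simp: x_def)
qed

lemma continuous_map_powertop_coordinate:
  "e \<in> E \<Longrightarrow> continuous_map (subtopology (powertop_real E) S) euclideanreal (\<lambda>l. l e)"
  by (intro continuous_map_from_subtopology continuous_map_product_projection)

lemma closedin_related_unit_metrics:
  assumes G: "one_loop s G" "c \<in> colorings m G" and G': "one_loop s G'" "c' \<in> colorings m G'"
    and K: "closedin (metric_simplex G') K"
  shows "closedin (metric_simplex G) {l \<in> unit_metrics G. \<exists>x\<in>K. ((G, l, c), (G', x, c')) \<in> cmg_rel s m}"
proof -
  have K': "K \<subseteq> unit_metrics G'"
    using closedin_subset[OF K] by (simp add: one_loop.topspace_metric_simplex[OF G'(1)])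
  let ?T = "{(Z, Z', \<phi>). Z \<subseteq> edges G \<and> Z' \<subseteq> edges G' \<and> \<phi> \<in> (edges G - Z) \<rightarrow>\<^sub>E edges G' \<and>
        (\<exists>f. graph_iso s (collapse G Z) (collapse G' Z') f \<phi>) \<and> (\<forall>e\<in>edges G - Z. c' (\<phi> e) = c e)}"
  let ?F = "\<lambda>Z Z' \<phi>. {l \<in> unit_metrics G. (\<forall>e\<in>Z. l e = 0) \<and> transport (edges G - Z) (edges G') Z' \<phi> l \<in> K}"
  have fin: "finite (edges G)" "finite (edges G')"
    using G G' by (auto intro: one_loop.finite_edges)
  have "finite (SIGMA Z:Pow (edges G). SIGMA Z':Pow (edges G'). (edges G - Z) \<rightarrow>\<^sub>E edges G')"
    using fin by (intro finite_SigmaI finite_PiE) auto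
  then have finT: "finite ?T"
    by (rule rev_finite_subset) auto
  have "closedin (metric_simplex G) (?F Z Z' \<phi>)" if T: "(Z, Z', \<phi>) \<in> ?T" for Z Z' \<phi>
  proof -
    have Z: "Z \<subseteq> edges G" "Z' \<subseteq> edges G'" using T by auto
    have bij: "bij_betw \<phi> (edges G - Z) (edges G' - Z')"
      using T by (auto simp: graph_iso_def collapse_def)
    define C where "C = {l \<in> unit_metrics G. \<forall>e\<in>Z. l e = 0}"
    \<comment> \<open>Lengths are nonnegative, so vanishing on all of \<open>Z\<close> is the
      vanishing of one continuous sum.\<close>
    have "closedin (metric_simplex G) {l \<in> topspace (metric_simplex G). (\<Sum>e\<in>Z. l e) \<in> {0}}"
      unfolding one_loop.metric_simplex_eq[OF G(1)] using Z(1) finite_subset[OF Z(1) fin(1)]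
      by (intro closedin_continuous_map_preimage[of _ euclideanreal] continuous_map_sum
          continuous_map_powertop_coordinate) auto
    moreover have "{l \<in> topspace (metric_simplex G). (\<Sum>e\<in>Z. l e) \<in> {0}} = C"
      using unit_metrics_nonneg[of _ G] finite_subset[OF Z(1) fin(1)] Z(1)
      by (auto simp: C_def one_loop.topspace_metric_simplex[OF G(1)] sum_nonneg_eq_0_iff subset_iff)
    ultimately have C: "closedin (metric_simplex G) C" by simp
    let ?t = "transport (edges G - Z) (edges G') Z' \<phi>"
    have inv: "inv_into (edges G - Z) \<phi> e' \<in> edges G - Z" if "e' \<in> edges G'" "e' \<notin> Z'" for e'
      using bij that by (intro inv_into_into) (auto simp: bij_betw_def)
    have CU: "C \<subseteq> unit_metrics G" by (auto simp: C_def)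
    have sub: "subtopology (metric_simplex G) C = subtopology (powertop_real (edges G)) C"
      unfolding one_loop.metric_simplex_eq[OF G(1)] using CU
      by (simp add: subtopology_subtopology Int_absorb1)
    have t_unit: "?t l \<in> unit_metrics G'" if l: "l \<in> C" for l
    proof -
      have l': "l \<in> unit_metrics G" "\<forall>e\<in>Z. l e = 0" using l by (auto simp: C_def)
      have "0 \<le> ?t l e'" if "e' \<in> edges G'" for e'
        using that inv[of e'] unit_metrics_nonneg[OF l'(1)] by (auto simp: transport_def)
      then have "?t l \<in> edges G' \<rightarrow>\<^sub>E {0..}" by (auto simp: transport_def)
      moreover have "(\<Sum>e'\<in>edges G'. ?t l e') = 1"
      proof -
        have "(\<Sum>e'\<in>edges G'. ?t l e') = (\<Sum>e'\<in>edges G' - Z'. ?t l e')"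
          using fin Z by (intro sum.mono_neutral_right) (auto simp: transport_def)
        also have "\<dots> = (\<Sum>e\<in>edges G - Z. ?t l (\<phi> e))"
          using sum.reindex_bij_betw[OF bij] by metis
        also have "\<dots> = (\<Sum>e\<in>edges G - Z. l e)"
        proof (rule sum.cong[OF refl])
          fix e assume e: "e \<in> edges G - Z"
          then have "\<phi> e \<in> edges G' - Z'" "inv_into (edges G - Z) \<phi> (\<phi> e) = e"
            using bij by (auto simp: bij_betw_def)
          then show "?t l (\<phi> e) = l e" by (simp add: transport_def)
        qed
        also have "\<dots> = (\<Sum>e\<in>edges G. l e)"
          using fin l'(2) by (intro sum.mono_neutral_left) auto
        finally show ?thesis using l'(1) by (simp add: unit_metrics_def)
      qed
      ultimately show ?thesis by (simp add: unit_metrics_def)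
    qed
    \<comment> \<open>Each coordinate of the transported metric is either zero or a single
      coordinate of \<open>l\<close>.\<close>
    have "continuous_map (subtopology (metric_simplex G) C) (metric_simplex G') ?t"
      unfolding sub one_loop.metric_simplex_eq[OF G'(1)] continuous_map_in_subtopology
    proof
      show "continuous_map (subtopology (powertop_real (edges G)) C) (powertop_real (edges G')) ?t"
        unfolding continuous_map_componentwise
      proof (intro conjI ballI)
        fix e' assume e': "e' \<in> edges G'"
        show "continuous_map (subtopology (powertop_real (edges G)) C) euclideanreal (\<lambda>l. ?t l e')"
        proof (cases "e' \<in> Z'")
          case True
          then show ?thesis using e' by (simp add: transport_def)
        next
          case False
          then show ?thesis
            using e' inv[OF e' False] by (simp add: transport_def continuous_map_powertop_coordinate)
        qed
      qed (auto simp: transport_def)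
      show "?t \<in> topspace (subtopology (powertop_real (edges G)) C) \<rightarrow> unit_metrics G'"
        using t_unit by auto
    qed
    from closedin_continuous_map_preimage[OF this K]
    have "closedin (subtopology (metric_simplex G) C)
        {l \<in> topspace (subtopology (metric_simplex G) C). ?t l \<in> K}" .
    then have "closedin (metric_simplex G) {l \<in> topspace (subtopology (metric_simplex G) C). ?t l \<in> K}"
      using C by (rule closedin_trans_full)
    moreover have "{l \<in> topspace (subtopology (metric_simplex G) C). ?t l \<in> K} = ?F Z Z' \<phi>"
      by (auto simp: one_loop.topspace_metric_simplex[OF G(1)] C_def)
    ultimately show ?thesis by simp
  qed
  then show ?thesis
    unfolding related_unit_metrics[OF G G' K'] using finT by (intro closedin_Union) auto
qed

section \<open>Cyclic words\<close>

text \<open>Pinning leg 1 to vertex 0 removes the rotations of the cycle, so that only one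
  reflection can still identify two labellings.\<close>

definition based_labellings :: "nat \<Rightarrow> nat \<Rightarrow> (nat \<Rightarrow> nat) set" where
  "based_labellings s k = {w \<in> labellings s k. w 1 = 0}"

lemma based_labellingsD:
  assumes "w \<in> based_labellings s k"
  shows "w \<in> labellings s k" "w 1 = 0" "\<And>i. i \<in> {1..s} \<Longrightarrow> w i < k"
    "\<And>j. j < k \<Longrightarrow> \<exists>i\<in>{1..s}. w i = j" "w \<in> extensional {1..s}"
proof -
  show "w \<in> labellings s k" "w 1 = 0" "\<And>i. i \<in> {1..s} \<Longrightarrow> w i < k" "w \<in> extensional {1..s}"
    using assms by (auto simp: based_labellings_def labellings_def PiE_iff)
  have "w ` {1..s} = {..<k}" using assms by (auto simp: based_labellings_def labellings_def)
  then show "\<exists>i\<in>{1..s}. w i = j" if "j < k" for j using that by (metis imageE lessThan_iff)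
qed

text \<open>Edge \<open>k - 1\<close> joins vertex \<open>k - 1\<close> to vertex 0. Merging the
  former into the latter leaves the numbers of all other vertices and edges unchanged.\<close>

lemma contract_last_edge:
  assumes k: "k \<ge> 2" and w: "w \<in> labellings s k"
  defines "h \<equiv> \<lambda>v. if v = k - 1 then 0 else v"
  defines "w' \<equiv> \<lambda>i\<in>{1..s}. h (w i)"
  shows "w' \<in> labellings s (k - 1)"
    and "contraction s (cycle_graph k w) (cycle_graph (k - 1) w') {k - 1} h id"
proof -
  have wk: "w ` {1..s} = {..<k}" "\<And>i. i \<in> {1..s} \<Longrightarrow> w i < k" using w by (auto simp: labellings_def)
  have hk: "h ` {..<k} = {..<k - 1}"
  proof (intro equalityI subsetI)
    fix v assume "v \<in> {..<k - 1}"
    then have "h v = v" "v \<in> {..<k}" by (auto simp: h_def)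
    then show "v \<in> h ` {..<k}" by (metis imageI)
  qed (use k in \<open>auto simp: h_def\<close>)
  have "w' ` {1..s} = h ` w ` {1..s}" by (auto simp: w'_def)
  then have "w' ` {1..s} = {..<k - 1}" using wk hk by simp
  moreover from this have "w' \<in> {1..s} \<rightarrow>\<^sub>E {..<k - 1}"
    by (intro PiE_I) (blast, auto simp: w'_def)
  ultimately show "w' \<in> labellings s (k - 1)" by (simp add: labellings_def)
  show "contraction s (cycle_graph k w) (cycle_graph (k - 1) w') {k - 1} h id"
  proof
    let ?G = "cycle_graph k w"
    show ends: "\<forall>e\<in>edges ?G. set_uprod (ends ?G e) \<subseteq> verts ?G" using k by auto
    show "h ` verts ?G = verts (cycle_graph (k - 1) w')" using hk by simp
    have "(k - 1, 0) \<in> joined_by ?G {k - 1}" using k by (intro joined_by_edge[of "k - 1"]) auto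
    then have j: "(k - 1, 0) \<in> joined_by ?G {k - 1}" "(0, k - 1) \<in> joined_by ?G {k - 1}"
      by (auto dest: joined_by_sym)
    show "h u = h v \<longleftrightarrow> (u, v) \<in> joined_by ?G {k - 1}" if uv: "u \<in> verts ?G" "v \<in> verts ?G" for u v
    proof
      assume "h u = h v"
      then have "u = v \<or> (u = 0 \<and> v = k - 1) \<or> (u = k - 1 \<and> v = 0)"
        by (auto simp: h_def split: if_splits)
      then show "(u, v) \<in> joined_by ?G {k - 1}" using j uv joined_by_refl by metis
    next
      have ends': "\<forall>e\<in>{k - 1}. set_uprod (ends ?G e) \<subseteq> verts ?G" using k by auto
      assume "(u, v) \<in> joined_by ?G {k - 1}"
      then show "h u = h v"
        using ends'
      proof (induction rule: joined_by_induct)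
        case (step x y e)
        then have "Upair x y = Upair (k - 1) 0" using k by auto
        then have "h x = h y" by (auto simp: h_def)
        then show ?case using step.IH by simp
      qed simp
    qed
    show "ends (cycle_graph (k - 1) w') (id e) = map_uprod h (ends ?G e)" if "e \<in> edges ?G - {k - 1}" for e
    proof -
      have e: "e < k - 1" using that by auto
      then have "Suc e mod (k - 1) = h (Suc e mod k)"
        by (cases "Suc e = k - 1") (auto simp: h_def)
      then show ?thesis using e by (simp add: h_def)
    qed
    show "bij_betw id (edges ?G - {k - 1}) (edges (cycle_graph (k - 1) w'))"
    proof -
      have "{..<k} - {k - 1} = {..<k - 1}" using k by auto
      then show ?thesis by simp
    qed
  qed (use wk k in \<open>auto simp: w'_def\<close>)
qed

text \<open>Induction on the number of edges, which drops with each contraction. The process cannot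
  run out of edges: a single remaining edge carries the whole length one.\<close>

lemma exists_cyclic_representative:
  assumes "one_loop s G" "l \<in> unit_metrics G" "c \<in> colorings m G" "s \<ge> 1"
  obtains k w l' c' where "k > 0" "w \<in> based_labellings s k" "l' \<in> unit_metrics (cycle_graph k w)"
    "c' \<in> colorings m (cycle_graph k w)" "\<And>j. j < k \<Longrightarrow> l' j > 0"
    "((G, l, c), (cycle_graph k w, l', c')) \<in> cmg_rel s m"
proof -
  have pull: "\<exists>l' c'. l' \<in> unit_metrics (cycle_graph k w) \<and> c' \<in> colorings m (cycle_graph k w) \<and>
      (\<forall>j<k. l' j = l (\<epsilon> j)) \<and> ((G, l, c), (cycle_graph k w, l', c')) \<in> cmg_rel s m"
    if G: "one_loop s G" "l \<in> unit_metrics G" "c \<in> colorings m G"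
      and w: "k > 0" "w \<in> labellings s k" and iso: "graph_iso s (cycle_graph k w) G p \<epsilon>"
    for k w p \<epsilon> and G :: ngraph and l c
  proof -
    let ?C = "cycle_graph k w"
    let ?c = "\<lambda>e\<in>edges ?C. c (\<epsilon> e)" and ?l = "\<lambda>e\<in>edges ?C. l (\<epsilon> e)"
    have "bij_betw \<epsilon> (edges ?C) (edges G)" using iso by (simp add: graph_iso_def)
    then have c: "?c \<in> colorings m ?C"
      using G(3) bij_betwE unfolding colorings_def by fastforce
    have "?l \<in> unit_metrics ?C" "((?C, ?l, ?c), (G, l, c)) \<in> cmg_rel s m"
      using cmg_rel_iso[OF iso cycle_graph_one_loop[OF w] c G] by simp_all
    then show ?thesis
      using c cmg_rel_sym by (intro exI[of _ ?l] exI[of _ ?c]) simp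
  qed
  have "\<exists>k w l' c'. k > 0 \<and> w \<in> based_labellings s k \<and> l' \<in> unit_metrics (cycle_graph k w) \<and>
    c' \<in> colorings m (cycle_graph k w) \<and> (\<forall>j<k. l' j > 0) \<and>
    ((G, l, c), (cycle_graph k w, l', c')) \<in> cmg_rel s m"
    using assms(1-3)
  proof (induction "card (edges G)" arbitrary: G l c rule: less_induct)
    case less
    interpret one_loop s G by fact
    show ?case
    proof (cases "\<forall>e\<in>edges G. l e > 0")
      case True
      define a where "a = leg G 1"
      have a: "a \<in> verts G" using leg_verts[of 1] assms(4) by (simp add: a_def)
      have "edge_degree a \<noteq> 0" using edge_degree_eq[OF a] by simp
      then obtain e where e: "e \<in> edges G" "a \<in> set_uprod (ends G e)"
      proof -
        have "{e \<in> edges G. a \<in> set_uprod (ends G e)} \<noteq> {}"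
        proof
          assume *: "{e \<in> edges G. a \<in> set_uprod (ends G e)} = {}"
          then have "{e \<in> edges G. ends G e = Upair a a} = {}" by auto
          with * \<open>edge_degree a \<noteq> 0\<close> show False unfolding edge_degree_def by (metis add_0 card.empty)
        qed
        then show ?thesis using that by blast
      qed
      obtain x y where "ends G e = Upair x y" by (metis uprod_exhaust)
      moreover have "Upair x y = Upair y x" by simp
      ultimately obtain b where b: "ends G e = Upair b a" using e(2) by auto
      obtain k w p \<epsilon> where kw: "k > 0" "w \<in> labellings s k" and iso: "graph_iso s (cycle_graph k w) G p \<epsilon>"
        and p: "p 0 = a" using normal_form[OF e(1) b] by metis
      \<comment> \<open>The normal form was started at the vertex of leg 1, and \<open>p\<close> is
        injective, so leg 1 receives label 0.\<close>
      have "p (w 1) = p 0" using iso p assms(4) by (simp add: graph_iso_def a_def)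
      moreover have "w 1 < k" using kw(2) assms(4) by (auto simp: labellings_def)
      ultimately have "w 1 = 0" using iso kw by (auto simp: graph_iso_def bij_betw_def inj_on_def)
      then have "w \<in> based_labellings s k" using kw by (simp add: based_labellings_def)
      moreover obtain l' c' where lc: "l' \<in> unit_metrics (cycle_graph k w)" "c' \<in> colorings m (cycle_graph k w)"
        "\<forall>j<k. l' j = l (\<epsilon> j)" "((G, l, c), (cycle_graph k w, l', c')) \<in> cmg_rel s m"
        using pull[OF less.prems kw iso] by blast
      moreover have "\<epsilon> j \<in> edges G" if "j < k" for j
        using iso that by (auto simp: graph_iso_def bij_betw_def)
      ultimately show ?thesis
        using True kw(1) by (intro exI[of _ k] exI[of _ w] exI[of _ l'] exI[of _ c']) simp
    next
      case False
      then obtain e where e: "e \<in> edges G" "l e = 0"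
        using unit_metrics_nonneg[OF less.prems(2)] by force
      obtain b a where b: "ends G e = Upair b a" by (metis uprod_exhaust)
      obtain k w p \<epsilon> where kw: "k > 0" "w \<in> labellings s k" and iso: "graph_iso s (cycle_graph k w) G p \<epsilon>"
        and \<epsilon>: "\<epsilon> (k - 1) = e" using normal_form[OF e(1) b] by metis
      obtain l' c' where l': "l' \<in> unit_metrics (cycle_graph k w)" and c': "c' \<in> colorings m (cycle_graph k w)"
        and l'l: "\<forall>j<k. l' j = l (\<epsilon> j)" and rel: "((G, l, c), (cycle_graph k w, l', c')) \<in> cmg_rel s m"
        using pull[OF less.prems kw iso] by blast
      have zero: "l' (k - 1) = 0" using l'l \<epsilon> e kw by simp
      have sum: "(\<Sum>j<k. l' j) = 1" using l' by (simp add: unit_metrics_def)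
      have k2: "k \<ge> 2"
      proof (rule ccontr)
        assume "\<not> k \<ge> 2"
        then have "k = 1" using kw by simp
        then show False using sum zero by simp
      qed
      let ?h = "\<lambda>v. if v = k - 1 then 0 else v"
      define w' where "w' = (\<lambda>i\<in>{1..s}. ?h (w i))"
      have w': "w' \<in> labellings s (k - 1)"
        and con: "contraction s (cycle_graph k w) (cycle_graph (k - 1) w') {k - 1} ?h id"
        using contract_last_edge[OF k2 kw(2)] unfolding w'_def by blast+
      let ?C = "cycle_graph (k - 1) w'"
      define l'' where "l'' = restrict l' {..<k - 1}"
      define c'' where "c'' = restrict c' {..<k - 1}"
      have "(\<Sum>j<k - 1. l'' j) = (\<Sum>j<k - 1. l' j)"
        by (intro sum.cong) (auto simp: l''_def)
      also have "\<dots> = 1"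
      proof -
        have "{..<k} = insert (k - 1) {..<k - 1}" using k2 by auto
        then show ?thesis using sum zero by simp
      qed
      finally have sum'': "(\<Sum>j<k - 1. l'' j) = 1" .
      have "0 \<le> l' j" if "j < k" for j
        using unit_metrics_nonneg[OF l'] that by simp
      then have "l'' \<in> {..<k - 1} \<rightarrow>\<^sub>E {0..}"
        unfolding l''_def by (intro restrict_PiE_iff[THEN iffD2]) auto
      with sum'' have l'': "l'' \<in> unit_metrics ?C"
        by (simp only: unit_metrics_def cycle_graph_simps mem_Collect_eq simp_thms)
      have "c' j \<in> {1..m}" if "j < k" for j
        using PiE_mem[OF c'[unfolded colorings_def cycle_graph_simps], of j] that by simp
      then have "c'' \<in> {..<k - 1} \<rightarrow>\<^sub>E {1..m}"
        unfolding c''_def by (intro restrict_PiE_iff[THEN iffD2]) auto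
      then have c'': "c'' \<in> colorings m ?C"
        unfolding colorings_def cycle_graph_simps .
      have C: "one_loop s ?C" using k2 by (intro cycle_graph_one_loop w') simp
      have "((cycle_graph k w, l', c'), (?C, l'', c'')) \<in> cmg_rel s m"
        by (rule cmg_rel_contraction[OF con cycle_graph_one_loop[OF kw] l' c' C l'' c''])
          (use zero in \<open>auto simp: l''_def c''_def\<close>)
      with rel have rel': "((G, l, c), (?C, l'', c'')) \<in> cmg_rel s m" by (rule cmg_rel_trans)
      have "card (edges G) = k"
        using iso bij_betw_same_card[of \<epsilon> "{..<k}" "edges G"] by (simp add: graph_iso_def)
      then have "card (edges ?C) < card (edges G)" using k2 by simp
      from less.hyps[OF this C l'' c''] obtain k0 w0 l0 c0
        where "k0 > 0" "w0 \<in> based_labellings s k0" "l0 \<in> unit_metrics (cycle_graph k0 w0)"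
          "c0 \<in> colorings m (cycle_graph k0 w0)" "\<forall>j<k0. l0 j > 0"
          "((?C, l'', c''), (cycle_graph k0 w0, l0, c0)) \<in> cmg_rel s m" by blast
      with cmg_rel_trans[OF rel'] show ?thesis
        by (intro exI[of _ k0] exI[of _ w0] exI[of _ l0] exI[of _ c0] conjI)
    qed
  qed
  then show ?thesis using that by blast
qed

section \<open>Rigidity of based cycles\<close>

lemma cycle_edge_inj:
  assumes "k \<ge> 3" "i < k" "j < k" "Upair i (Suc i mod k) = Upair j (Suc j mod k)"
  shows "i = j"
proof (rule ccontr)
  assume "i \<noteq> j"
  then have *: "i = Suc j mod k" "Suc i mod k = j" using assms(4) by auto
  show False
  proof (cases "Suc j = k")
    case True
    then have "i = 0" using * by simp
    then show False using * True assms(1) by simp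
  next
    case False
    then have i: "i = Suc j" using * assms by simp
    show False
    proof (cases "Suc i = k")
      case True
      then show False using * i assms(1) by simp
    next
      case False
      then have "Suc i mod k = Suc i" using assms by simp
      then show False using * i by simp
    qed
  qed
qed

lemma Upair_eqD: "Upair a b = Upair c d \<Longrightarrow> (c = a \<and> b = d) \<or> (b = c \<and> d = a)"
  by auto

text \<open>Vertex 1 must go to a neighbour of vertex 0. From then on each vertex goes to the
  neighbour of the previous image that has not just been used, so the first step decides
  everything.\<close>

lemma cycle_graph_iso_vertices:
  assumes k: "k > 0" and f: "inj_on f {..<k}" "\<And>j. j < k \<Longrightarrow> f j < k" and f0: "f 0 = 0"
    and adj: "\<And>j. j < k \<Longrightarrow> \<exists>i<k. Upair (f j) (f (Suc j mod k)) = Upair i (Suc i mod k)"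
  shows "(\<forall>j<k. f j = j) \<or> (\<forall>j<k. f j = (k - j) mod k)"
proof (cases "k = 1")
  case True
  then show ?thesis using f0 by simp
next
  case False
  then have k1: "1 < k" using k by simp
  obtain i where i: "i < k" "Upair (f 0) (f 1) = Upair i (Suc i mod k)" using adj[of 0] k1 by auto
  have "f 1 = 1 \<or> f 1 = k - 1"
  proof (cases "i = 0 \<and> f 1 = Suc i mod k")
    case True
    then show ?thesis using k1 by simp
  next
    case False
    then have "f 1 = i" "Suc i mod k = 0" using i(2) f0 by auto
    then show ?thesis using i(1) by (cases "Suc i = k") auto
  qed
  then show ?thesis
  proof
    assume f1: "f 1 = 1"
    have "f j = j" if "j < k" for j
      using that
    proof (induction j rule: less_induct)
      case (less j)
      consider "j = 0" | "j = 1" | n where "j = Suc (Suc n)" by (metis One_nat_def not0_implies_Suc)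
      then show ?case
      proof cases
        case (3 n)
        have fn: "f (Suc n) = Suc n" "f n = n" using less 3 by auto
        have m: "Suc (Suc n) mod k = j" "Suc n < k" using less.prems 3 by simp_all
        obtain i where i: "i < k" "Upair (Suc n) (f j) = Upair i (Suc i mod k)"
          using adj[OF m(2)] unfolding m(1) fn(1) by blast
        then consider "i = Suc n" "f j = Suc i mod k" | "f j = i" "Suc i mod k = Suc n"
          using Upair_eqD[OF i(2)] by blast
        then show ?thesis
        proof cases
          case 1
          then show ?thesis using 3 less.prems by simp
        next
          case 2
          then have "i = n" using i(1) by (cases "Suc i = k") auto
          then have "f j = f n" using 2 fn by simp
          then have "j = n" using f(1) less.prems 3 by (auto dest!: inj_onD)
          then show ?thesis using 3 by simp
        qed
      qed (use f0 f1 in auto)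
    qed
    then show ?thesis by blast
  next
    assume f1: "f 1 = k - 1"
    have "f j = (k - j) mod k" if "j < k" for j
      using that
    proof (induction j rule: less_induct)
      case (less j)
      consider "j = 0" | "j = 1" | n where "j = Suc (Suc n)" by (metis One_nat_def not0_implies_Suc)
      then show ?case
      proof cases
        case (3 n)
        have fn: "f (Suc n) = k - Suc n" "f n = (k - n) mod k" using less 3 by auto
        have m: "Suc (Suc n) mod k = j" "Suc n < k" using less.prems 3 by simp_all
        obtain i where i: "i < k" "Upair (k - Suc n) (f j) = Upair i (Suc i mod k)"
          using adj[OF m(2)] unfolding m(1) fn(1) by blast
        then consider "i = k - Suc n" "f j = Suc i mod k" | "f j = i" "Suc i mod k = k - Suc n"
          using Upair_eqD[OF i(2)] by blast
        then show ?thesis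
        proof cases
          case 1
          then have "f j = f n" using fn less.prems 3 by (simp add: Suc_diff_Suc)
          then have "j = n" using f(1) less.prems 3 by (auto dest!: inj_onD)
          then show ?thesis using 3 by simp
        next
          case 2
          then have "i = k - j" using i(1) 3 less.prems by (cases "Suc i = k") auto
          then show ?thesis using 2 3 less.prems by simp
        qed
      qed (use f0 f1 k1 in auto)
    qed
    then show ?thesis by blast
  qed
qed

text \<open>With at least three vertices an edge is determined by its ends, so the vertex map
  decides the edge map. With two vertices the reflection fixes both of them, and only the exchange
  of the parallel edges tells the alternatives apart.\<close>

lemma cycle_graph_iso_rigid:
  assumes iso: "graph_iso s (cycle_graph k w) (cycle_graph k' w') f \<phi>"
    and k: "k > 0" and s: "s \<ge> 1" and w: "w 1 = 0" "w' 1 = 0"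
  shows "k' = k \<and> ((\<forall>j<k. f j = j \<and> \<phi> j = j) \<or> (\<forall>j<k. f j = (k - j) mod k \<and> \<phi> j = k - 1 - j))"
proof -
  have f: "bij_betw f {..<k} {..<k'}" and \<phi>: "bij_betw \<phi> {..<k} {..<k'}"
    using iso by (simp_all add: graph_iso_def)
  have kk: "k' = k" using bij_betw_same_card[OF f] by simp
  have f0: "f 0 = 0" using iso s w by (auto simp: graph_iso_def)
  have \<phi>k: "\<phi> j < k" if "j < k" for j using \<phi> that kk by (auto simp: bij_betw_def)
  have ends: "Upair (f j) (f (Suc j mod k)) = Upair (\<phi> j) (Suc (\<phi> j) mod k)" if "j < k" for j
  proof -
    have "ends (cycle_graph k' w') (\<phi> j) = map_uprod f (ends (cycle_graph k w) j)"
      using iso that unfolding graph_iso_def by (metis cycle_graph_simps(2) lessThan_iff)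
    moreover have "ends (cycle_graph k' w') (\<phi> j) = Upair (\<phi> j) (Suc (\<phi> j) mod k)"
      unfolding kk using \<phi>k[OF that] by (rule cycle_graph_simps(4))
    ultimately show ?thesis using that by (metis cycle_graph_simps(4) map_uprod_simps)
  qed
  have fk: "(\<forall>j<k. f j = j) \<or> (\<forall>j<k. f j = (k - j) mod k)"
    by (rule cycle_graph_iso_vertices[OF k]) (use f kk f0 ends \<phi>k in \<open>auto simp: bij_betw_def\<close>)
  have flip_edge: "Upair ((k - j) mod k) ((k - (Suc j mod k)) mod k) = Upair (k - 1 - j) (Suc (k - 1 - j) mod k)"
    if "j < k" for j
    using that by (cases "Suc j = k") (auto simp: Suc_diff_Suc)
  consider "k = 1" | "k = 2" | "k \<ge> 3" using k by linarith
  then have "(\<forall>j<k. f j = j \<and> \<phi> j = j) \<or> (\<forall>j<k. f j = (k - j) mod k \<and> \<phi> j = k - 1 - j)"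
  proof cases
    case 1
    then show ?thesis using f0 \<phi>k by auto
  next
    case 2
    have f1: "f 0 = 0" "f 1 = 1" using fk 2 by auto
    have "\<phi> 0 < 2" "\<phi> 1 < 2" using \<phi>k 2 by auto
    moreover have "\<phi> 0 \<noteq> \<phi> 1"
      using inj_onD[OF bij_betw_imp_inj_on[OF \<phi>], of 0 1] 2 by auto
    ultimately have "(\<phi> 0 = 0 \<and> \<phi> 1 = 1) \<or> (\<phi> 0 = 1 \<and> \<phi> 1 = 0)" by auto
    moreover have "j = 0 \<or> j = 1" if "j < k" for j using that 2 by auto
    ultimately show ?thesis using f1 2 by fastforce
  next
    case 3
    from fk show ?thesis
    proof
      assume id: "\<forall>j<k. f j = j"
      have "\<phi> j = j" if "j < k" for j
        by (rule cycle_edge_inj[OF 3 \<phi>k[OF that] that]) (use ends[OF that] id that k in auto)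
      with id show ?thesis by blast
    next
      assume fl: "\<forall>j<k. f j = (k - j) mod k"
      have "\<phi> j = k - 1 - j" if j: "j < k" for j
      proof (rule cycle_edge_inj[OF 3 \<phi>k[OF j]])
        have "f (Suc j mod k) = (k - (Suc j mod k)) mod k" using fl k by simp
        then show "Upair (\<phi> j) (Suc (\<phi> j) mod k) = Upair (k - 1 - j) (Suc (k - 1 - j) mod k)"
          using ends[OF j] flip_edge[OF j] fl j by metis
      qed (use k in simp)
      with fl show ?thesis by blast
    qed
  qed
  with kk show ?thesis by blast
qed

text \<open>The reflection of the cycle that fixes vertex 0; it exchanges the edges \<open>j\<close> and \<open>k - 1 - j\<close>.\<close>

definition flip_labelling :: "nat \<Rightarrow> nat \<Rightarrow> (nat \<Rightarrow> nat) \<Rightarrow> nat \<Rightarrow> nat" where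
  "flip_labelling s k w = (\<lambda>i\<in>{1..s}. (k - w i) mod k)"

definition flip_edges :: "nat \<Rightarrow> (nat \<Rightarrow> 'b) \<Rightarrow> nat \<Rightarrow> 'b" where
  "flip_edges k c = (\<lambda>j\<in>{..<k}. c (k - 1 - j))"

lemma flip_vertex: "v < k \<Longrightarrow> (k - (k - v) mod k) mod k = (v::nat)"
  by (cases "v = 0") auto

lemma flip_labelling_based:
  assumes "w \<in> based_labellings s k" "s \<ge> 1"
  shows "flip_labelling s k w \<in> based_labellings s k" "flip_labelling s k (flip_labelling s k w) = w"
proof -
  note w = based_labellingsD[OF assms(1)]
  have k: "k > 0" using w(3)[of 1] assms(2) by auto
  have "flip_labelling s k w ` {1..s} = {..<k}"
  proof (intro equalityI subsetI)
    fix v assume v: "v \<in> {..<k}"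
    then obtain i where "i \<in> {1..s}" "w i = (k - v) mod k" using w(4)[of "(k - v) mod k"] k by auto
    then have "flip_labelling s k w i = v" using flip_vertex v by (simp add: flip_labelling_def)
    then show "v \<in> flip_labelling s k w ` {1..s}" using \<open>i \<in> {1..s}\<close> by blast
  qed (use k in \<open>auto simp: flip_labelling_def\<close>)
  then show "flip_labelling s k w \<in> based_labellings s k"
    using k w(2) assms(2) by (auto simp: based_labellings_def labellings_def flip_labelling_def)
  show "flip_labelling s k (flip_labelling s k w) = w"
  proof
    fix i show "flip_labelling s k (flip_labelling s k w) i = w i"
    proof (cases "i \<in> {1..s}")
      case True
      then show ?thesis using flip_vertex[OF w(3)[OF True]] by (simp add: flip_labelling_def)
    next
      case False
      then show ?thesis using extensional_arb[OF w(5) False] by (auto simp: flip_labelling_def)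
    qed
  qed
qed

lemma flip_edges_flip: "c \<in> extensional {..<k} \<Longrightarrow> flip_edges k (flip_edges k c) = c"
  by (auto simp: flip_edges_def fun_eq_iff extensional_def)

lemma cycle_graph_flip_iso:
  assumes "w \<in> based_labellings s k" "s \<ge> 1"
  shows "graph_iso s (cycle_graph k (flip_labelling s k w)) (cycle_graph k w) (\<lambda>j. (k - j) mod k) (\<lambda>j. k - 1 - j)"
proof -
  note w = based_labellingsD[OF assms(1)]
  have k: "k > 0" using w(3)[of 1] assms(2) by auto
  have 1: "bij_betw (\<lambda>j. (k - j) mod k) {..<k} {..<k}"
    by (rule bij_betw_byWitness[where f' = "\<lambda>j. (k - j) mod k"]) (use k flip_vertex in auto)
  have 2: "bij_betw (\<lambda>j. k - 1 - j) {..<k} {..<k}"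
    by (rule bij_betw_byWitness[where f' = "\<lambda>j. k - 1 - j"]) (use k in auto)
  have 3: "Upair (k - 1 - j) (Suc (k - 1 - j) mod k) = Upair ((k - j) mod k) ((k - (Suc j mod k)) mod k)"
    if "j < k" for j
    using that by (cases "Suc j = k") (auto simp: Suc_diff_Suc)
  have 4: "w i = (k - flip_labelling s k w i) mod k" if "i \<in> {1..s}" for i
    using flip_vertex[OF w(3)[OF that]] that by (simp add: flip_labelling_def)
  have 5: "ends (cycle_graph k w) (k - 1 - j) =
      map_uprod (\<lambda>j. (k - j) mod k) (ends (cycle_graph k (flip_labelling s k w)) j)" if "j < k" for j
  proof -
    have "ends (cycle_graph k w) (k - 1 - j) = Upair (k - 1 - j) (Suc (k - 1 - j) mod k)"
      using k by (intro cycle_graph_simps(4)) simp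
    then show ?thesis unfolding 3[OF that] using that by simp
  qed
  show ?thesis
    unfolding graph_iso_def cycle_graph_simps by (intro conjI ballI 1 2 4 5) simp_all
qed

lemma cmg_rel_flip:
  assumes w: "w \<in> based_labellings s k" "s \<ge> 1"
    and l: "l \<in> unit_metrics (cycle_graph k w)" and c: "c \<in> colorings m (cycle_graph k w)"
  defines "w' \<equiv> flip_labelling s k w"
  shows "flip_edges k l \<in> unit_metrics (cycle_graph k w')"
    and "flip_edges k c \<in> colorings m (cycle_graph k w')"
    and "((cycle_graph k w', flip_edges k l, flip_edges k c), (cycle_graph k w, l, c)) \<in> cmg_rel s m"
proof -
  have k: "k > 0" using based_labellingsD(3)[OF w(1), of 1] w(2) by auto
  have one: "one_loop s (cycle_graph k w)" "one_loop s (cycle_graph k w')"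
    using cycle_graph_one_loop[OF k] based_labellingsD(1) flip_labelling_based[OF w] w(1)
    unfolding w'_def by blast+
  show c': "flip_edges k c \<in> colorings m (cycle_graph k w')"
    using c k by (auto simp: flip_edges_def colorings_def PiE_iff)
  have "flip_edges k c e = c (k - 1 - e)" if "e \<in> edges (cycle_graph k w')" for e
    using that by (simp add: flip_edges_def)
  from cmg_rel_iso[OF cycle_graph_flip_iso[OF w, folded w'_def] one(2) c' one(1) l c this]
  show "flip_edges k l \<in> unit_metrics (cycle_graph k w')"
    "((cycle_graph k w', flip_edges k l, flip_edges k c), (cycle_graph k w, l, c)) \<in> cmg_rel s m"
    by (simp_all only: flip_edges_def cycle_graph_simps)
qed

text \<open>Positive lengths leave nothing to collapse, so the relation is an isomorphism of cycles;
  leg 1 makes it fix vertex 0, and rigidity leaves the identity and the reflection.\<close>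

lemma cmg_rel_positive:
  assumes rel: "((cycle_graph k w, l, c), (cycle_graph k' w', l', c')) \<in> cmg_rel s m" and s: "s \<ge> 1"
    and w: "w \<in> based_labellings s k" "w' \<in> based_labellings s k'"
    and l: "l \<in> unit_metrics (cycle_graph k w)" "l' \<in> unit_metrics (cycle_graph k' w')"
    and c: "c \<in> colorings m (cycle_graph k w)" "c' \<in> colorings m (cycle_graph k' w')"
    and pos: "\<And>j. j < k \<Longrightarrow> l j > 0" "\<And>j. j < k' \<Longrightarrow> l' j > 0"
  shows "k' = k \<and> (w' = w \<and> l' = l \<and> c' = c \<or>
    w' = flip_labelling s k w \<and> l' = flip_edges k l \<and> c' = flip_edges k c)"
proof -
  have k: "k > 0" "k' > 0" using based_labellingsD(3)[OF w(1), of 1] based_labellingsD(3)[OF w(2), of 1] s by auto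
  have graph: "is_graph s (cycle_graph k w)" "is_graph s (cycle_graph k' w')"
    using cycle_graph_one_loop[OF k(1)] cycle_graph_one_loop[OF k(2)] w
    by (auto intro!: one_loop.graph based_labellingsD(1))
  have Z: "zero_edges (cycle_graph k w) l = {}" "zero_edges (cycle_graph k' w') l' = {}"
    using pos by (force simp: zero_edges_def)+
  obtain f \<phi> where iso0: "graph_iso s (collapse (cycle_graph k w) (zero_edges (cycle_graph k w) l))
      (collapse (cycle_graph k' w') (zero_edges (cycle_graph k' w') l')) f \<phi>"
    and lc0: "\<And>e. e \<in> edges (cycle_graph k w) - zero_edges (cycle_graph k w) l \<Longrightarrow>
      l' (\<phi> e) = l e \<and> c' (\<phi> e) = c e"
    using cmg_relD[OF rel l] by blast
  note iso = iso0[unfolded Z]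
  have lc: "l' (\<phi> e) = l e \<and> c' (\<phi> e) = c e" if "e < k" for e
    using lc0[of e] that by (simp add: Z)
  obtain g where iso': "graph_iso s (cycle_graph k w) (cycle_graph k' w') g \<phi>"
    using graph_iso_of_trivial_collapse[OF graph iso] by blast
  have ext: "l \<in> extensional {..<k}" "l' \<in> extensional {..<k'}" "c \<in> extensional {..<k}" "c' \<in> extensional {..<k'}"
    using l c by (auto simp: unit_metrics_def colorings_def PiE_iff)
  have wext: "w \<in> extensional {1..s}" "w' \<in> extensional {1..s}"
    using based_labellingsD(5)[OF w(1)] based_labellingsD(5)[OF w(2)] .
  have w': "w' i = g (w i)" if "i \<in> {1..s}" for i using iso' that by (simp add: graph_iso_def)
  have kk: "k' = k" and
    cases: "(\<forall>j<k. g j = j \<and> \<phi> j = j) \<or> (\<forall>j<k. g j = (k - j) mod k \<and> \<phi> j = k - 1 - j)"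
    using cycle_graph_iso_rigid[OF iso' k(1) s] based_labellingsD(2)[OF w(1)] based_labellingsD(2)[OF w(2)]
    by auto
  from cases show ?thesis
  proof
    assume id: "\<forall>j<k. g j = j \<and> \<phi> j = j"
    have wg: "w' i = w i" if "i \<in> {1..s}" for i
      using w'[OF that] id based_labellingsD(3)[OF w(1) that] by simp
    have lc': "l' j = l j" "c' j = c j" if "j < k" for j
      using lc[OF that] id that by simp_all
    have "w' = w" by (rule extensionalityI[OF wext(2,1) wg])
    moreover have "l' = l"
      by (rule extensionalityI[OF ext(2)[unfolded kk] ext(1)]) (use lc' in simp)
    moreover have "c' = c"
      by (rule extensionalityI[OF ext(4)[unfolded kk] ext(3)]) (use lc' in simp)
    ultimately show ?thesis using kk by blast
  next
    assume fl: "\<forall>j<k. g j = (k - j) mod k \<and> \<phi> j = k - 1 - j"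
    have "w' i = (k - w i) mod k" if "i \<in> {1..s}" for i
      using w'[OF that] fl based_labellingsD(3)[OF w(1) that] by simp
    then have "w' = flip_labelling s k w"
      unfolding flip_labelling_def by (intro extensionalityI[OF wext(2)]) simp_all
    moreover have swap: "l' j = l (k - 1 - j)" "c' j = c (k - 1 - j)" if "j < k" for j
      using lc[of "k - 1 - j"] fl that k by simp_all
    have "l' = flip_edges k l"
      unfolding flip_edges_def by (rule extensionalityI[OF ext(2)[unfolded kk]]) (use swap(1) in simp_all)
    moreover have "c' = flip_edges k c"
      unfolding flip_edges_def by (rule extensionalityI[OF ext(4)[unfolded kk]]) (use swap(2) in simp_all)
    ultimately show ?thesis using kk by blast
  qed
qed

section \<open>Counting the cells\<close>

text \<open>Forgetting the value at \<open>a\<close> leaves a map onto \<open>B\<close> or onto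
  \<open>B - {b}\<close>, according to whether \<open>b\<close> has another preimage.\<close>

lemma card_surjections_value:
  assumes "finite A" "finite B" "a \<notin> A" "b \<in> B"
  shows "card {f \<in> insert a A \<rightarrow>\<^sub>E B. f ` insert a A = B \<and> f a = b} =
    card {f \<in> A \<rightarrow>\<^sub>E B. f ` A = B} + card {f \<in> A \<rightarrow>\<^sub>E (B - {b}). f ` A = B - {b}}"
proof -
  let ?S = "{f \<in> A \<rightarrow>\<^sub>E B. f ` A = B}" and ?T = "{f \<in> A \<rightarrow>\<^sub>E (B - {b}). f ` A = B - {b}}"
  have "bij_betw (\<lambda>g. g(a := b)) (?S \<union> ?T) {f \<in> insert a A \<rightarrow>\<^sub>E B. f ` insert a A = B \<and> f a = b}"
  proof (rule bij_betw_byWitness[where f' = "\<lambda>f. restrict f A"])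
    show "\<forall>g\<in>?S \<union> ?T. restrict (g(a := b)) A = g"
    proof
      fix g assume "g \<in> ?S \<union> ?T"
      then have "g \<in> extensional A" by (auto simp: PiE_iff)
      then show "restrict (g(a := b)) A = g"
        using assms(3) by (intro extensionalityI[of _ A]) auto
    qed
    show "\<forall>f\<in>{f \<in> insert a A \<rightarrow>\<^sub>E B. f ` insert a A = B \<and> f a = b}. (restrict f A)(a := b) = f"
    proof
      fix f assume f: "f \<in> {f \<in> insert a A \<rightarrow>\<^sub>E B. f ` insert a A = B \<and> f a = b}"
      then have "f \<in> extensional (insert a A)" by (auto simp: PiE_iff)
      then show "(restrict f A)(a := b) = f"
        using f by (intro extensionalityI[of _ "insert a A"]) (auto simp: extensional_def)
    qed
    show "(\<lambda>g. g(a := b)) ` (?S \<union> ?T) \<subseteq> {f \<in> insert a A \<rightarrow>\<^sub>E B. f ` insert a A = B \<and> f a = b}"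
    proof
      fix f assume "f \<in> (\<lambda>g. g(a := b)) ` (?S \<union> ?T)"
      then obtain g where g: "f = g(a := b)" "g \<in> A \<rightarrow>\<^sub>E B" "g ` A = B \<or> g ` A = B - {b}"
        by (auto simp: PiE_iff)
      have "f ` A = g ` A" using g(1) assms(3) by (auto simp: image_def)
      then have "f ` insert a A = B" using g assms(4) by auto
      moreover have "f \<in> insert a A \<rightarrow>\<^sub>E B"
        unfolding g(1) using g(2) assms(4) by (intro PiE_fun_upd) auto
      moreover have "f a = b" using g(1) by simp
      ultimately show "f \<in> {f \<in> insert a A \<rightarrow>\<^sub>E B. f ` insert a A = B \<and> f a = b}"
        by (intro CollectI conjI)
    qed
    show "(\<lambda>f. restrict f A) ` {f \<in> insert a A \<rightarrow>\<^sub>E B. f ` insert a A = B \<and> f a = b} \<subseteq> ?S \<union> ?T"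
    proof
      fix g assume "g \<in> (\<lambda>f. restrict f A) ` {f \<in> insert a A \<rightarrow>\<^sub>E B. f ` insert a A = B \<and> f a = b}"
      then obtain f where f: "g = restrict f A" "f ` insert a A = B" "f a = b" "f \<in> insert a A \<rightarrow>\<^sub>E B"
        by blast
      have im: "g ` A = f ` A" using f(1) by simp
      have "insert b (f ` A) = B" using f(2,3) by auto
      then have g: "g ` A = B \<or> g ` A = B - {b}"
        unfolding im by (cases "b \<in> f ` A") auto
      have gA: "g \<in> A \<rightarrow>\<^sub>E g ` A" using f(1) by (auto simp: PiE_iff)
      from g show "g \<in> ?S \<union> ?T"
      proof
        assume "g ` A = B"
        then show ?thesis using gA by (intro UnI1 CollectI conjI) simp_all
      next
        assume "g ` A = B - {b}"
        then show ?thesis using gA by (intro UnI2 CollectI conjI) simp_all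
      qed
    qed
  qed
  then have "card {f \<in> insert a A \<rightarrow>\<^sub>E B. f ` insert a A = B \<and> f a = b} = card (?S \<union> ?T)"
    by (rule bij_betw_same_card[symmetric])
  also have "\<dots> = card ?S + card ?T"
  proof (rule card_Un_disjoint)
    show "finite ?S" "finite ?T" using assms by (auto intro!: finite_PiE finite_subset[OF Collect_subset])
    show "?S \<inter> ?T = {}" using assms(4) by auto
  qed
  finally show ?thesis .
qed

lemma card_surjections:
  assumes "finite A" "finite B"
  shows "card {f \<in> A \<rightarrow>\<^sub>E B. f ` A = B} = Stirling (card A) (card B) * fact (card B)"
  using assms
proof (induction A arbitrary: B rule: finite_induct)
  case empty
  show ?case
  proof (cases "card B")
    case 0
    then have "B = {}" using empty by simp
    then show ?thesis by simp
  next
    case (Suc n)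
    then have "B \<noteq> {}" by auto
    then show ?thesis using Suc by simp
  qed
next
  case (insert a A)
  show ?case
  proof (cases "card B")
    case 0
    then have "B = {}" using insert.prems by simp
    then show ?thesis using insert.hyps by simp
  next
    case (Suc n)
    let ?F = "\<lambda>b. {f \<in> insert a A \<rightarrow>\<^sub>E B. f ` insert a A = B \<and> f a = b}"
    have "{f \<in> insert a A \<rightarrow>\<^sub>E B. f ` insert a A = B} = (\<Union>b\<in>B. ?F b)" by auto
    then have "card {f \<in> insert a A \<rightarrow>\<^sub>E B. f ` insert a A = B} = card (\<Union>b\<in>B. ?F b)" by simp
    also have "\<dots> = (\<Sum>b\<in>B. card (?F b))"
      using insert by (intro card_UN_disjoint) (auto intro!: finite_PiE finite_subset[OF Collect_subset])
    also have "\<dots> = (\<Sum>b\<in>B. Stirling (card A) (Suc n) * fact (Suc n) + Stirling (card A) n * fact n)"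
    proof (rule sum.cong[OF refl])
      fix b assume b: "b \<in> B"
      show "card (?F b) = Stirling (card A) (Suc n) * fact (Suc n) + Stirling (card A) n * fact n"
        using card_surjections_value[OF insert.hyps(1) insert.prems insert.hyps(2) b]
          insert.IH[OF insert.prems] insert.IH[of "B - {b}"] insert.prems b Suc by simp
    qed
    \<comment> \<open>The factor counts the possible values at \<open>a\<close>; it turns the two
      terms into the Stirling recursion times \<open>fact (Suc n)\<close>.\<close>
    also have "\<dots> = Suc n * (Stirling (card A) (Suc n) * fact (Suc n) + Stirling (card A) n * fact n)"
      using Suc by simp
    also have "\<dots> = Stirling (card (insert a A)) (card B) * fact (card B)"
      using Suc insert.hyps by (simp add: algebra_simps)
    finally show ?thesis .
  qed
qed

text \<open>Prescribing the label of leg 1 selects one \<open>k\<close>-th of all surjections. In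
  the count, the two terms of the Stirling recursion appear with the common factor
  \<open>fact (k - 1)\<close>.\<close>

lemma card_based_labellings:
  assumes "s \<ge> 1" "k \<ge> 1"
  shows "card (based_labellings s k) = Stirling s k * fact (k - 1)"
proof -
  obtain s' k' where s': "s = Suc s'" and k': "k = Suc k'" using assms by (metis One_nat_def Suc_le_D)
  have ins: "insert 1 {2..s} = {1..s}" using assms(1) by auto
  have "based_labellings s k = {f \<in> insert 1 {2..s} \<rightarrow>\<^sub>E {..<k}. f ` insert 1 {2..s} = {..<k} \<and> f 1 = 0}"
    unfolding ins based_labellings_def labellings_def by auto
  then have "card (based_labellings s k) =
      card {f \<in> {2..s} \<rightarrow>\<^sub>E {..<k}. f ` {2..s} = {..<k}} +
      card {f \<in> {2..s} \<rightarrow>\<^sub>E ({..<k} - {0}). f ` {2..s} = {..<k} - {0}}"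
    using card_surjections_value[of "{2..s}" "{..<k}" 1 0] assms by simp
  also have "\<dots> = Stirling s' k * fact k + Stirling s' k' * fact k'"
    using card_surjections[of "{2..s}" "{..<k}"] card_surjections[of "{2..s}" "{..<k} - {0}"] s' k' by simp
  also have "\<dots> = Stirling s k * fact (k - 1)"
    using s' k' by (simp add: algebra_simps)
  finally show ?thesis .
qed

text \<open>An arbitrary injective numbering selects the smaller element of each two-element orbit;
  the strict inequality never selects a fixed point.\<close>

lemma involution_fundamental_domain:
  assumes P: "finite P" and \<sigma>: "\<And>p. p \<in> P \<Longrightarrow> \<sigma> p \<in> P" "\<And>p. p \<in> P \<Longrightarrow> \<sigma> (\<sigma> p) = p"
  obtains R where "R \<subseteq> P" "\<And>p. p \<in> P \<Longrightarrow> \<sigma> p \<noteq> p \<Longrightarrow> p \<in> R \<longleftrightarrow> \<sigma> p \<notin> R"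
    "\<And>p. p \<in> R \<Longrightarrow> \<sigma> p \<noteq> p" "card P = 2 * card R + card {p \<in> P. \<sigma> p = p}"
proof -
  obtain g :: "'a \<Rightarrow> nat" where g: "inj_on g P"
    using finite_imp_inj_to_nat_seg[OF P] by blast
  define R where "R = {p \<in> P. g p < g (\<sigma> p)}"
  have R: "p \<in> R \<longleftrightarrow> \<sigma> p \<notin> R" if "p \<in> P" "\<sigma> p \<noteq> p" for p
  proof -
    have "g (\<sigma> p) \<noteq> g p" using g that \<sigma>(1) by (auto dest: inj_onD)
    then show ?thesis using that \<sigma> by (auto simp: R_def)
  qed
  have R': "\<sigma> p \<noteq> p" if "p \<in> R" for p using that by (auto simp: R_def)
  have RP: "R \<subseteq> P" by (auto simp: R_def)
  have fin: "finite R" "finite (\<sigma> ` R)" "finite {p \<in> P. \<sigma> p = p}" using P RP finite_subset by auto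
  have split: "P = (R \<union> \<sigma> ` R) \<union> {p \<in> P. \<sigma> p = p}"
  proof (intro equalityI subsetI)
    fix p assume p: "p \<in> P"
    show "p \<in> (R \<union> \<sigma> ` R) \<union> {p \<in> P. \<sigma> p = p}"
    proof (cases "\<sigma> p = p \<or> p \<in> R")
      case False
      then have "\<sigma> p \<in> R" using R[OF p] by blast
      then have "\<sigma> (\<sigma> p) \<in> \<sigma> ` R" by (rule imageI)
      then show ?thesis using \<sigma>(2)[OF p] by simp
    qed (use p in auto)
  qed (use RP \<sigma>(1) in auto)
  have inj: "inj_on \<sigma> R" using RP \<sigma>(2) by (intro inj_onI) (metis subsetD)
  have d1: "R \<inter> \<sigma> ` R = {}" using R R' RP by blast
  have d2: "(R \<union> \<sigma> ` R) \<inter> {p \<in> P. \<sigma> p = p} = {}"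
  proof -
    have "\<sigma> (\<sigma> p) \<noteq> \<sigma> p" if "p \<in> R" for p using R'[OF that] \<sigma>(2) RP that by (metis subsetD)
    then show ?thesis using R' by blast
  qed
  have "card P = card (R \<union> \<sigma> ` R) + card {p \<in> P. \<sigma> p = p}"
    using card_Un_disjoint[OF _ fin(3) d2] fin split by simp
  also have "card (R \<union> \<sigma> ` R) = 2 * card R"
    using card_Un_disjoint[OF fin(1,2) d1] card_image[OF inj] by simp
  finally show ?thesis using that RP R R' by blast
qed

section \<open>Colored words and their reflection\<close>

definition words :: "nat \<Rightarrow> nat \<Rightarrow> nat \<Rightarrow> ((nat \<Rightarrow> nat) \<times> (nat \<Rightarrow> nat)) set" where
  "words s m k = based_labellings s k \<times> ({..<k} \<rightarrow>\<^sub>E {1..m})"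

definition flip :: "nat \<Rightarrow> nat \<Rightarrow> (nat \<Rightarrow> nat) \<times> (nat \<Rightarrow> nat) \<Rightarrow> (nat \<Rightarrow> nat) \<times> (nat \<Rightarrow> nat)" where
  "flip s k = (\<lambda>(w, c). (flip_labelling s k w, flip_edges k c))"

lemma finite_words: "finite (words s m k)"
  unfolding words_def based_labellings_def labellings_def
  by (intro finite_cartesian_product finite_PiE) (auto intro!: finite_PiE finite_subset[OF Collect_subset])

lemma card_words:
  assumes "s \<ge> 1" "k \<ge> 1"
  shows "card (words s m k) = Stirling s k * fact (k - 1) * m ^ k"
  using card_based_labellings[OF assms] by (simp add: words_def card_cartesian_product card_PiE)

lemma flip_words:
  assumes "s \<ge> 1" "p \<in> words s m k"
  shows "flip s k p \<in> words s m k" "flip s k (flip s k p) = p"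
proof -
  obtain w c where p: "p = (w, c)" "w \<in> based_labellings s k" "c \<in> {..<k} \<rightarrow>\<^sub>E {1..m}"
    using assms(2) by (auto simp: words_def)
  have "flip_edges k c \<in> {..<k} \<rightarrow>\<^sub>E {1..m}"
    unfolding flip_edges_def using p(3) by (intro restrict_PiE_iff[THEN iffD2] ballI PiE_mem[OF p(3)]) auto
  then show "flip s k p \<in> words s m k"
    using flip_labelling_based(1)[OF p(2) assms(1)] by (simp add: flip_def words_def p(1))
  have "c \<in> extensional {..<k}" using p(3) by (simp add: PiE_iff)
  then show "flip s k (flip s k p) = p"
    using flip_labelling_based(2)[OF p(2) assms(1)] flip_edges_flip by (simp add: flip_def p(1))
qed

text \<open>Surjectivity provides a leg at vertex 1, which the reflection moves to vertex
  \<open>k - 1\<close>. Freeness is thus visible on the labelling, whatever the coloring.\<close>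

lemma flip_words_ge3:
  assumes "p \<in> words s m k" "k \<ge> 3"
  shows "flip s k p \<noteq> p"
proof
  assume eq: "flip s k p = p"
  obtain w c where p: "p = (w, c)" "w \<in> based_labellings s k" using assms(1) by (auto simp: words_def)
  obtain i where i: "i \<in> {1..s}" "w i = 1" using based_labellingsD(4)[OF p(2), of 1] assms(2) by auto
  have "flip_labelling s k w i = w i" using eq by (simp add: flip_def p(1))
  then have "(k - 1) mod k = 1" using i by (simp add: flip_labelling_def)
  then show False using assms(2) by simp
qed

lemma flip_labelling_le2:
  assumes w: "w \<in> based_labellings s k" and k: "k \<le> 2"
  shows "flip_labelling s k w = w"
proof (rule extensionalityI[of _ "{1..s}"])
  fix i assume i: "i \<in> {1..s}"
  have "w i < k" using based_labellingsD(3)[OF w i] .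
  then have "(k - w i) mod k = w i" using k by (cases "w i = 0") auto
  then show "flip_labelling s k w i = w i" using i by (simp add: flip_labelling_def)
qed (use based_labellingsD(5)[OF w] in \<open>simp_all add: flip_labelling_def\<close>)

lemma flip_words_1: "p \<in> words s m 1 \<Longrightarrow> flip s 1 p = p"
  using flip_labelling_le2[of _ s 1]
  by (auto simp: words_def flip_def flip_edges_def fun_eq_iff PiE_iff extensional_def)

text \<open>With two vertices the reflection moves no label and merely exchanges the parallel edges,
  so only their colors can detect it.\<close>

lemma flip_words_2_iff:
  assumes "(w, c) \<in> words s m 2"
  shows "flip s 2 (w, c) = (w, c) \<longleftrightarrow> c 0 = c 1"
proof -
  have w: "w \<in> based_labellings s 2" and c: "c \<in> extensional {..<2}"
    using assms by (auto simp: words_def PiE_iff)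
  have "flip_edges 2 c = c \<longleftrightarrow> c 0 = c 1"
  proof
    assume "flip_edges 2 c = c"
    then have "flip_edges 2 c 0 = c 0" by simp
    then show "c 0 = c 1" by (simp add: flip_edges_def)
  next
    assume eq: "c 0 = c 1"
    show "flip_edges 2 c = c"
    proof (rule extensionalityI[OF _ c])
      fix j :: nat assume "j \<in> {..<2}"
      then have "j = 0 \<or> j = 1" by auto
      then show "flip_edges 2 c j = c j" using eq by (auto simp: flip_edges_def)
    qed (simp add: flip_edges_def)
  qed
  then show ?thesis using flip_labelling_le2[OF w] by (simp add: flip_def)
qed

lemma card_flip_fixed_2:
  assumes "s \<ge> 1"
  shows "card {p \<in> words s m 2. flip s 2 p = p} = Stirling s 2 * m"
proof -
  have prod: "{p \<in> words s m 2. flip s 2 p = p} =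
      based_labellings s 2 \<times> {c \<in> {..<2} \<rightarrow>\<^sub>E {1..m}. c 0 = c (1::nat)}"
    using flip_words_2_iff[of _ _ s m] by (auto simp: words_def)
  have bij: "bij_betw (\<lambda>a. \<lambda>j\<in>{..<2::nat}. a) {1..m} {c \<in> {..<2} \<rightarrow>\<^sub>E {1..m}. c 0 = c (1::nat)}"
  proof (rule bij_betw_byWitness[where f' = "\<lambda>c. c 0"])
    show "\<forall>c\<in>{c \<in> {..<2} \<rightarrow>\<^sub>E {1..m}. c 0 = c (1::nat)}. (\<lambda>j\<in>{..<2}. c 0) = c"
    proof
      fix c assume c: "c \<in> {c \<in> {..<2} \<rightarrow>\<^sub>E {1..m}. c 0 = c (1::nat)}"
      then have ext: "c \<in> extensional {..<2}" and eq: "c 0 = c 1" by (simp_all add: PiE_iff)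
      show "(\<lambda>j\<in>{..<2}. c 0) = c"
      proof (rule extensionalityI[OF _ ext])
        fix j :: nat assume j: "j \<in> {..<2}"
        then have "j = 0 \<or> j = 1" by auto
        then have "c 0 = c j" using eq by metis
        then show "(\<lambda>j\<in>{..<2}. c 0) j = c j" using j by simp
      qed simp
    qed
    show "(\<lambda>c. c 0) ` {c \<in> {..<2} \<rightarrow>\<^sub>E {1..m}. c 0 = c (1::nat)} \<subseteq> {1..m}"
      by (rule image_subsetI) (simp add: PiE_iff)
    show "(\<lambda>a. \<lambda>j\<in>{..<2::nat}. a) ` {1..m} \<subseteq> {c \<in> {..<2} \<rightarrow>\<^sub>E {1..m}. c 0 = c (1::nat)}"
      by (rule image_subsetI) (simp add: PiE_iff)
  qed simp
  have "card {c \<in> {..<2} \<rightarrow>\<^sub>E {1..m}. c 0 = c (1::nat)} = m"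
    using bij_betw_same_card[OF bij] card_atLeastAtMost[of 1 m] by linarith
  then show ?thesis
    unfolding prod card_cartesian_product using card_based_labellings[OF assms, of 2] by simp
qed

section \<open>The cell structure of the moduli space\<close>

text \<open>Points of the standard simplex are zero beyond \<open>k - 1\<close>, whereas metrics are
  extensional; \<open>restrict\<close> translates between the two conventions.\<close>

definition cell_map :: "nat \<Rightarrow> nat \<Rightarrow> nat \<Rightarrow> (nat \<Rightarrow> nat) \<times> (nat \<Rightarrow> nat) \<Rightarrow> (nat \<Rightarrow> real) \<Rightarrow>
    colored_metric_graph set" where
  "cell_map s m k p x = cmg_rel s m `` {(cycle_graph k (fst p), restrict x {..<k}, snd p)}"

text \<open>The counterpart of \<open>flip_edges\<close> in simplex coordinates, with zero instead
  of an undefined value outside.\<close>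

definition reverse :: "nat \<Rightarrow> (nat \<Rightarrow> real) \<Rightarrow> nat \<Rightarrow> real" where
  "reverse k x i = (if i < k then x (k - 1 - i) else 0)"

lemma atMost_pred: "k \<ge> 1 \<Longrightarrow> {..k - Suc 0} = {..<k}"
  by auto

lemma standard_simplex_pred_iff:
  "k \<ge> 1 \<Longrightarrow> x \<in> standard_simplex (k - Suc 0) \<longleftrightarrow>
     (\<forall>i<k. 0 \<le> x i) \<and> (\<forall>i\<ge>k. x i = 0) \<and> (\<Sum>i<k. x i) = 1"
  using atMost_pred[of k] unfolding standard_simplex_iff by auto

lemma simplex_interior_pred_iff:
  "k \<ge> 1 \<Longrightarrow> x \<in> simplex_interior (k - Suc 0) \<longleftrightarrow>
     (\<forall>i<k. 0 < x i) \<and> (\<forall>i\<ge>k. x i = 0) \<and> (\<Sum>i<k. x i) = 1"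
  using atMost_pred[of k] unfolding simplex_interior_iff by auto

lemma restrict_unit_metrics:
  assumes "k \<ge> 1" "x \<in> standard_simplex (k - 1)"
  shows "restrict x {..<k} \<in> unit_metrics (cycle_graph k w)"
proof -
  have "restrict x {..<k} \<in> {..<k} \<rightarrow>\<^sub>E {0..}"
    using assms by (intro restrict_PiE_iff[THEN iffD2]) (auto simp: standard_simplex_pred_iff)
  moreover have "(\<Sum>j<k. restrict x {..<k} j) = 1"
    using assms by (simp add: standard_simplex_pred_iff)
  ultimately show ?thesis
    by (simp only: unit_metrics_def cycle_graph_simps mem_Collect_eq simp_thms)
qed

lemma unit_metrics_restrict:
  assumes "k \<ge> 1" "l \<in> unit_metrics (cycle_graph k w)"
  obtains x where "x \<in> standard_simplex (k - 1)" "l = restrict x {..<k}"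
proof -
  define x where "x i = (if i < k then l i else 0)" for i
  have "(\<Sum>i<k. x i) = (\<Sum>i<k. l i)" by (intro sum.cong) (auto simp: x_def)
  then have "x \<in> standard_simplex (k - 1)"
    using assms unit_metrics_nonneg[OF assms(2)]
    by (simp add: standard_simplex_pred_iff) (simp add: unit_metrics_def x_def)
  moreover have "l = restrict x {..<k}"
    using subsetD[OF unit_metrics_extensional assms(2)]
    by (intro extensionalityI[of _ "{..<k}"]) (simp_all add: x_def)
  ultimately show ?thesis by (rule that)
qed

locale moduli =
  fixes s m :: nat
  assumes s: "s \<ge> 1"
begin

lemma words_graph:
  assumes "p \<in> words s m k"
  shows "k \<ge> 1" "fst p \<in> based_labellings s k" "snd p \<in> colorings m (cycle_graph k w)"
    "one_loop s (cycle_graph k (fst p))"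
proof -
  show w: "fst p \<in> based_labellings s k" and "snd p \<in> colorings m (cycle_graph k w)"
    using assms unfolding words_def colorings_def cycle_graph_simps mem_Times_iff by simp_all
  show k: "k \<ge> 1" using based_labellingsD(3)[OF w, of 1] s by simp
  show "one_loop s (cycle_graph k (fst p))"
    using k by (intro cycle_graph_one_loop based_labellingsD(1)[OF w]) simp
qed

lemma cell_point:
  assumes "p \<in> words s m k" "x \<in> standard_simplex (k - 1)"
  shows "(cycle_graph k (fst p), restrict x {..<k}, snd p) \<in> colored_metric_graphs s m"
  using words_graph[OF assms(1)] restrict_unit_metrics assms(2) by (intro colored_metric_graphsI) blast+

lemma cell_map_eq_iff:
  assumes "p \<in> words s m k" "x \<in> standard_simplex (k - 1)" "q \<in> words s m n" "y \<in> standard_simplex (n - 1)"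
  shows "cell_map s m k p x = cell_map s m n q y \<longleftrightarrow>
    ((cycle_graph k (fst p), restrict x {..<k}, snd p), (cycle_graph n (fst q), restrict y {..<n}, snd q)) \<in> cmg_rel s m"
  unfolding cell_map_def
  by (rule eq_equiv_class_iff[OF cmg_rel_equiv cell_point[OF assms(1,2)] cell_point[OF assms(3,4)]])

lemma cell_map_interior_eq:
  assumes p: "p \<in> words s m k" and x: "x \<in> simplex_interior (k - 1)"
    and q: "q \<in> words s m n" and y: "y \<in> simplex_interior (n - 1)"
    and eq: "cell_map s m k p x = cell_map s m n q y"
  shows "n = k \<and> (q = p \<and> y = x \<or> q = flip s k p \<and> y = reverse k x)"
proof -
  have k: "k \<ge> 1" "n \<ge> 1" using words_graph(1)[OF p] words_graph(1)[OF q] .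
  have xs: "x \<in> standard_simplex (k - 1)" "y \<in> standard_simplex (n - 1)"
    using x y simplex_interior_subset by blast+
  have rel: "((cycle_graph k (fst p), restrict x {..<k}, snd p), (cycle_graph n (fst q), restrict y {..<n}, snd q)) \<in> cmg_rel s m"
    using cell_map_eq_iff[OF p xs(1) q xs(2)] eq by blast
  have pos: "0 < restrict x {..<k} j" if "j < k" for j using x that k by (simp add: simplex_interior_pred_iff)
  have pos': "0 < restrict y {..<n} j" if "j < n" for j using y that k by (simp add: simplex_interior_pred_iff)
  have *: "n = k \<and> (fst q = fst p \<and> restrict y {..<n} = restrict x {..<k} \<and> snd q = snd p \<or>
      fst q = flip_labelling s k (fst p) \<and> restrict y {..<n} = flip_edges k (restrict x {..<k}) \<and> snd q = flip_edges k (snd p))"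
    by (rule cmg_rel_positive[OF rel s words_graph(2)[OF p] words_graph(2)[OF q]
          restrict_unit_metrics[OF k(1) xs(1)] restrict_unit_metrics[OF k(2) xs(2)]
          words_graph(3)[OF p] words_graph(3)[OF q] pos pos'])
  then have nk: "n = k" ..
  have x0: "x i = 0" "y i = 0" if "i \<ge> k" for i
    using x y that k nk by (simp_all add: simplex_interior_pred_iff)
  have 1: "y = x" if "restrict y {..<n} = restrict x {..<k}"
  proof
    fix i show "y i = x i"
      using fun_cong[OF that, of i] x0[of i] nk by (cases "i < k") simp_all
  qed
  have 2: "y = reverse k x" if "restrict y {..<n} = flip_edges k (restrict x {..<k})"
  proof
    fix i show "y i = reverse k x i"
      using fun_cong[OF that, of i] x0[of i] nk by (cases "i < k") (simp_all add: flip_edges_def reverse_def)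
  qed
  from * show ?thesis
    using 1 2 by (auto simp: flip_def prod_eq_iff case_prod_beta)
qed

lemma cell_map_flip:
  assumes p: "p \<in> words s m k" and x: "x \<in> standard_simplex (k - 1)"
  shows "cell_map s m k (flip s k p) (reverse k x) = cell_map s m k p x"
    and "reverse k x \<in> standard_simplex (k - 1)"
proof -
  have k: "k \<ge> 1" by (rule words_graph(1)[OF p])
  have "bij_betw (\<lambda>i. k - 1 - i) {..<k} {..<k}"
    by (rule bij_betw_byWitness[where f' = "\<lambda>i. k - 1 - i"]) (use k in auto)
  then have "(\<Sum>i<k. x (k - 1 - i)) = (\<Sum>i<k. x i)" by (rule sum.reindex_bij_betw)
  moreover have "(\<Sum>i<k. reverse k x i) = (\<Sum>i<k. x (k - 1 - i))"
    by (intro sum.cong) (auto simp: reverse_def)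
  ultimately show r: "reverse k x \<in> standard_simplex (k - 1)"
    using x k by (simp add: standard_simplex_pred_iff) (simp add: reverse_def)
  have "restrict (reverse k x) {..<k} = flip_edges k (restrict x {..<k})"
    by (auto simp: reverse_def flip_edges_def fun_eq_iff)
  moreover have "((cycle_graph k (flip_labelling s k (fst p)), flip_edges k (restrict x {..<k}), flip_edges k (snd p)),
      (cycle_graph k (fst p), restrict x {..<k}, snd p)) \<in> cmg_rel s m"
    by (rule cmg_rel_flip(3)[OF words_graph(2)[OF p] s restrict_unit_metrics[OF k x] words_graph(3)[OF p]])
  ultimately show "cell_map s m k (flip s k p) (reverse k x) = cell_map s m k p x"
    using cell_map_eq_iff[OF flip_words(1)[OF s p] r p x] by (simp add: flip_def case_prod_beta)
qed

text \<open>Related points have collapsed graphs with equally many edges, so the number of nonzero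
  lengths is an invariant. It bounds the dimension of the cell in which a boundary point
  lands.\<close>

lemma cell_map_support:
  assumes p: "p \<in> words s m k" and x: "x \<in> standard_simplex (k - 1)"
    and q: "q \<in> words s m n" and y: "y \<in> simplex_interior (n - 1)"
    and eq: "cell_map s m k p x = cell_map s m n q y"
  shows "card {j. j < k \<and> x j \<noteq> 0} = n"
proof -
  have k: "k \<ge> 1" "n \<ge> 1" using words_graph(1)[OF p] words_graph(1)[OF q] .
  have ys: "y \<in> standard_simplex (n - 1)" using y simplex_interior_subset by blast
  have rel: "((cycle_graph k (fst p), restrict x {..<k}, snd p),
      (cycle_graph n (fst q), restrict y {..<n}, snd q)) \<in> cmg_rel s m"
    using cell_map_eq_iff[OF p x q ys] eq by (rule iffD1)
  have Z: "edges (cycle_graph k (fst p)) - zero_edges (cycle_graph k (fst p)) (restrict x {..<k}) = {j. j < k \<and> x j \<noteq> 0}"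
    by (auto simp: zero_edges_def)
  have Z': "edges (cycle_graph n (fst q)) - zero_edges (cycle_graph n (fst q)) (restrict y {..<n}) = {..<n}"
    using y k by (auto simp: zero_edges_def simplex_interior_pred_iff)
  obtain \<phi> where "bij_betw \<phi> (edges (cycle_graph k (fst p)) - zero_edges (cycle_graph k (fst p)) (restrict x {..<k}))
      (edges (cycle_graph n (fst q)) - zero_edges (cycle_graph n (fst q)) (restrict y {..<n}))"
    by (rule cmg_relD[OF rel restrict_unit_metrics[OF k(1) x] restrict_unit_metrics[OF k(2) ys]])
  from bij_betw_same_card[OF this] show ?thesis unfolding Z Z' by simp
qed

lemma MCG1_points:
  assumes "z \<in> topspace (MCG1 s m)"
  obtains k p x where "p \<in> words s m k" "x \<in> simplex_interior (k - 1)" "z = cell_map s m k p x"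
proof -
  obtain G c l where G: "one_loop s G" "c \<in> colorings m G" and l: "l \<in> topspace (metric_simplex G)"
    and z: "z = cmg_rel s m `` {(G, l, c)}"
    using assms by (auto simp: MCG1_def colored_simplices_def one_loop_graphs_iff)
  have l': "l \<in> unit_metrics G" using l one_loop.topspace_metric_simplex[OF G(1)] by simp
  obtain k w l0 c0 where k: "k > 0" and w: "w \<in> based_labellings s k" and l0: "l0 \<in> unit_metrics (cycle_graph k w)"
    and c0: "c0 \<in> colorings m (cycle_graph k w)" and pos: "\<And>j. j < k \<Longrightarrow> l0 j > 0"
    and rel: "((G, l, c), (cycle_graph k w, l0, c0)) \<in> cmg_rel s m"
    using exists_cyclic_representative[OF G(1) l' G(2) s] by blast
  have k1: "k \<ge> 1" using k by simp
  obtain x where x: "x \<in> standard_simplex (k - 1)" "l0 = restrict x {..<k}"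
    using unit_metrics_restrict[OF k1 l0] by blast
  have "(w, c0) \<in> words s m k" using w c0 by (simp add: words_def colorings_def)
  moreover have "0 < x j" if "j < k" for j using pos[OF that] that by (simp add: x(2))
  then have "x \<in> simplex_interior (k - 1)"
    using x(1) k1 by (simp add: standard_simplex_pred_iff simplex_interior_pred_iff)
  moreover have "z = cell_map s m k (w, c0) x"
    unfolding z cell_map_def using equiv_class_eq[OF cmg_rel_equiv rel] x(2) by simp
  ultimately show ?thesis by (rule that)
qed

lemma continuous_restrict:
  assumes p: "p \<in> words s m k"
  shows "continuous_map (simplex_space (k - 1)) (metric_simplex (cycle_graph k (fst p))) (\<lambda>x. restrict x {..<k})"
proof -
  have k: "k \<ge> 1" by (rule words_graph(1)[OF p])
  show ?thesis
    unfolding one_loop.metric_simplex_eq[OF words_graph(4)[OF p]] continuous_map_in_subtopology cycle_graph_simps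
  proof
    show "continuous_map (simplex_space (k - 1)) (powertop_real {..<k}) (\<lambda>x. restrict x {..<k})"
      unfolding continuous_map_componentwise
      by (intro conjI ballI) (auto simp: continuous_map_coordinate)
    show "(\<lambda>x. restrict x {..<k}) \<in> topspace (simplex_space (k - 1)) \<rightarrow> unit_metrics (cycle_graph k (fst p))"
      using restrict_unit_metrics[OF k] by auto
  qed
qed

lemma quotient_map_MCG1:
  "quotient_map (colored_simplices s m) (MCG1 s m) (\<lambda>((G, c), l). cmg_rel s m `` {(G, l, c)})"
  unfolding MCG1_def by (rule quotient_map_quotient_topology)

lemma continuous_cell_map:
  assumes p: "p \<in> words s m k"
  shows "continuous_map (simplex_space (k - 1)) (MCG1 s m) (cell_map s m k p)"
proof -
  let ?i = "(cycle_graph k (fst p), snd p)"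
  have "?i \<in> (SIGMA G : one_loop_graphs s. colorings m G)"
    using words_graph(3,4)[OF p] by (simp add: one_loop_graphs_iff)
  then have "continuous_map (metric_simplex (cycle_graph k (fst p))) (colored_simplices s m) (\<lambda>l. (?i, l))"
    unfolding colored_simplices_def
    using continuous_map_component_injection[of ?i _ "\<lambda>(G, c). metric_simplex G"] by simp
  from continuous_map_compose[OF continuous_map_compose[OF continuous_restrict[OF p] this]
      quotient_imp_continuous_map[OF quotient_map_MCG1]]
  show ?thesis by (simp add: o_def cell_map_def[abs_def])
qed

text \<open>In the quotient a set is closed once its preimage in each simplex of the disjoint union
  is. That preimage consists of the metrics related to the given closed set, so each simplex is
  settled by \<open>closedin_related_unit_metrics\<close>, however many there are.\<close>

lemma closed_cell_map:
  assumes p: "p \<in> words s m k"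
  shows "closed_map (simplex_space (k - 1)) (MCG1 s m) (cell_map s m k p)"
  unfolding closed_map_def
proof (intro allI impI)
  fix K assume K: "closedin (simplex_space (k - 1)) K"
  let ?C = "cycle_graph k (fst p)"
  have k: "k \<ge> 1" by (rule words_graph(1)[OF p])
  have Ks: "K \<subseteq> standard_simplex (k - 1)" using closedin_subset[OF K] by simp
  define K' where "K' = (\<lambda>x. restrict x {..<k}) ` K"
  \<comment> \<open>Both sides are concrete: a compact source and a Hausdorff target. Nothing of the
    kind is assumed about the moduli space.\<close>
  have "closed_map (simplex_space (k - 1)) (metric_simplex ?C) (\<lambda>x. restrict x {..<k})"
  proof (rule T1_Spaces.continuous_imp_closed_map[OF continuous_restrict[OF p]])
    show "compact_space (simplex_space (k - 1))"
      using compactin_standard_simplex by (simp add: compact_space_subtopology)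
    show "Hausdorff_space (metric_simplex ?C)"
      unfolding one_loop.metric_simplex_eq[OF words_graph(4)[OF p]]
      by (intro Hausdorff_space_subtopology) (simp add: Hausdorff_space_product_topology)
  qed
  then have K'c: "closedin (metric_simplex ?C) K'" using K unfolding closed_map_def K'_def by blast
  have K'u: "K' \<subseteq> unit_metrics ?C" using Ks restrict_unit_metrics[OF k] by (auto simp: K'_def)
  let ?\<pi> = "\<lambda>((G, c), l). cmg_rel s m `` {(G, l, c)}"
  let ?U = "cell_map s m k p ` K"
  have "closedin (colored_simplices s m) {z \<in> topspace (colored_simplices s m). ?\<pi> z \<in> ?U}"
    unfolding colored_simplices_def closedin_sum_topology
  proof (intro conjI ballI)
    fix i assume "i \<in> (SIGMA G : one_loop_graphs s. colorings m G)"
    then obtain G c where i: "i = (G, c)" and G: "one_loop s G" "c \<in> colorings m G"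
      by (auto simp: one_loop_graphs_iff)
    have "cmg_rel s m `` {(G, l, c)} = cmg_rel s m `` {(?C, x, snd p)} \<longleftrightarrow> ((G, l, c), (?C, x, snd p)) \<in> cmg_rel s m"
      if "l \<in> unit_metrics G" "x \<in> K'" for l x
      using that K'u by (intro eq_equiv_class_iff[OF cmg_rel_equiv] colored_metric_graphsI G words_graph(3,4)[OF p]) auto
    then have "{l \<in> unit_metrics G. cmg_rel s m `` {(G, l, c)} \<in> ?U} =
        {l \<in> unit_metrics G. \<exists>x\<in>K'. ((G, l, c), (?C, x, snd p)) \<in> cmg_rel s m}"
      by (auto simp: K'_def cell_map_def image_iff)
    moreover have "{x. (i, x) \<in> {z \<in> topspace (sum_topology (\<lambda>(G, c). metric_simplex G)
        (SIGMA G : one_loop_graphs s. colorings m G)). ?\<pi> z \<in> ?U}} =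
        {l \<in> unit_metrics G. cmg_rel s m `` {(G, l, c)} \<in> ?U}"
      using G by (auto simp: i one_loop_graphs_iff one_loop.topspace_metric_simplex[OF G(1)])
    moreover have "closedin (metric_simplex G) {l \<in> unit_metrics G. \<exists>x\<in>K'. ((G, l, c), (?C, x, snd p)) \<in> cmg_rel s m}"
      by (rule closedin_related_unit_metrics[OF G words_graph(4)[OF p] words_graph(3)[OF p] K'c])
    ultimately show "closedin (case i of (G, c) \<Rightarrow> metric_simplex G)
        {x. (i, x) \<in> {z \<in> topspace (sum_topology (\<lambda>(G, c). metric_simplex G)
        (SIGMA G : one_loop_graphs s. colorings m G)). ?\<pi> z \<in> ?U}}"
      by (simp only: i prod.case)
  qed auto
  moreover have "?U \<subseteq> topspace (MCG1 s m)"
    using continuous_map_image_subset_topspace[OF continuous_cell_map[OF p]] Ks by fastforce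
  ultimately show "closedin (MCG1 s m) ?U"
    using quotient_map_MCG1 unfolding quotient_map_closedin by blast
qed

end

section \<open>Halves of a folded edge\<close>

lemma simplex_interior_1_iff:
  "x \<in> simplex_interior (Suc 0) \<longleftrightarrow> 0 < x 0 \<and> 0 < x 1 \<and> (\<forall>i>1. x i = 0) \<and> x 0 + x 1 = 1"
proof -
  have "(\<forall>i\<le>Suc 0. 0 < x i) \<longleftrightarrow> 0 < x 0 \<and> 0 < x 1" by (auto simp: le_Suc_eq)
  then show ?thesis by (simp add: simplex_interior_iff)
qed

lemma standard_simplex_1_iff:
  "x \<in> standard_simplex (Suc 0) \<longleftrightarrow> 0 \<le> x 0 \<and> 0 \<le> x 1 \<and> (\<forall>i>1. x i = 0) \<and> x 0 + x 1 = 1"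
proof -
  have "(\<forall>i\<le>Suc 0. 0 \<le> x i) \<longleftrightarrow> 0 \<le> x 0 \<and> 0 \<le> x 1" by (auto simp: le_Suc_eq)
  then show ?thesis by (simp add: standard_simplex_iff)
qed

lemma eq_barycenter_1:
  assumes "x \<in> standard_simplex (Suc 0)" "x 0 = x 1"
  shows "x = barycenter 1"
proof
  fix i
  have "x 0 = 1 / 2" "x 1 = 1 / 2" "\<forall>i>1. x i = 0" using assms by (auto simp: standard_simplex_1_iff)
  then show "x i = barycenter 1 i"
    by (cases "i = 0"; cases "i = 1") (auto simp: barycenter_def)
qed

lemma standard_simplex_0_eq: "standard_simplex 0 = simplex_interior 0"
  by (auto simp: standard_simplex_iff simplex_interior_iff)

text \<open>An edge of the moduli space whose two edges carry the same color is folded at its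
  midpoint. It is divided into the midpoint (tag 2) and one half (tag 3).\<close>

definition subcell :: "nat \<Rightarrow> (nat \<Rightarrow> real) \<Rightarrow> nat \<Rightarrow> real" where
  "subcell t x = (if t = 2 then barycenter 1
     else if t = 3 then (\<lambda>i. if i = 0 then x 0 + x 1 / 2 else if i = 1 then x 1 / 2 else 0)
     else x)"

lemma subcell_simps [simp]:
  "subcell 0 x = x" "subcell (Suc 0) x = x" "subcell 2 x = barycenter 1"
  "subcell 3 x 0 = x 0 + x 1 / 2" "subcell 3 x (Suc 0) = x 1 / 2" "i > 1 \<Longrightarrow> subcell 3 x i = 0"
  by (simp_all add: subcell_def)

lemma subcell_3_simplex: "x \<in> standard_simplex (Suc 0) \<Longrightarrow> subcell 3 x \<in> standard_simplex (Suc 0)"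
  by (simp add: standard_simplex_1_iff)

text \<open>\<open>subcell 3\<close> is the affine map that fixes the end \<open>(1, 0)\<close> and
  sends \<open>(0, 1)\<close> to the midpoint. Its open image is the half where coordinate 0
  dominates; the other half is the mirror image.\<close>

lemma subcell_3_interior:
  assumes "x \<in> simplex_interior (Suc 0)"
  shows "subcell 3 x \<in> simplex_interior (Suc 0)" "subcell 3 x 0 > subcell 3 x 1"
  using assms by (simp_all add: simplex_interior_1_iff)

lemma subcell_3_surj:
  assumes "y \<in> simplex_interior (Suc 0)" "y 0 > y 1"
  obtains x where "x \<in> simplex_interior (Suc 0)" "y = subcell 3 x"
proof -
  define x where "x i = (if i = 0 then y 0 - y 1 else if i = 1 then 2 * y 1 else 0)" for i :: nat
  have "x \<in> simplex_interior (Suc 0)" using assms by (simp add: simplex_interior_1_iff x_def)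
  moreover have "y = subcell 3 x"
  proof
    fix i show "y i = subcell 3 x i"
      using assms(1) by (cases "i = 0"; cases "i = 1") (auto simp: simplex_interior_1_iff x_def)
  qed
  ultimately show ?thesis by (rule that)
qed

lemma subcell_3_inj:
  assumes "x \<in> simplex_interior (Suc 0)" "y \<in> simplex_interior (Suc 0)" "subcell 3 x = subcell 3 y"
  shows "x = y"
proof
  fix i
  have "subcell 3 x (Suc 0) = subcell 3 y (Suc 0)" using assms(3) by simp
  then have 1: "x 1 = y 1" by simp
  moreover have "x 0 = y 0" using assms(1,2) 1 by (simp add: simplex_interior_1_iff)
  moreover have "x i = y i" if "i > 1" using assms(1,2) that by (simp add: simplex_interior_1_iff)
  ultimately show "x i = y i" by (cases "i = 0"; cases "i = 1") auto
qed

context moduli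
begin

definition fixed_words :: "nat \<Rightarrow> ((nat \<Rightarrow> nat) \<times> (nat \<Rightarrow> nat)) set" where
  "fixed_words k = {p \<in> words s m k. flip s k p = p}"

text \<open>Which representative of a free orbit is taken does not matter; a definite choice makes
  \<open>cells\<close> a single set.\<close>

definition half_words :: "nat \<Rightarrow> ((nat \<Rightarrow> nat) \<times> (nat \<Rightarrow> nat)) set" where
  "half_words k = (SOME R. R \<subseteq> words s m k \<and>
     (\<forall>p\<in>words s m k. flip s k p \<noteq> p \<longrightarrow> (p \<in> R \<longleftrightarrow> flip s k p \<notin> R)) \<and>
     (\<forall>p\<in>R. flip s k p \<noteq> p) \<and> card (words s m k) = 2 * card R + card (fixed_words k))"

lemma half_words:
  shows "half_words k \<subseteq> words s m k"
    and "p \<in> words s m k \<Longrightarrow> flip s k p \<noteq> p \<Longrightarrow> p \<in> half_words k \<longleftrightarrow> flip s k p \<notin> half_words k"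
    and "p \<in> half_words k \<Longrightarrow> flip s k p \<noteq> p"
    and "card (words s m k) = 2 * card (half_words k) + card (fixed_words k)"
proof -
  have "\<exists>R. R \<subseteq> words s m k \<and>
     (\<forall>p\<in>words s m k. flip s k p \<noteq> p \<longrightarrow> (p \<in> R \<longleftrightarrow> flip s k p \<notin> R)) \<and>
     (\<forall>p\<in>R. flip s k p \<noteq> p) \<and> card (words s m k) = 2 * card R + card (fixed_words k)"
  proof (rule involution_fundamental_domain[of "words s m k" "flip s k",
        OF finite_words flip_words(1)[OF s] flip_words(2)[OF s]])
    fix R assume R: "R \<subseteq> words s m k"
      "\<And>p. p \<in> words s m k \<Longrightarrow> flip s k p \<noteq> p \<Longrightarrow> p \<in> R \<longleftrightarrow> flip s k p \<notin> R"
      "\<And>p. p \<in> R \<Longrightarrow> flip s k p \<noteq> p"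
      "card (words s m k) = 2 * card R + card {p \<in> words s m k. flip s k p = p}"
    show ?thesis
      unfolding fixed_words_def by (intro exI[of _ R] conjI ballI impI)
        (rule R(1), rule R(2), assumption+, rule R(3), assumption, rule R(4))
  qed
  from someI_ex[OF this, folded half_words_def]
  have *: "half_words k \<subseteq> words s m k"
    "\<forall>p\<in>words s m k. flip s k p \<noteq> p \<longrightarrow> (p \<in> half_words k \<longleftrightarrow> flip s k p \<notin> half_words k)"
    "\<forall>p\<in>half_words k. flip s k p \<noteq> p" "card (words s m k) = 2 * card (half_words k) + card (fixed_words k)"
    by simp_all
  show "half_words k \<subseteq> words s m k" by (rule *(1))
  show "p \<in> words s m k \<Longrightarrow> flip s k p \<noteq> p \<Longrightarrow> p \<in> half_words k \<longleftrightarrow> flip s k p \<notin> half_words k"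
    using *(2) by metis
  show "p \<in> half_words k \<Longrightarrow> flip s k p \<noteq> p" using *(3) by metis
  show "card (words s m k) = 2 * card (half_words k) + card (fixed_words k)" by (rule *(4))
qed

text \<open>Tag 0 marks one representative of each free orbit of the reflection, tag 1 the graphs with
  one vertex.\<close>

definition cells :: "(nat \<times> nat \<times> (nat \<Rightarrow> nat) \<times> (nat \<Rightarrow> nat)) set" where
  "cells = Pair 0 ` (SIGMA k:{2..s}. half_words k) \<union> (\<lambda>p. (1, 1, p)) ` words s m 1 \<union>
     (\<lambda>p. (2, 2, p)) ` fixed_words 2 \<union> (\<lambda>p. (3, 2, p)) ` fixed_words 2"

definition cell_dim :: "nat \<times> nat \<times> (nat \<Rightarrow> nat) \<times> (nat \<Rightarrow> nat) \<Rightarrow> nat" where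
  "cell_dim = (\<lambda>(t, k, p). if t = 2 then 0 else k - 1)"

definition char_map :: "nat \<times> nat \<times> (nat \<Rightarrow> nat) \<times> (nat \<Rightarrow> nat) \<Rightarrow> (nat \<Rightarrow> real) \<Rightarrow> colored_metric_graph set" where
  "char_map = (\<lambda>(t, k, p) x. cell_map s m k p (subcell t x))"

lemma cells_cases [consumes 1, case_names free vertex midpoint half]:
  assumes "(t, k, p) \<in> cells"
  obtains "t = 0" "k \<in> {2..s}" "p \<in> half_words k"
    | "t = 1" "k = 1" "p \<in> words s m 1"
    | "t = 2" "k = 2" "p \<in> fixed_words 2"
    | "t = 3" "k = 2" "p \<in> fixed_words 2"
  using assms unfolding cells_def by blast

lemma cells_words:
  assumes "(t, k, p) \<in> cells"
  shows "p \<in> words s m k"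
  using assms
proof (cases rule: cells_cases)
  case free
  then show ?thesis using half_words(1) by blast
qed (simp_all add: fixed_words_def)

lemma cells_tags:
  assumes "(t, k, p) \<in> cells"
  shows "t = 0 \<Longrightarrow> p \<in> half_words k" "t \<noteq> 0 \<Longrightarrow> k = 1 \<Longrightarrow> t = 1"
    "t \<noteq> 0 \<Longrightarrow> k = 2 \<Longrightarrow> t = 2 \<or> t = 3" "t = 3 \<Longrightarrow> k = 2"
  using assms by (cases rule: cells_cases; simp)+

lemma subcell_half_asymmetric:
  assumes "(3, k, p) \<in> cells" "x \<in> simplex_interior (cell_dim (3, k, p))"
  shows "subcell 3 x 0 > subcell 3 x 1"
proof (rule subcell_3_interior(2))
  have "k = 2" using cells_tags(4)[OF assms(1)] by simp
  then show "x \<in> simplex_interior (Suc 0)" using assms(2) by (simp add: cell_dim_def)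
qed

lemma subcell_simplex:
  assumes "(t, k, p) \<in> cells" "x \<in> standard_simplex (cell_dim (t, k, p))"
  shows "subcell t x \<in> standard_simplex (k - 1)"
  using assms(1)
proof (cases rule: cells_cases)
  case midpoint
  then show ?thesis using barycenter_interior[of 1] simplex_interior_subset[of 1] by auto
next
  case half
  then show ?thesis using assms(2) subcell_3_simplex by (simp add: cell_dim_def)
qed (use assms(2) in \<open>simp_all add: cell_dim_def\<close>)

lemma subcell_interior:
  assumes "(t, k, p) \<in> cells" "x \<in> simplex_interior (cell_dim (t, k, p))"
  shows "subcell t x \<in> simplex_interior (k - 1)"
  using assms(1)
proof (cases rule: cells_cases)
  case midpoint
  then show ?thesis using barycenter_interior[of 1] by simp
next
  case half
  then show ?thesis using assms(2) subcell_3_interior by (simp add: cell_dim_def)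
qed (use assms(2) in \<open>simp_all add: cell_dim_def\<close>)

lemma continuous_subcell:
  assumes "(t, k, p) \<in> cells"
  shows "continuous_map (simplex_space (cell_dim (t, k, p))) (simplex_space (k - 1)) (subcell t)"
proof (rule continuous_map_into_powertop)
  fix i
  show "continuous_map (simplex_space (cell_dim (t, k, p))) euclideanreal (\<lambda>x. subcell t x i)"
    unfolding subcell_def
    by (cases "t = 2"; cases "t = 3"; cases "i = 0"; cases "i = 1")
      (auto intro!: continuous_intros continuous_map_coordinate)
qed (use subcell_simplex[OF assms] in auto)

lemma continuous_char_map:
  assumes "(t, k, p) \<in> cells"
  shows "continuous_map (simplex_space (cell_dim (t, k, p))) (MCG1 s m) (char_map (t, k, p))"
  using continuous_map_compose[OF continuous_subcell[OF assms] continuous_cell_map[OF cells_words[OF assms]]]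
  by (simp add: char_map_def o_def)

lemma closed_char_map:
  assumes "(t, k, p) \<in> cells"
  shows "closed_map (simplex_space (cell_dim (t, k, p))) (MCG1 s m) (char_map (t, k, p))"
proof -
  have "closed_map (simplex_space (cell_dim (t, k, p))) (simplex_space (k - 1)) (subcell t)"
    using compactin_standard_simplex
    by (intro T1_Spaces.continuous_imp_closed_map continuous_subcell[OF assms] Hausdorff_space_simplex)
      (simp add: compact_space_subtopology)
  from closed_map_compose[OF this closed_cell_map[OF cells_words[OF assms]]]
  show ?thesis by (simp add: char_map_def o_def)
qed

section \<open>Partition into open cells and their boundaries\<close>

lemma words_le:
  assumes "p \<in> words s m k"
  shows "k \<le> s"
proof -
  have "fst p ` {1..s} = {..<k}"
    using words_graph(2)[OF assms] by (simp add: based_labellings_def labellings_def)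
  then show ?thesis using card_image_le[of "{1..s}" "fst p"] by simp
qed

lemma reverse_interior:
  assumes "k \<ge> 1" "x \<in> simplex_interior (k - 1)" "reverse k x \<in> standard_simplex (k - 1)"
  shows "reverse k x \<in> simplex_interior (k - 1)"
  using assms by (simp add: standard_simplex_pred_iff simplex_interior_pred_iff) (simp add: reverse_def)

text \<open>A word in a free orbit, or else its reflection with reversed lengths, is the chosen one.
  A fixed word has at most two edges, and for two edges the comparison of their lengths decides
  between midpoint and half.\<close>

lemma cells_cover:
  assumes "z \<in> topspace (MCG1 s m)"
  obtains i x where "i \<in> cells" "x \<in> simplex_interior (cell_dim i)" "z = char_map i x"
proof -
  note result = that
  obtain k p x where p: "p \<in> words s m k" and x: "x \<in> simplex_interior (k - 1)" and z: "z = cell_map s m k p x"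
    using MCG1_points[OF assms] by blast
  have k: "k \<ge> 1" "k \<le> s" using words_graph(1)[OF p] words_le[OF p] by auto
  have xs: "x \<in> standard_simplex (k - 1)" using x simplex_interior_subset by blast
  have z': "z = cell_map s m k (flip s k p) (reverse k x)" using cell_map_flip(1)[OF p xs] z by simp
  have rx: "reverse k x \<in> simplex_interior (k - 1)"
    by (rule reverse_interior[OF k(1) x cell_map_flip(2)[OF p xs]])
  show ?thesis
  proof (cases "flip s k p = p")
    case False
    then have "k \<noteq> 1" using flip_words_1[of p s m] p by auto
    then have k2: "k \<in> {2..s}" using k by auto
    have cell: "(0, k, q) \<in> cells" if "q \<in> half_words k" for q
      unfolding cells_def using k2 that by blast
    show ?thesis
    proof (cases "p \<in> half_words k")
      case True
      show ?thesis
        by (rule result[OF cell[OF True], of x]) (use x z in \<open>simp_all add: cell_dim_def char_map_def\<close>)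
    next
      case False
      then have "flip s k p \<in> half_words k" using half_words(2)[OF p] \<open>flip s k p \<noteq> p\<close> by blast
      from result[OF cell[OF this], of "reverse k x"] show ?thesis
        using rx z' by (simp add: cell_dim_def char_map_def)
    qed
  next
    case True
    then have "\<not> k \<ge> 3" using flip_words_ge3[OF p] by blast
    then consider "k = 1" | "k = 2" using k by linarith
    then show ?thesis
    proof cases
      case 1
      then have "(1, 1, p) \<in> cells" unfolding cells_def using p by blast
      from result[OF this, of x] show ?thesis using x z 1 by (simp add: cell_dim_def char_map_def)
    next
      case 2
      then have fixp: "p \<in> fixed_words 2" using p True by (simp add: fixed_words_def)
      then have c2: "(2, 2, p) \<in> cells" and c3: "(3, 2, p) \<in> cells" unfolding cells_def by blast+
      have half: ?thesis if y: "y \<in> simplex_interior (Suc 0)" "y 0 > y 1" "z = cell_map s m 2 p y" for y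
      proof -
        obtain x' where x': "x' \<in> simplex_interior (Suc 0)" "y = subcell 3 x'"
          using subcell_3_surj[OF y(1,2)] by blast
        from result[OF c3, of x'] show ?thesis using x' y(3) by (simp add: cell_dim_def char_map_def)
      qed
      have x1: "x \<in> simplex_interior (Suc 0)" "x \<in> standard_simplex (Suc 0)" using x xs 2 by simp_all
      consider "x 0 = x 1" | "x 0 > x 1" | "x 0 < x 1" by linarith
      then show ?thesis
      proof cases
        case 1
        then have xb: "x = barycenter 1" using eq_barycenter_1[OF x1(2)] by blast
        from result[OF c2, of "barycenter 0"] show ?thesis
          using z \<open>k = 2\<close> xb barycenter_interior[of 0] by (simp add: cell_dim_def char_map_def)
      next
        case 2
        show ?thesis by (rule half[OF x1(1) 2]) (use z \<open>k = 2\<close> in simp)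
      next
        case 3
        show ?thesis
          by (rule half[of "reverse 2 x"]) (use rx z' \<open>k = 2\<close> True 3 in \<open>simp_all add: reverse_def\<close>)
      qed
    qed
  qed
qed

text \<open>Equal points have words and lengths that agree up to reflection. A free orbit contains
  only one chosen word; on an edge with fixed word, the sign of the difference of the two lengths
  separates midpoint, chosen half and mirror image.\<close>

lemma cells_unique:
  assumes i: "(t, k, p) \<in> cells" "x \<in> simplex_interior (cell_dim (t, k, p))"
    and j: "(u, n, q) \<in> cells" "y \<in> simplex_interior (cell_dim (u, n, q))"
    and eq: "char_map (t, k, p) x = char_map (u, n, q) y"
  shows "(u, n, q) = (t, k, p) \<and> y = x"
proof -
  let ?x = "subcell t x" and ?y = "subcell u y"
  have p: "p \<in> words s m k" and q: "q \<in> words s m n" using cells_words i(1) j(1) by blast+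
  have nk: "n = k" and qp: "q = p \<and> ?y = ?x \<or> q = flip s k p \<and> ?y = reverse k ?x"
    using cell_map_interior_eq[OF p subcell_interior[OF i] q subcell_interior[OF j]] eq
    by (simp_all add: char_map_def)
  \<comment> \<open>Being fixed by the reflection is shared by a word and its reflection, and it
    separates tag 0 from the other tags.\<close>
  have fixed_iff: "t' = 0 \<longleftrightarrow> flip s k' p' \<noteq> p'" if "(t', k', p') \<in> cells" for t' k' p'
    using that
  proof (cases rule: cells_cases)
    case free
    then show ?thesis using half_words(3) by simp
  next
    case vertex
    then show ?thesis using flip_words_1 by simp
  qed (simp_all add: fixed_words_def)
  have y0: "?y 0 = ?y 1" if "u = 2" using that by (simp add: barycenter_def)
  have x0: "?x 0 = ?x 1" if "t = 2" using that by (simp add: barycenter_def)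
  have y3: "?y 0 > ?y 1" if "u = 3"
    using subcell_half_asymmetric j unfolding that by blast
  have x3: "?x 0 > ?x 1" if "t = 3"
    using subcell_half_asymmetric i unfolding that by blast
  have main: "u = t \<and> q = p \<and> ?y = ?x"
  proof (cases "t = 0")
    case True
    then have nf: "flip s k p \<noteq> p" and ph: "p \<in> half_words k"
      using fixed_iff[OF i(1)] cells_tags(1)[OF i(1)] by simp_all
    from qp show ?thesis
    proof
      assume a: "q = p \<and> ?y = ?x"
      then have "u = 0" using fixed_iff[OF j(1)] nf nk by simp
      with a True show ?thesis by simp
    next
      assume a: "q = flip s k p \<and> ?y = reverse k ?x"
      have "flip s k q \<noteq> q" using a nf flip_words(2)[OF s p] by metis
      then have "u = 0" using fixed_iff[OF j(1)] nk by simp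
      then have "q \<in> half_words k" using cells_tags(1)[OF j(1)] nk by simp
      then have False using a half_words(2)[OF p nf] ph by blast
      then show ?thesis ..
    qed
  next
    case False
    then have fp: "flip s k p = p" using fixed_iff[OF i(1)] by simp
    then have q: "q = p" using qp by auto
    then have u0: "u \<noteq> 0" using fixed_iff[OF j(1)] fp nk by simp
    from i(1) show ?thesis
    proof (cases rule: cells_cases)
      case vertex
      then have "u = 1" using cells_tags(2)[OF j(1) u0] nk by simp
      moreover have "reverse 1 ?x = ?x"
      proof
        fix i show "reverse 1 ?x i = ?x i"
          using subcell_interior[OF i] vertex by (auto simp: reverse_def simplex_interior_iff)
      qed
      ultimately show ?thesis using qp q vertex(1,2) by metis
    next
      case midpoint
      then have u: "u = 2 \<or> u = 3" using cells_tags(3)[OF j(1) u0] nk by simp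
      have "?x 0 = ?x 1" using x0 midpoint by simp
      moreover have "?y 0 = ?x 0 \<and> ?y 1 = ?x 1 \<or> ?y 0 = ?x 1 \<and> ?y 1 = ?x 0"
      proof -
        have "reverse k ?x 0 = ?x 1" "reverse k ?x 1 = ?x 0"
          unfolding midpoint(2) by (simp_all add: reverse_def)
        with qp show ?thesis by metis
      qed
      ultimately have "?y 0 = ?y 1" by metis
      then have "u = 2" using y3 u by fastforce
      then show ?thesis using midpoint q by simp
    next
      case half
      then have u: "u = 2 \<or> u = 3" using cells_tags(3)[OF j(1) u0] nk by simp
      have "?y = ?x"
      proof (rule ccontr)
        assume "?y \<noteq> ?x"
        then have "?y = reverse k ?x" using qp by blast
        then have "?y 0 = ?x 1" "?y 1 = ?x 0" unfolding half(2) by (simp_all add: reverse_def)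
        then have "?y 0 < ?y 1" using x3[OF half(1)] by metis
        then show False using u y0 y3 by fastforce
      qed
      moreover from this have "?y 0 > ?y 1" using x3[OF half(1)] by metis
      then have "u = 3" using u y0 by fastforce
      ultimately show ?thesis using half(1) q by metis
    qed (use False in simp)
  qed
  have "y = x"
  proof -
    have t: "subcell t y = subcell t x" "y \<in> simplex_interior (cell_dim (t, k, p))"
      using main j(2) nk by auto
    from i(1) show ?thesis
    proof (cases rule: cells_cases)
      case midpoint
      have *: "z = barycenter 0" if "z \<in> simplex_interior 0" for z
        using that by (auto simp: simplex_interior_iff barycenter_def)
      have "x \<in> simplex_interior 0" "y \<in> simplex_interior 0"
        using i(2) t(2) midpoint by (simp_all add: cell_dim_def)
      then show ?thesis using *[of x] *[of y] by metis
    next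
      case half
      then have "x \<in> simplex_interior (Suc 0)" "y \<in> simplex_interior (Suc 0)" "subcell 3 y = subcell 3 x"
        using i(2) t by (simp_all add: cell_dim_def)
      then show ?thesis using subcell_3_inj by metis
    qed (use t in simp_all)
  qed
  with main nk show ?thesis by simp
qed

text \<open>Either some edge length vanishes, and then the point has fewer nonzero edges and lies in
  a smaller cell, or all lengths are positive, which happens only at the midpoint end of a half
  edge.\<close>

lemma char_map_boundary:
  assumes i: "(t, k, p) \<in> cells"
    and x: "x \<in> standard_simplex (cell_dim (t, k, p))" "x \<notin> simplex_interior (cell_dim (t, k, p))"
  obtains j y where "j \<in> cells" "cell_dim j < cell_dim (t, k, p)" "y \<in> simplex_interior (cell_dim j)"
    "char_map (t, k, p) x = char_map j y"
proof -
  have t2: "t \<noteq> 2" using x standard_simplex_0_eq by (auto simp: cell_dim_def)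
  have p: "p \<in> words s m k" by (rule cells_words[OF i])
  have k: "k \<ge> 1" by (rule words_graph(1)[OF p])
  have dim: "cell_dim (t, k, p) = k - 1" using t2 by (simp add: cell_dim_def)
  have xs: "subcell t x \<in> standard_simplex (k - 1)" by (rule subcell_simplex[OF i x(1)])
  show ?thesis
  proof (cases "\<exists>j<k. subcell t x j = 0")
    case True
    then obtain j where j: "j < k" "subcell t x j = 0" by blast
    have "char_map (t, k, p) x \<in> topspace (MCG1 s m)"
      using continuous_map_image_subset_topspace[OF continuous_char_map[OF i]] x(1) by fastforce
    then obtain c y where c: "c \<in> cells" "y \<in> simplex_interior (cell_dim c)" "char_map (t, k, p) x = char_map c y"
      by (rule cells_cover)
    obtain u n q where c_eq: "c = (u, n, q)" by (cases c)
    have q: "q \<in> words s m n" using cells_words c(1) c_eq by blast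
    have cu: "(u, n, q) \<in> cells" "y \<in> simplex_interior (cell_dim (u, n, q))"
      using c c_eq by simp_all
    have eq: "cell_map s m k p (subcell t x) = cell_map s m n q (subcell u y)"
      using c(3) by (simp add: c_eq char_map_def)
    have "n = card {j. j < k \<and> subcell t x j \<noteq> 0}"
      by (rule cell_map_support[OF p xs q subcell_interior[OF cu] eq, symmetric])
    also have "\<dots> \<le> card ({..<k} - {j})"
      using j(2) by (intro card_mono) auto
    also have "\<dots> < k" using j(1) by simp
    finally have "n < k" .
    moreover have "cell_dim c \<le> n - 1" by (simp add: c_eq cell_dim_def)
    ultimately have "cell_dim c < cell_dim (t, k, p)" using words_graph(1)[OF q] dim by linarith
    from that[OF c(1) this c(2,3)] show ?thesis .
  next
    case False
    \<comment> \<open>Where the parametrization is the identity, nonvanishing coordinates would put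
      \<open>x\<close> in the interior.\<close>
    have id: ?thesis if "subcell t x = x"
    proof -
      have nz: "x j \<noteq> 0" if "j < k" for j using False that \<open>subcell t x = x\<close> by metis
      have st: "(\<forall>i<k. 0 \<le> x i) \<and> (\<forall>i\<ge>k. x i = 0) \<and> (\<Sum>i<k. x i) = 1"
        using x(1) standard_simplex_pred_iff[OF k, of x] by (simp add: dim)
      then have "\<forall>i<k. 0 < x i" using nz by (metis less_le)
      with st have "x \<in> simplex_interior (cell_dim (t, k, p))"
        using simplex_interior_pred_iff[OF k, of x] by (simp add: dim)
      with x(2) show ?thesis ..
    qed
    from i show ?thesis
    proof (cases rule: cells_cases)
      case half
      \<comment> \<open>The end \<open>x 1 = 0\<close> of a half edge has a vanishing length and is
        already settled. The remaining end has \<open>x 0 = 0\<close> and is the midpoint, a cell of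
        its own.\<close>
      then have k2: "k = 2" and x1: "x \<in> standard_simplex (Suc 0)" "x \<notin> simplex_interior (Suc 0)"
        using x by (simp_all add: cell_dim_def)
      have "\<not> (1 < k \<and> subcell t x 1 = 0)" using False by blast
      then have "subcell 3 x 1 \<noteq> 0" using half(1,2) by simp
      then have "x 1 \<noteq> 0" by simp
      then have "x 0 = 0" using x1 by (auto simp: standard_simplex_1_iff simplex_interior_1_iff less_le)
      then have "subcell 3 x = barycenter 1"
        using subcell_3_simplex[OF x1(1)] by (intro eq_barycenter_1) simp_all
      moreover have "(2, 2, p) \<in> cells" using half unfolding cells_def by blast
      ultimately show ?thesis
        using that[of "(2, 2, p)" "barycenter 0"] half barycenter_interior[of 0]
        by (simp add: cell_dim_def char_map_def)
    next
      case midpoint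
      then show ?thesis using t2 by simp
    next
      case free
      then show ?thesis by (intro id) simp
    next
      case vertex
      then show ?thesis by (intro id) simp
    qed
  qed
qed

section \<open>Evaluation of the Euler characteristic\<close>

lemma finite_half_words: "finite (half_words k)" and finite_fixed_words: "finite (fixed_words k)"
  using finite_words[of s m k] half_words(1)[of k] by (auto simp: fixed_words_def intro: finite_subset)

lemma finite_cells: "finite cells"
  unfolding cells_def using finite_words finite_half_words finite_fixed_words
  by (intro finite_UnI finite_imageI finite_SigmaI) auto

theorem has_euler_MCG1: "has_euler (MCG1 s m) {} (\<Sum>i\<in>cells. (-1) ^ cell_dim i)"
proof (rule has_euler_finite_cell_complex[OF finite_cells, of _ _ char_map])
  have sub: "char_map i ` standard_simplex (cell_dim i) \<subseteq> topspace (MCG1 s m)" if "i \<in> cells" for i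
    using that continuous_map_image_subset_topspace[OF continuous_char_map] by (cases i) fastforce
  show "continuous_map (simplex_space (cell_dim i)) (MCG1 s m) (char_map i)" if "i \<in> cells" for i
    using that continuous_char_map by (cases i) blast
  show "closed_map (simplex_space (cell_dim i)) (MCG1 s m) (char_map i)" if "i \<in> cells" for i
    using that closed_char_map by (cases i) blast
  show "inj_on (char_map i) (simplex_interior (cell_dim i))" if "i \<in> cells" for i
  proof (rule inj_onI)
    fix x y assume *: "x \<in> simplex_interior (cell_dim i)" "y \<in> simplex_interior (cell_dim i)" "char_map i x = char_map i y"
    obtain t k p where i: "i = (t, k, p)" by (cases i)
    have "(t, k, p) = (t, k, p) \<and> y = x" by (rule cells_unique) (use that * in \<open>simp_all add: i\<close>)
    then show "x = y" by simp
  qed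
  show "char_map i ` simplex_interior (cell_dim i) \<inter> char_map j ` simplex_interior (cell_dim j) = {}"
    if "i \<in> cells" "j \<in> cells" "i \<noteq> j" for i j
  proof (rule ccontr)
    assume "\<not> ?thesis"
    then obtain x y where *: "x \<in> simplex_interior (cell_dim i)" "y \<in> simplex_interior (cell_dim j)"
      "char_map i x = char_map j y" by blast
    obtain t k p where i: "i = (t, k, p)" by (cases i)
    obtain u n q where j: "j = (u, n, q)" by (cases j)
    have "(u, n, q) = (t, k, p) \<and> y = x" by (rule cells_unique) (use that * in \<open>simp_all add: i j\<close>)
    with that(3) i j show False by simp
  qed
  show "topspace (MCG1 s m) = (\<Union>i\<in>cells. char_map i ` simplex_interior (cell_dim i))"
  proof (intro equalityI subsetI)
    fix z assume "z \<in> topspace (MCG1 s m)"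
    then show "z \<in> (\<Union>i\<in>cells. char_map i ` simplex_interior (cell_dim i))"
      by (rule cells_cover) blast
  next
    fix z assume "z \<in> (\<Union>i\<in>cells. char_map i ` simplex_interior (cell_dim i))"
    then obtain i x where "i \<in> cells" "x \<in> simplex_interior (cell_dim i)" "z = char_map i x" by blast
    then show "z \<in> topspace (MCG1 s m)" using sub[of i] simplex_interior_subset by blast
  qed
  show "char_map i ` (standard_simplex (cell_dim i) - simplex_interior (cell_dim i)) \<subseteq>
      (\<Union>j\<in>{j \<in> cells. cell_dim j < cell_dim i}. char_map j ` simplex_interior (cell_dim j))" if iC: "i \<in> cells" for i
  proof
    fix z assume "z \<in> char_map i ` (standard_simplex (cell_dim i) - simplex_interior (cell_dim i))"
    then obtain x where x: "x \<in> standard_simplex (cell_dim i)" "x \<notin> simplex_interior (cell_dim i)" "z = char_map i x"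
      by blast
    obtain t k p where i: "i = (t, k, p)" by (cases i)
    obtain j y where "j \<in> cells" "cell_dim j < cell_dim (t, k, p)" "y \<in> simplex_interior (cell_dim j)"
      "char_map (t, k, p) x = char_map j y"
      by (rule char_map_boundary[OF iC[unfolded i] x(1,2)[unfolded i]])
    with x(3) i have "j \<in> cells" "cell_dim j < cell_dim i" "y \<in> simplex_interior (cell_dim j)" "z = char_map j y"
      by simp_all
    then show "z \<in> (\<Union>j\<in>{j \<in> cells. cell_dim j < cell_dim i}. char_map j ` simplex_interior (cell_dim j))"
      by blast
  qed
qed

text \<open>Midpoints and half edges are indexed by the same words and contribute with opposite
  signs. The graphs with one vertex give \<open>m\<close>, since \<open>Stirling s 1\<close> is
  one.\<close>

lemma sum_cells: "(\<Sum>i\<in>cells. (-1) ^ cell_dim i) =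
    (\<Sum>k=2..s. (-1) ^ (k - 1) * int (card (half_words k))) + int m"
proof -
  let ?f = "\<lambda>i. (-1) ^ cell_dim i :: int"
  let ?A = "Pair 0 ` (SIGMA k:{2..s}. half_words k)" and ?B = "(\<lambda>p. (1::nat, 1::nat, p)) ` words s m 1"
  let ?C = "(\<lambda>p. (2::nat, 2::nat, p)) ` fixed_words 2" and ?D = "(\<lambda>p. (3::nat, 2::nat, p)) ` fixed_words 2"
  have fin: "finite ?A" "finite ?B" "finite ?C" "finite ?D"
    using finite_words finite_half_words finite_fixed_words by (auto intro!: finite_imageI finite_SigmaI)
  have "(\<Sum>i\<in>cells. ?f i) = sum ?f ?A + sum ?f ?B + sum ?f ?C + sum ?f ?D"
  proof -
    have d: "?A \<inter> ?B = {}" "(?A \<union> ?B) \<inter> ?C = {}" "(?A \<union> ?B \<union> ?C) \<inter> ?D = {}" by auto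
    show ?thesis
      unfolding cells_def
      sum.union_disjoint[OF finite_UnI[OF finite_UnI[OF fin(1,2)] fin(3)] fin(4) d(3)]
      sum.union_disjoint[OF finite_UnI[OF fin(1,2)] fin(3) d(2)]
      sum.union_disjoint[OF fin(1,2) d(1)] by (rule refl)
  qed
  also have "sum ?f ?A = (\<Sum>z\<in>(SIGMA k:{2..s}. half_words k). ?f (0, z))"
    by (rule sum.reindex_cong[of "Pair 0"]) (simp_all add: inj_on_def)
  also have "\<dots> = (\<Sum>(k, p)\<in>(SIGMA k:{2..s}. half_words k). (-1) ^ (k - 1))"
    by (rule sum.cong) (auto simp: cell_dim_def)
  also have "\<dots> = (\<Sum>k=2..s. \<Sum>p\<in>half_words k. (-1) ^ (k - 1))"
    by (rule sum.Sigma[symmetric]) (auto intro: finite_half_words)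
  also have "\<dots> = (\<Sum>k=2..s. (-1) ^ (k - 1) * int (card (half_words k)))"
    by (simp add: mult.commute)
  also have "sum ?f ?B = int m"
    using card_words[OF s, of 1 m] s Stirling_1[of "s - 1"]
    by (subst sum.reindex) (auto simp: inj_on_def cell_dim_def)
  also have "sum ?f ?C = int (card (fixed_words 2))"
    by (subst sum.reindex) (auto simp: inj_on_def cell_dim_def)
  also have "sum ?f ?D = - int (card (fixed_words 2))"
    by (subst sum.reindex) (auto simp: inj_on_def cell_dim_def)
  finally show ?thesis by simp
qed

lemma card_half_words_ge3:
  assumes "k \<ge> 3"
  shows "real (card (half_words k)) = real (Stirling s k) * (fact (k - 1) / 2) * real m ^ k"
proof -
  have "fixed_words k = {}" using flip_words_ge3[OF _ assms] by (auto simp: fixed_words_def)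
  then have "2 * card (half_words k) = Stirling s k * fact (k - 1) * m ^ k"
    using half_words(4)[of k] card_words[OF s, of k m] assms by simp
  then have "2 * real (card (half_words k)) = real (Stirling s k) * fact (k - 1) * real m ^ k"
    by (metis of_nat_fact of_nat_mult of_nat_numeral of_nat_power)
  then show ?thesis by simp
qed

text \<open>Of the \<open>Stirling s 2 * m ^ 2\<close> words with two edges, those with equal colors
  are fixed; the rest pair up. The power of two enters through
  \<open>Stirling s 2 = 2 ^ (s - 1) - 1\<close>.\<close>

lemma card_half_words_2:
  "real (card (half_words 2)) = (2 ^ (s - 1) - 1) * (real m * (real m - 1) / 2)"
proof -
  have "2 * card (half_words 2) + Stirling s 2 * m = Stirling s 2 * m ^ 2"
    using half_words(4)[of 2] card_words[OF s, of 2 m] card_flip_fixed_2[OF s, of m]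
    by (simp add: fixed_words_def)
  then have "2 * real (card (half_words 2)) + real (Stirling s 2) * real m = real (Stirling s 2) * real m ^ 2"
    by (metis of_nat_add of_nat_mult of_nat_numeral of_nat_power)
  moreover have "real (Stirling s 2) = 2 ^ (s - 1) - 1"
    using Stirling_2[of "s - 1"] s by (simp add: numeral_2_eq_2 of_nat_diff)
  ultimately show ?thesis by (simp add: power2_eq_square algebra_simps)
qed

text \<open>The \<open>-1\<close> in the value of \<open>Stirling s 2\<close> contributes
  \<open>m * (m - 1) / 2\<close>, which combines with the \<open>m\<close> one-vertex graphs to
  \<open>m * (m + 1) / 2\<close>.\<close>

lemma sum_half_words:
  "real_of_int ((\<Sum>k=2..s. (-1) ^ (k - 1) * int (card (half_words k))) + int m) =
    2 ^ (s - 1) * (real m * (1 - real m) / 2) + real m * (real m + 1) / 2 +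
    (\<Sum>k = 3..s. (-1) ^ (k - 1) * real (Stirling s k) * (fact (k - 1) / 2) * real m ^ k)"
proof -
  let ?g = "\<lambda>k. (-1) ^ (k - 1) * real (card (half_words k))"
  have "(\<Sum>k=2..s. ?g k) = - real (card (half_words 2)) + (\<Sum>k=3..s. ?g k)"
  \<comment> \<open>For \<open>s = 1\<close> the range contains no \<open>k = 2\<close>, but the
    separated term then vanishes because \<open>2 ^ 0 - 1 = 0\<close>.\<close>
  proof (cases "s = 1")
    case True
    then show ?thesis using card_half_words_2 by simp
  next
    case False
    then have "{2..s} = insert 2 {3..s}" using s by auto
    then show ?thesis by simp
  qed
  also have "(\<Sum>k=3..s. ?g k) =
      (\<Sum>k = 3..s. (-1) ^ (k - 1) * real (Stirling s k) * (fact (k - 1) / 2) * real m ^ k)"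
    by (intro sum.cong) (auto simp: card_half_words_ge3)
  finally show ?thesis
    unfolding card_half_words_2 by (simp add: field_simps)
qed

end

theorem proposition4p11:
  fixes s m :: nat
  assumes "s \<ge> 1" and "m \<ge> 1"
  shows "has_finite_betti_numbers (MCG1 s m) \<and>
    real_of_int (euler_characteristic (MCG1 s m)) =
      2 ^ (s - 1) * (real m * (1 - real m) / 2) + real m * (real m + 1) / 2 +
      (\<Sum>k = 3..s. (-1) ^ (k - 1) * real (Stirling s k) * (fact (k - 1) / 2) * real m ^ k)"
proof -
  interpret moduli s m by unfold_locales (rule assms(1))
  from has_euler_absolute[OF has_euler_MCG1]
  have "has_finite_betti_numbers (MCG1 s m)"
    and "euler_characteristic (MCG1 s m) = (\<Sum>k=2..s. (-1) ^ (k - 1) * int (card (half_words k))) + int m"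
    unfolding sum_cells by blast+
  then show ?thesis using sum_half_words by (simp only:)
qed

end
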